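(* Let $\mathcal{P}$ be a nice pointclass with the property of Baire. Let $X$ be a Peano continuum and $N\unlhd \pi_1(X)$ a normal subgroup of pointclass $\mathcal{P}$. If $\pi_1(X)/N$ is comonster then $\pi_1(X)/N$ is $\aleph_1$-comonster. In particular, if $\pi_1(X)$ is comonster, then $\pi_1(X)$ is $\aleph_1$-comonster.
   Context: A group $G$ is comonster if for every finite subset $S\subseteq G$ the normal closure $\langle\langle S\rangle\rangle$ is not equal to $G$; it is $\kappa$-comonster if $\langle\langle S\rangle\rangle\neq G$ for every $S\subseteq G$ of cardinality $<\kappa$. A Peano continuum is a path connected, locally path connected compact metrizable space. For a path connected metric space $X$ and $x\in X$, $L_x$ is the set of loops $[0,1]\to X$ based at $x$ with the sup metric. For $G\leq \pi_1(X,x)$, $\bigcup G\subseteq L_x$ is the set of all loops whose homotopy class lies in $G$; $G$ is of pointclass $\mathcal{P}$ if $\bigcup G$ belongs to $\mathcal{P}$ in $L_x$ (for a nice pointclass and a normal subgroup this does not depend on the basepoint, so one writes $\pi_1(X)$). A space is Polish if it is completely metrizable and separable; $L_x$ is Polish when $X$ is. A pointclass on Polish spaces assigns to each Polish space a collection of its subsets (of a given topological description). It is nice if it contains the closed sets and is closed under continuous images and preimages (between Polish spaces), countable intersections and finite unions. A subset $Y$ of a space $Z$ has the property of Baire (BP) if there is an open $O\subseteq Z$ with $Y\Delta O$ meager; a pointclass on Polish spaces has BP if each set in it has BP. *)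

theory Defs
  imports
    "HOL-Analysis.Analysis"
    "HOL-Algebra.Coset"
begin

unbundle cardinal_syntax

section \<open>Polish spaces and pointclasses\<close>

definition Polish_space :: "'a topology \<Rightarrow> bool" where
  "Polish_space Z \<longleftrightarrow> completely_metrizable_space Z \<and> separable_space Z"

definition nowhere_dense_in :: "'a topology \<Rightarrow> 'a set \<Rightarrow> bool" where
  "nowhere_dense_in Z A \<longleftrightarrow> A \<subseteq> topspace Z \<and> Z interior_of (Z closure_of A) = {}"

definition meager_in :: "'a topology \<Rightarrow> 'a set \<Rightarrow> bool" where
  "meager_in Z A \<longleftrightarrow> (\<exists>\<F>. countable \<F> \<and> (\<forall>B\<in>\<F>. nowhere_dense_in Z B) \<and> A = \<Union>\<F>)"

definition Baire_property_in :: "'a topology \<Rightarrow> 'a set \<Rightarrow> bool" where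
  "Baire_property_in Z A \<longleftrightarrow> (\<exists>U. openin Z U \<and> meager_in Z (sym_diff A U))"

text \<open>
  A pointclass ranges over all Polish spaces. A Polish space has at most the cardinality of the
  continuum, so every Polish space, of whatever type, is homeomorphic to one whose points are real
  numbers, with an arbitrary Polish topology on an arbitrary set of reals (in general not the
  subspace topology). It therefore suffices to specify a pointclass on topologies of type
  \<^typ>\<open>real topology\<close>. The values on topologies that are not Polish are irrelevant.
\<close>

type_synonym pointclass = "real topology \<Rightarrow> real set set"

definition is_pointclass :: "pointclass \<Rightarrow> bool" where
  "is_pointclass P \<longleftrightarrow> (\<forall>Z. Polish_space Z \<longrightarrow> P Z \<subseteq> Pow (topspace Z))"

definition nice_pointclass :: "pointclass \<Rightarrow> bool" where
  "nice_pointclass P \<longleftrightarrow>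
     is_pointclass P \<and>
     (\<forall>Z A. Polish_space Z \<and> closedin Z A \<longrightarrow> A \<in> P Z) \<and>
     (\<forall>Y Z f A. Polish_space Y \<and> Polish_space Z \<and> continuous_map Y Z f \<and> A \<in> P Y
        \<longrightarrow> f ` A \<in> P Z) \<and>
     (\<forall>Y Z f A. Polish_space Y \<and> Polish_space Z \<and> continuous_map Y Z f \<and> A \<in> P Z
        \<longrightarrow> {y \<in> topspace Y. f y \<in> A} \<in> P Y) \<and>
     (\<forall>Z (A :: nat \<Rightarrow> real set). Polish_space Z \<and> (\<forall>n. A n \<in> P Z) \<longrightarrow> (\<Inter>n. A n) \<in> P Z) \<and>
     (\<forall>Z A B. Polish_space Z \<and> A \<in> P Z \<and> B \<in> P Z \<longrightarrow> A \<union> B \<in> P Z)"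

definition pointclass_has_BP :: "pointclass \<Rightarrow> bool" where
  "pointclass_has_BP P \<longleftrightarrow> (\<forall>Z. Polish_space Z \<longrightarrow> (\<forall>A\<in>P Z. Baire_property_in Z A))"

text \<open>
  Membership of a subset of a Polish space of arbitrary type in a pointclass, by transport to a
  homeomorphic copy with real points. For a nice pointclass the choice of the copy is immaterial,
  because of the closure under continuous preimages.
\<close>

definition in_pointclass :: "pointclass \<Rightarrow> 'a topology \<Rightarrow> 'a set \<Rightarrow> bool" where
  "in_pointclass P Z A \<longleftrightarrow>
     A \<subseteq> topspace Z \<and> (\<exists>Y h. homeomorphic_map Z Y h \<and> h ` A \<in> P Y)"

section \<open>Loop spaces and the fundamental group\<close>

definition Peano_continuum :: "'a::metric_space set \<Rightarrow> bool" where
  "Peano_continuum X \<longleftrightarrow>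
     X \<noteq> {} \<and> compact X \<and> path_connected X \<and> locally path_connected X"

text \<open>
  Points of the loop space are maps on \<^term>\<open>{0..1::real}\<close>, represented as functions that are
  \<^const>\<open>undefined\<close> outside the interval. The metric of \<^const>\<open>cfunspace\<close> is the sup metric.
\<close>

definition loop_space :: "'a::metric_space set \<Rightarrow> 'a \<Rightarrow> (real \<Rightarrow> 'a) metric" where
  "loop_space X x =
     submetric (cfunspace (top_of_set {0..1}) (submetric euclidean_metric X))
               {p. p 0 = x \<and> p 1 = x}"

text \<open>
  The argument \<open>p\<close> may be any loop in the sense of \<^const>\<open>path\<close>, in particular a concatenation
  \<open>p +++ q\<close>, which is not \<^const>\<open>undefined\<close> outside the interval.
\<close>

definition loop_class :: "'a::metric_space set \<Rightarrow> 'a \<Rightarrow> (real \<Rightarrow> 'a) \<Rightarrow> (real \<Rightarrow> 'a) set" where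
  "loop_class X x p = {q \<in> mspace (loop_space X x). homotopic_paths X p q}"

text \<open>
  Elements of the fundamental group are homotopy classes as sets of loops, so that for a set
  \<open>G\<close> of elements, \<open>\<Union>G\<close> is the set of loops whose class lies in \<open>G\<close>. In the product,
  all the classes in the union coincide.
\<close>

definition fundamental_group :: "'a::metric_space set \<Rightarrow> 'a \<Rightarrow> (real \<Rightarrow> 'a) set monoid" where
  "fundamental_group X x =
     \<lparr>carrier = loop_class X x ` mspace (loop_space X x),
      mult = (\<lambda>A B. \<Union>p\<in>A. \<Union>q\<in>B. loop_class X x (p +++ q)),
      one = loop_class X x (\<lambda>t. x)\<rparr>"

definition of_pointclass ::
    "pointclass \<Rightarrow> 'a::metric_space set \<Rightarrow> 'a \<Rightarrow> (real \<Rightarrow> 'a) set set \<Rightarrow> bool" where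
  "of_pointclass P X x G \<longleftrightarrow> in_pointclass P (mtopology_of (loop_space X x)) (\<Union>G)"

section \<open>Comonster groups\<close>

definition normal_closure :: "('a, 'b) monoid_scheme \<Rightarrow> 'a set \<Rightarrow> 'a set" where
  "normal_closure G S = (\<lambda>N. N \<lhd> G) hull S"

definition comonster :: "('a, 'b) monoid_scheme \<Rightarrow> bool" where
  "comonster G \<longleftrightarrow> (\<forall>S. finite S \<and> S \<subseteq> carrier G \<longrightarrow> normal_closure G S \<noteq> carrier G)"

definition card_comonster :: "'k rel \<Rightarrow> ('a, 'b) monoid_scheme \<Rightarrow> bool" where
  "card_comonster \<kappa> G \<longleftrightarrow> (\<forall>S. S \<subseteq> carrier G \<and> |S| <o \<kappa> \<longrightarrow> normal_closure G S \<noteq> carrier G)"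

abbreviation aleph_1 :: "nat set rel" where
  "aleph_1 \<equiv> cardSuc natLeq"

end

theory Submission
  imports
    Defs
    "HOL-Library.Countable_Set_Type"
begin

text \<open>
  Let \<open>S\<close> be a countable set that together with \<open>N\<close> normally generates the fundamental group, let
  \<open>G\<^sub>n\<close> be the normal subgroup generated by \<open>N\<close> and the first \<open>n\<close> elements of \<open>S\<close>, and
  suppose that no \<open>G\<^sub>n\<close> contains all sufficiently small loops. By compactness and local path
  connectedness there are loops \<open>\<alpha>\<^sub>k\<close> at one point that shrink to that point and satisfy
  \<open>\<alpha>\<^sub>k \<notin> G\<^sub>k\<close>. Concatenating those \<open>\<alpha>\<^sub>k\<close> with \<open>\<sigma> k\<close> gives a continuous map from the Cantor
  space to the loop space. The Cantor space is covered by the countably many preimages of the sets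
  \<open>N[w]\<close> of products of an element of \<open>N\<close> with conjugates of the letters of a word \<open>w\<close> over \<open>S\<close>.
  Each is obtained from \<open>N\<close> by continuous images and preimages, so one of them is comeager in a
  cylinder and contains two points that differ in a single large coordinate \<open>k\<close>, whence
  \<open>\<alpha>\<^sub>k \<in> G\<^sub>k\<close>, a contradiction. So some \<open>G\<^sub>n\<close> contains all small loops. Modulo small loops
  the group is finitely generated because \<open>X\<close> is compact, hence \<open>G\<^sub>m\<close> is the whole group for some
  \<open>m\<close>. If \<open>N\<close> is trivial, its loops form an analytic set, and nonmeager analytic sets are comeager
  in some nonempty open set.
\<close>

section \<open>Polish spaces and Baire category\<close>

text \<open>The second claim comes with no pointclass, so it is not an instance of the first. Both
  follow from one lemma about a predicate \<open>Q\<close> on sets of loops, which must hold for the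
  loops of \<open>N\<close>, survive the addition of one letter to a word, and yield
  \<open>meager_or_comeager_on_open\<close> after pullback to the Cantor space. This dichotomy is
  all that the category argument uses, and it has a direct proof for analytic sets.

  The cover consists of the sets \<open>N[w]\<close> and not of the subgroups
  \<open>G\<^sub>n\<close> for two reasons. Each letter of a fixed word costs only one preimage
  under a continuous map and one projection, so that definability passes from \<open>N\<close> to
  \<open>N[w]\<close>. And a word has finitely many letters, so that \<open>N[w]\<close> lies in one
  \<open>G\<^sub>n\<close>.

  Which word becomes comeager somewhere, and in which cylinder, is not known when the loops are
  chosen. Hence the \<alpha>'s avoid the members of an increasing chain one after the other, and any
  sufficiently late coordinate gives the contradiction. Two loops that differ in one coordinate have
  a conjugate of that \<alpha> as their quotient; this is where normality enters.\<close>

lemma metrizable_separable_imp_second_countable: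
  assumes "metrizable_space X" "separable_space X"
  shows "second_countable X"
proof -
  obtain M d where "Metric_space M d" and X: "X = Metric_space.mtopology M d"
    using assms(1) metrizable_space_def by blast
  then interpret Metric_space M d by simp
  obtain C where C: "countable C" "C \<subseteq> M" "mtopology closure_of C = M"
    using assms(2) unfolding separable_space_def X by auto
  define B where "B = (\<lambda>(c,n). mball c (inverse (real (Suc n)))) ` (C \<times> (UNIV::nat set))"
  have "\<exists>V\<in>B. x \<in> V \<and> V \<subseteq> U" if U: "openin mtopology U" "x \<in> U" for U x
  proof -
    obtain r where r: "r > 0" "mball x r \<subseteq> U" and xM: "x \<in> M"
      using U openin_mtopology by blast
    obtain n where n: "inverse (real (Suc n)) < r/2"
      using reals_Archimedean[of "r/2"] r(1) by auto
    have "x \<in> mtopology closure_of C"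
      using C(3) xM by simp
    then obtain c where c: "c \<in> C" "c \<in> mball x (inverse (real (Suc n)))"
      unfolding metric_closure_of mem_Collect_eq
      by (metis inverse_positive_iff_positive of_nat_0_less_iff zero_less_Suc)
    have dcx: "d x c < inverse (real (Suc n))" "c \<in> M"
      using c by auto
    have "mball c (inverse (real (Suc n))) \<subseteq> mball x r"
    proof
      fix z assume z: "z \<in> mball c (inverse (real (Suc n)))"
      then have "d x z \<le> d x c + d c z"
        using triangle xM dcx by (simp add: in_mball)
      then show "z \<in> mball x r"
        using z dcx n xM by (auto simp: in_mball)
    qed
    moreover have "x \<in> mball c (inverse (real (Suc n)))"
      using dcx xM commute by (auto simp: in_mball)
    ultimately show ?thesis
      using r(2) c(1) unfolding B_def by (intro bexI[of _ "mball c (inverse (real (Suc n)))"]) auto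
  qed
  moreover have "countable B" "\<forall>V\<in>B. openin mtopology V"
    using C(1) unfolding B_def by auto
  ultimately show ?thesis
    unfolding second_countable_def X by blast
qed

lemma Polish_space_iff_second_countable:
  "Polish_space Z \<longleftrightarrow> completely_metrizable_space Z \<and> second_countable Z"
  unfolding Polish_space_def
  by (auto intro: completely_metrizable_imp_metrizable_space
      metrizable_separable_imp_second_countable second_countable_imp_separable_space)

lemma Polish_space_closed_subtopology:
  assumes "Polish_space Z" "closedin Z A"
  shows "Polish_space (subtopology Z A)"
  using assms unfolding Polish_space_iff_second_countable
  by (simp add: completely_metrizable_space_closedin second_countable_subtopology)

lemma Polish_space_prod_topology:
  assumes "Polish_space Y" "Polish_space Z"
  shows "Polish_space (prod_topology Y Z)"
proof -
  obtain C D where C: "countable C" "C \<subseteq> topspace Y" "Y closure_of C = topspace Y"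
    and D: "countable D" "D \<subseteq> topspace Z" "Z closure_of D = topspace Z"
    using assms unfolding Polish_space_def separable_space_def by metis
  have "separable_space (prod_topology Y Z)"
    unfolding separable_space_def
    by (rule exI[of _ "C \<times> D"]) (use C D in \<open>auto simp: closure_of_Times\<close>)
  then show ?thesis
    using assms unfolding Polish_space_def by (simp add: completely_metrizable_space_prod_topology)
qed

lemma Polish_space_homeomorphic:
  assumes "Z homeomorphic_space Y"
  shows "Polish_space Z \<longleftrightarrow> Polish_space Y"
  using homeomorphic_completely_metrizable_space[OF assms] homeomorphic_separable_space[OF assms]
  unfolding Polish_space_def by simp

lemma Polish_space_Hausdorff: "Polish_space Z \<Longrightarrow> Hausdorff_space Z"
  by (simp add: Polish_space_def completely_metrizable_imp_metrizable_space metrizable_imp_Hausdorff_space)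

text \<open>Carries the topology of \<open>Z\<close> along an injection to its image, which need not
  be a subspace of anything. This is how a space is given other points, such as real
  numbers.\<close>

lemma pullback_topology_homeomorphic_map:
  assumes "inj_on e (topspace Z)"
  shows "homeomorphic_map Z (pullback_topology (e ` topspace Z) (inv_into (topspace Z) e) Z) e"
proof -
  let ?Y = "pullback_topology (e ` topspace Z) (inv_into (topspace Z) e) Z"
  have ts: "topspace ?Y = e ` topspace Z"
    by (auto simp: topspace_pullback_topology inv_into_into)
  have "homeomorphic_maps Z ?Y e (inv_into (topspace Z) e)"
    unfolding homeomorphic_maps_def
  proof (intro conjI ballI)
    show "continuous_map Z ?Y e"
    proof (rule continuous_map_pullback')
      show "continuous_map Z Z (inv_into (topspace Z) e \<circ> e)"
        by (rule continuous_map_eq[of _ _ id]) (use assms in auto)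
    qed auto
    show "continuous_map ?Y Z (inv_into (topspace Z) e)"
      using continuous_map_pullback[OF continuous_map_id, of "e ` topspace Z" "inv_into (topspace Z) e" Z]
      by (simp add: id_def o_def)
  qed (use assms in \<open>auto simp: ts f_inv_into_f\<close>)
  then show ?thesis
    using homeomorphic_maps_map by blast
qed

text \<open>A point of a T1 space is determined by the members of a countable base that contain it.
  So the points embed into the sets of natural numbers, and from there into the reals.\<close>

lemma Polish_space_real_copy:
  fixes Z :: "'a topology"
  assumes "Polish_space Z"
  obtains Y :: "real topology" and h where "Polish_space Y" "homeomorphic_map Z Y h"
proof -
  obtain \<B> where \<B>: "countable \<B>" "\<forall>V\<in>\<B>. openin Z V"
    "\<forall>U x. openin Z U \<and> x \<in> U \<longrightarrow> (\<exists>V\<in>\<B>. x \<in> V \<and> V \<subseteq> U)"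
    using assms unfolding Polish_space_iff_second_countable second_countable_def by blast
  define j where "j = (\<lambda>x. to_nat_on \<B> ` {V\<in>\<B>. x \<in> V})"
  have j: "inj_on j (topspace Z)"
  proof (rule inj_onI, rule ccontr)
    fix x y assume xy: "x \<in> topspace Z" "y \<in> topspace Z" "j x = j y" "x \<noteq> y"
    then obtain U where U: "openin Z U" "x \<in> U" "y \<notin> U"
      using Hausdorff_imp_t1_space[OF Polish_space_Hausdorff[OF assms]] unfolding t1_space_def by metis
    then obtain V where V: "V \<in> \<B>" "x \<in> V" "y \<notin> V"
      using \<B>(3) by blast
    then have "to_nat_on \<B> V \<in> j y"
      using xy(3) unfolding j_def by blast
    then show False
      using V \<B>(1) unfolding j_def by auto
  qed
  obtain r :: "nat set \<Rightarrow> real" where r: "inj r"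
    using nat_sets_eqpoll_reals unfolding eqpoll_def bij_betw_def by auto
  have "inj_on (r \<circ> j) (topspace Z)"
    using j r by (simp add: comp_inj_on inj_on_subset)
  note h = pullback_topology_homeomorphic_map[OF this]
  show ?thesis
    using that[OF _ h] assms Polish_space_homeomorphic[OF homeomorphic_map_imp_homeomorphic_space[OF h]] by simp
qed

section \<open>Meager sets and the Baire category theorem\<close>

lemma nowhere_dense_in_subset:
  "nowhere_dense_in Z A \<Longrightarrow> B \<subseteq> A \<Longrightarrow> nowhere_dense_in Z B"
  unfolding nowhere_dense_in_def
  using interior_of_mono[OF closure_of_mono, of B A Z Z] by auto

lemma meager_in_subset:
  assumes "meager_in Z A" "B \<subseteq> A"
  shows "meager_in Z B"
proof -
  obtain \<F> where \<F>: "countable \<F>" "\<forall>B\<in>\<F>. nowhere_dense_in Z B" "A = \<Union>\<F>"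
    using assms unfolding meager_in_def by blast
  have "B = \<Union>((\<inter>) B ` \<F>)"
    using assms(2) \<F>(3) by blast
  moreover have "\<forall>C\<in>(\<inter>) B ` \<F>. nowhere_dense_in Z C"
    using \<F>(2) nowhere_dense_in_subset by (metis (no_types, lifting) imageE inf_le2)
  ultimately show ?thesis
    unfolding meager_in_def using \<F>(1) by (meson countable_image)
qed

lemma meager_in_UN:
  assumes "countable I" "\<And>i. i \<in> I \<Longrightarrow> meager_in Z (A i)"
  shows "meager_in Z (\<Union>i\<in>I. A i)"
proof -
  obtain \<F> where \<F>: "\<And>i. i \<in> I \<Longrightarrow> countable (\<F> i) \<and> (\<forall>B\<in>\<F> i. nowhere_dense_in Z B) \<and> A i = \<Union>(\<F> i)"
    using assms(2) unfolding meager_in_def by metis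
  have "(\<Union>i\<in>I. A i) = \<Union>(\<Union>i\<in>I. \<F> i)"
    using \<F> by auto
  moreover have "countable (\<Union>i\<in>I. \<F> i)"
    using \<F> assms(1) by blast
  ultimately show ?thesis
    unfolding meager_in_def using \<F> by (metis UN_E)
qed

lemma meager_in_Un:
  "meager_in Z A \<Longrightarrow> meager_in Z B \<Longrightarrow> meager_in Z (A \<union> B)"
  using meager_in_UN[of "{True,False}" Z "\<lambda>b. if b then A else B"] by (simp add: Un_commute split: if_splits)

lemma nowhere_dense_in_imp_meager_in: "nowhere_dense_in Z A \<Longrightarrow> meager_in Z A"
  unfolding meager_in_def by (intro exI[of _ "{A}"]) auto

lemma openin_meager_imp_empty:
  assumes "completely_metrizable_space Z" "meager_in Z U" "openin Z U"
  shows "U = {}"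
proof -
  obtain \<F> where \<F>: "countable \<F>" "\<forall>B\<in>\<F>. nowhere_dense_in Z B" "U = \<Union>\<F>"
    using assms unfolding meager_in_def by blast
  have "Z interior_of \<Union>((closure_of) Z ` \<F>) = {}"
    using assms(1) \<F> by (intro Baire_category_alt) (auto simp: nowhere_dense_in_def)
  moreover have "U \<subseteq> \<Union>((closure_of) Z ` \<F>)"
    using \<F> closure_of_subset unfolding nowhere_dense_in_def by fastforce
  ultimately show ?thesis
    using assms(3) interior_of_maximal by blast
qed

lemma nowhere_dense_in_homeomorphic_image:
  assumes "homeomorphic_map Y Z h" "nowhere_dense_in Y A"
  shows "nowhere_dense_in Z (h ` A)"
proof -
  have "A \<subseteq> topspace Y"
    using assms(2) by (simp add: nowhere_dense_in_def)
  then have "Z closure_of (h ` A) = h ` (Y closure_of A)" "h ` A \<subseteq> topspace Z"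
    by (rule homeomorphic_map_closure_of[OF assms(1)])
      (use \<open>A \<subseteq> topspace Y\<close> homeomorphic_imp_surjective_map[OF assms(1)] in blast)
  moreover have "Z interior_of (h ` (Y closure_of A)) = h ` (Y interior_of (Y closure_of A))"
    by (rule homeomorphic_map_interior_of[OF assms(1)]) (rule closure_of_subset_topspace)
  ultimately show ?thesis
    using assms(2) unfolding nowhere_dense_in_def by simp
qed

lemma meager_in_homeomorphic_image:
  assumes "homeomorphic_map Y Z h" "meager_in Y A"
  shows "meager_in Z (h ` A)"
proof -
  obtain \<F> where \<F>: "countable \<F>" "\<forall>B\<in>\<F>. nowhere_dense_in Y B" "A = \<Union>\<F>"
    using assms unfolding meager_in_def by blast
  have "h ` A = \<Union>((`) h ` \<F>)"
    using \<F> by blast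
  moreover have "\<forall>B\<in>(`) h ` \<F>. nowhere_dense_in Z B"
    using \<F>(2) nowhere_dense_in_homeomorphic_image[OF assms(1)] by blast
  ultimately show ?thesis
    unfolding meager_in_def using \<F>(1) by (meson countable_image)
qed

text \<open>A one-sided weakening of the Baire property: it localizes a nonmeager set to an open set
  in which it is comeager, and says nothing about the rest of the set.\<close>

definition meager_or_comeager_on_open :: "'a topology \<Rightarrow> 'a set \<Rightarrow> bool" where
  "meager_or_comeager_on_open Z A \<longleftrightarrow>
     meager_in Z A \<or> (\<exists>U. openin Z U \<and> U \<noteq> {} \<and> meager_in Z (U - A))"

lemma Baire_property_in_imp:
  assumes "Baire_property_in Z A"
  shows "meager_or_comeager_on_open Z A"
proof -
  obtain U where U: "openin Z U" "meager_in Z (sym_diff A U)"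
    using assms unfolding Baire_property_in_def by blast
  then show ?thesis
    unfolding meager_or_comeager_on_open_def
    by (cases "U = {}") (auto intro!: exI[of _ U] meager_in_subset[OF U(2)])
qed

lemma meager_or_comeager_on_open_homeomorphic:
  assumes h: "homeomorphic_map Y Z h" and A: "A \<subseteq> topspace Y" "meager_or_comeager_on_open Y A"
  shows "meager_or_comeager_on_open Z (h ` A)"
  using A(2) unfolding meager_or_comeager_on_open_def
proof (elim disjE exE conjE)
  fix U assume U: "openin Y U" "U \<noteq> {}" "meager_in Y (U - A)"
  have "h ` U - h ` A \<subseteq> h ` (U - A)"
    by blast
  then have "meager_in Z (h ` U - h ` A)"
    using meager_in_homeomorphic_image[OF h U(3)] meager_in_subset by blast
  moreover have "openin Z (h ` U)"
    using h U(1) homeomorphic_imp_open_map unfolding open_map_def by blast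
  ultimately show "meager_in Z (h ` A) \<or> (\<exists>U. openin Z U \<and> U \<noteq> {} \<and> meager_in Z (U - h ` A))"
    using U(2) by blast
qed (use meager_in_homeomorphic_image[OF h] in blast)

text \<open>The points at which \<open>B\<close> is locally of second category, written D(B) in the
  classical literature. It serves as a closed approximation of \<open>B\<close> from above, up to a
  meager set.\<close>

definition nonmeager_points :: "'a topology \<Rightarrow> 'a set \<Rightarrow> 'a set" where
  "nonmeager_points Z B = {z \<in> topspace Z. \<forall>U. openin Z U \<and> z \<in> U \<longrightarrow> \<not> meager_in Z (U \<inter> B)}"

text \<open>Every point of the difference lies in a basic open set that meets \<open>B\<close> in a
  meager set, and there are only countably many basic open sets.\<close>

lemma meager_in_Diff_nonmeager_points:
  assumes "second_countable Z" "B \<subseteq> topspace Z"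
  shows "meager_in Z (B - nonmeager_points Z B)"
proof -
  obtain \<B> where \<B>: "countable \<B>" "\<forall>V\<in>\<B>. openin Z V"
    "\<forall>U x. openin Z U \<and> x \<in> U \<longrightarrow> (\<exists>V\<in>\<B>. x \<in> V \<and> V \<subseteq> U)"
    using assms unfolding second_countable_def by blast
  let ?I = "{V\<in>\<B>. meager_in Z (V \<inter> B)}"
  have "B - nonmeager_points Z B \<subseteq> (\<Union>V\<in>?I. V \<inter> B)"
  proof
    fix z assume z: "z \<in> B - nonmeager_points Z B"
    then obtain U where U: "openin Z U" "z \<in> U" "meager_in Z (U \<inter> B)"
      using assms(2) unfolding nonmeager_points_def by blast
    then obtain V where V: "V \<in> \<B>" "z \<in> V" "V \<subseteq> U"
      using \<B>(3) by blast
    then have "V \<in> ?I"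
      using U(3) meager_in_subset by (metis (no_types, lifting) inf_mono mem_Collect_eq order_refl)
    then show "z \<in> (\<Union>V\<in>?I. V \<inter> B)"
      using V z by blast
  qed
  moreover have "meager_in Z (\<Union>V\<in>?I. V \<inter> B)"
    by (rule meager_in_UN) (use \<B>(1) in auto)
  ultimately show ?thesis
    using meager_in_subset by blast
qed

lemma closedin_nonmeager_points: "closedin Z (nonmeager_points Z B)"
proof -
  have "openin Z (topspace Z - nonmeager_points Z B)"
  proof (subst openin_subopen, intro ballI)
    fix z assume "z \<in> topspace Z - nonmeager_points Z B"
    then obtain U where U: "openin Z U" "z \<in> U" "meager_in Z (U \<inter> B)"
      unfolding nonmeager_points_def by blast
    then have "U \<subseteq> topspace Z - nonmeager_points Z B"
      unfolding nonmeager_points_def using openin_subset by blast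
    then show "\<exists>T. openin Z T \<and> z \<in> T \<and> T \<subseteq> topspace Z - nonmeager_points Z B"
      using U by blast
  qed
  then show ?thesis
    unfolding closedin_def by (simp add: nonmeager_points_def)
qed

lemma nonmeager_points_subset_closure_of:
  "nonmeager_points Z B \<subseteq> Z closure_of B"
proof
  fix z assume z: "z \<in> nonmeager_points Z B"
  have "meager_in Z {}"
    unfolding meager_in_def by (intro exI[of _ "{}"]) auto
  then have "U \<inter> B \<noteq> {}" if "openin Z U" "z \<in> U" for U
    using z that unfolding nonmeager_points_def by auto
  then show "z \<in> Z closure_of B"
    using z unfolding nonmeager_points_def in_closure_of by blast
qed

text \<open>Replace each D(B n) by its interior, so that the difference becomes closed. An open set
  \<open>V\<close> inside it meets the union of the \<open>B n\<close> only in the meager parts B n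
  - D(B n) and in the boundaries of the D(B n). So no point of \<open>V\<close> is a point of local
  nonmeagerness, and \<open>V\<close> is empty.\<close>

lemma meager_in_nonmeager_points_Diff_UN:
  fixes B :: "nat \<Rightarrow> 'a set"
  assumes Z: "second_countable Z" and B: "\<And>n. B n \<subseteq> topspace Z"
  shows "meager_in Z (nonmeager_points Z (\<Union>n. B n) - (\<Union>n. nonmeager_points Z (B n)))"
proof -
  let ?D = "nonmeager_points Z (\<Union>n. B n)" and ?E = "\<Union>n. nonmeager_points Z (B n)"
  let ?F = "(\<Union>n. B n - nonmeager_points Z (B n))"
  have mF: "meager_in Z ?F"
    by (rule meager_in_UN) (simp_all add: meager_in_Diff_nonmeager_points Z B)
  let ?U = "\<Union>n. Z interior_of nonmeager_points Z (B n)"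
  let ?bd = "\<Union>n. nonmeager_points Z (B n) - Z interior_of nonmeager_points Z (B n)"
  have bd: "meager_in Z ?bd"
  proof (rule meager_in_UN)
    fix n
    have "closedin Z (nonmeager_points Z (B n) - Z interior_of nonmeager_points Z (B n))"
      by (simp add: closedin_diff closedin_nonmeager_points)
    moreover have "Z interior_of (nonmeager_points Z (B n) - Z interior_of nonmeager_points Z (B n)) = {}"
      using interior_of_mono[of "nonmeager_points Z (B n) - Z interior_of nonmeager_points Z (B n)" "nonmeager_points Z (B n)" Z]
        interior_of_subset[of Z "nonmeager_points Z (B n) - Z interior_of nonmeager_points Z (B n)"] by blast
    ultimately show "meager_in Z (nonmeager_points Z (B n) - Z interior_of nonmeager_points Z (B n))"
      by (intro nowhere_dense_in_imp_meager_in) (auto simp: nowhere_dense_in_def closure_of_closedin closedin_subset)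
  qed auto
  have "nowhere_dense_in Z (?D - ?U)"
  proof -
    have cl: "closedin Z (?D - ?U)"
      by (intro closedin_diff closedin_nonmeager_points openin_Union) auto
    define V where "V = Z interior_of (?D - ?U)"
    have V: "openin Z V" "V \<subseteq> ?D - ?U"
      unfolding V_def by (simp, rule interior_of_subset)
    have "V \<inter> (\<Union>n. B n) \<subseteq> ?F \<union> ?bd"
      using V(2) by blast
    then have "meager_in Z (V \<inter> (\<Union>n. B n))"
      using meager_in_Un[OF mF bd] meager_in_subset by blast
    then have "z \<notin> ?D" if "z \<in> V" for z
      using V(1) that unfolding nonmeager_points_def by simp blast
    then have "V = {}"
      using V(2) by blast
    then show ?thesis
      using cl unfolding nowhere_dense_in_def V_def by (simp add: closure_of_closedin closedin_subset)
  qed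
  moreover have "?D - ?E \<subseteq> ?D - ?U"
    using interior_of_subset[of Z] by (intro Diff_mono UN_mono order_refl)
  ultimately show ?thesis
    using nowhere_dense_in_imp_meager_in meager_in_subset by blast
qed

section \<open>Analytic sets\<close>

text \<open>The quantifier cannot range over types, so the parameter space has real points;
  \<open>analytic_inI\<close> lifts this restriction.\<close>

definition analytic_in :: "'a topology \<Rightarrow> 'a set \<Rightarrow> bool" where
  "analytic_in Z A \<longleftrightarrow>
     (\<exists>(Y :: real topology) g. Polish_space Y \<and> continuous_map Y Z g \<and> A = g ` topspace Y)"

lemma analytic_inI:
  assumes "Polish_space Y" "continuous_map Y Z g"
  shows "analytic_in Z (g ` topspace Y)"
proof -
  obtain W :: "real topology" and h where W: "Polish_space W" "homeomorphic_map Y W h"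
    using Polish_space_real_copy[OF assms(1)] by blast
  obtain k where k: "homeomorphic_map W Y k"
    using W(2) by (meson homeomorphic_map_maps homeomorphic_maps_sym)
  have "continuous_map W Z (g \<circ> k)"
    using continuous_map_compose[OF homeomorphic_imp_continuous_map[OF k] assms(2)] .
  moreover have "g ` topspace Y = (g \<circ> k) ` topspace W"
    using homeomorphic_imp_surjective_map[OF k] by (metis image_comp)
  ultimately show ?thesis
    unfolding analytic_in_def using W(1) by blast
qed

lemma analytic_in_continuous_image:
  assumes "analytic_in Y A" "continuous_map Y Z f"
  shows "analytic_in Z (f ` A)"
proof -
  obtain W :: "real topology" and g where g: "Polish_space W" "continuous_map W Y g" "A = g ` topspace W"
    using assms(1) unfolding analytic_in_def by blast
  show ?thesis
    using analytic_inI[OF g(1) continuous_map_compose[OF g(2) assms(2)]] g(3) by (metis image_comp)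
qed

text \<open>If \<open>g\<close> parametrizes \<open>A\<close>, the preimage is the projection of the
  fibre product of \<open>f\<close> and \<open>g\<close>, which is closed in a product of Polish
  spaces because \<open>Z\<close> is Hausdorff.\<close>

lemma analytic_in_continuous_preimage:
  assumes "Polish_space Y" "Hausdorff_space Z" "continuous_map Y Z f" "analytic_in Z A"
  shows "analytic_in Y {y \<in> topspace Y. f y \<in> A}"
proof -
  obtain W :: "real topology" and g where g: "Polish_space W" "continuous_map W Z g" "A = g ` topspace W"
    using assms(4) unfolding analytic_in_def by blast
  let ?P = "prod_topology Y W"
  let ?E = "{p \<in> topspace ?P. (f \<circ> fst) p = (g \<circ> snd) p}"
  have "closedin ?P ?E"
    by (rule closedin_continuous_maps_eq[OF assms(2)]
        continuous_map_compose[OF continuous_map_fst assms(3)] continuous_map_compose[OF continuous_map_snd g(2)])+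
  then have P: "Polish_space (subtopology ?P ?E)"
    using Polish_space_closed_subtopology Polish_space_prod_topology assms(1) g(1) by blast
  have "continuous_map (subtopology ?P ?E) Y fst"
    by (simp add: continuous_map_from_subtopology continuous_map_fst)
  from analytic_inI[OF P this] have "analytic_in Y (fst ` (topspace ?P \<inter> ?E))"
    by simp
  moreover have "fst ` (topspace ?P \<inter> ?E) = {y \<in> topspace Y. f y \<in> A}"
    using g(3) by force
  ultimately show ?thesis
    by simp
qed

text \<open>
  A Suslin scheme argument: the image is covered by images of smaller and smaller pieces, indexed by
  finite sequences, and a point that is locally nonmeager along a branch of pieces is attained.
\<close>

lemma analytic_in_meager_or_comeager_on_open:
  assumes Z: "Polish_space Z" and A: "analytic_in Z A"
  shows "meager_or_comeager_on_open Z A"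
proof -
  obtain Y :: "real topology" and g where Y: "Polish_space Y" and g: "continuous_map Y Z g" and
    Ag: "A = g ` topspace Y"
    using A unfolding analytic_in_def by blast
  obtain M d where "Metric_space M d" and comp: "Metric_space.mcomplete M d" and Yeq: "Y = Metric_space.mtopology M d"
    using Y unfolding Polish_space_def completely_metrizable_space_def by blast
  interpret Metric_space M d by fact
  have tsY: "topspace Y = M" by (simp add: Yeq)
  have Z2: "second_countable Z"
    using Z Polish_space_iff_second_countable by blast
  have mempty: "meager_in Z {}"
    unfolding meager_in_def by (intro exI[of _ "{}"]) auto
  show ?thesis
  proof (cases "M = {}")
    case True
    then show ?thesis using mempty unfolding Ag tsY meager_or_comeager_on_open_def by simp
  next
    case False
    obtain C where C: "countable C" "C \<subseteq> M" "mtopology closure_of C = M"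
      using Y tsY unfolding Polish_space_def separable_space_def Yeq by auto
    have "C \<noteq> {}" using C(3) False by auto
    define c where "c = from_nat_into C"
    have cC: "range c = C"
      unfolding c_def by (rule range_from_nat_into) (use C \<open>C \<noteq> {}\<close> in auto)
    have cM: "c n \<in> M" for n using cC C(2) by blast
    have cdense: "\<exists>n. d (c n) y \<le> e" if "y \<in> M" "e > 0" for y e
    proof -
      have "y \<in> mtopology closure_of C" using C(3) that(1) by simp
      then obtain z where "z \<in> C" "z \<in> mball y e"
        using \<open>e > 0\<close> unfolding metric_closure_of mem_Collect_eq by blast
      then show ?thesis
        using cC commute[of y z] by (metis in_mball less_imp_le rangeE)
    qed
    \<comment> \<open>Entry \<open>j\<close> of the sequence names a dense point within distance
      \<open>(1/2)^j\<close>, so the pieces shrink along every branch. The pieces of one length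
      cover \<open>M\<close> and may overlap.\<close>
    define Ys where "Ys s = {y \<in> M. \<forall>j<length s. d (c (s ! j)) y \<le> (1/2)^j}" for s
    define As where "As s = g ` Ys s" for s
    have YsM: "Ys s \<subseteq> M" for s by (auto simp: Ys_def)
    have AsZ: "As s \<subseteq> topspace Z" for s
      using YsM[of s] g unfolding As_def tsY[symmetric] continuous_map_def by blast
    have Ys_snoc: "Ys (s @ [n]) = {y \<in> Ys s. d (c n) y \<le> (1/2)^length s}" for s n
      by (auto simp: Ys_def nth_append less_Suc_eq)
    have YsU: "Ys s = (\<Union>n. Ys (s @ [n]))" for s
      using cdense YsM[of s] unfolding Ys_snoc by (auto simp: subset_iff)
    have AsU: "As s = (\<Union>n. As (s @ [n]))" for s
      unfolding As_def by (subst YsU) auto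
    define D where "D s = nonmeager_points Z (As s)" for s
    \<comment> \<open>The points whose local nonmeagerness gets lost when some piece is refined.
      Since there are countably many finite sequences, this exceptional set is meager.\<close>
    define Q where "Q = (\<Union>s. D s - (\<Union>n. D (s @ [n])))"
    have mQ: "meager_in Z Q"
      unfolding Q_def
    proof (rule meager_in_UN)
      fix s
      show "meager_in Z (D s - (\<Union>n. D (s @ [n])))"
        using meager_in_nonmeager_points_Diff_UN[OF Z2, of "\<lambda>n. As (s @ [n])"] AsZ
        unfolding D_def AsU[symmetric] by blast
    qed auto
    have As_Nil: "As [] = A" by (simp add: As_def Ys_def Ag tsY)
    have DA: "x \<in> A" if x: "x \<in> D []" "x \<notin> Q" for x
    proof -
      \<comment> \<open>Outside \<open>Q\<close> a sequence with \<open>x \<in> D s\<close> always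
        has an extension by one entry with the same property, so an infinite branch grows from
        \<open>[]\<close>.\<close>
      have "\<exists>f. \<forall>k. (x \<in> D (f k) \<and> length (f k) = k) \<and> (\<exists>n. f (Suc k) = f k @ [n])"
      proof (rule dependent_nat_choice)
        show "\<exists>s. x \<in> D s \<and> length s = 0" using x by auto
        fix s k assume s: "x \<in> D s \<and> length s = k"
        then obtain n where "x \<in> D (s @ [n])" using x(2) unfolding Q_def by blast
        then show "\<exists>t. (x \<in> D t \<and> length t = Suc k) \<and> (\<exists>n. t = s @ [n])"
          using s by (intro exI[of _ "s @ [n]"]) simp
      qed
      then obtain f where f: "\<And>k. x \<in> D (f k)" "\<And>k. length (f k) = k" "\<And>k. \<exists>n. f (Suc k) = f k @ [n]"
        by blast
      obtain b where b: "\<And>k. f (Suc k) = f k @ [b k]"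
        using f(3) by metis
      have Ysb: "d (c (b j)) y \<le> (1/2)^j" if "y \<in> Ys (f k)" "j < k" for y j k
        using that
      proof (induction k)
        case (Suc k)
        then show ?case
          using Ys_snoc[of "f k" "b k"] f(2)[of k] by (cases "j = k") (auto simp: b)
      qed simp
      have xcl: "x \<in> Z closure_of As (f k)" for k
        using f(1)[of k] nonmeager_points_subset_closure_of[of Z "As (f k)"] unfolding D_def by blast
      have "As (f k) \<noteq> {}" for k
        using xcl[of k] by auto
      then have "\<exists>y. y \<in> Ys (f k)" for k
        unfolding As_def by auto
      \<comment> \<open>These points are arbitrary and need not be mapped to \<open>x\<close>. Only
        their limit will be, because the pieces shrink while their images keep \<open>x\<close> in
        their closures.\<close>
      then obtain y where y: "\<And>k. y k \<in> Ys (f k)"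
        by metis
      have yM: "y k \<in> M" for k using y YsM by blast
      have close: "d z z' \<le> 2 * (1/2)^j" if "z \<in> Ys (f k)" "z' \<in> Ys (f l)" "j < k" "j < l" for z z' j k l
        using triangle'[of z "c (b j)" z'] Ysb[OF that(1,3)] Ysb[OF that(2,4)] cM that(1,2) YsM
          triangle[of z "c (b j)" z'] commute[of z "c (b j)"] by (auto simp: subset_iff)
      have small: "\<exists>j. 2 * (1/2)^j < (e::real)" if e: "e > 0" for e
      proof -
        obtain j where "(1/2)^j < e/2"
          using real_arch_pow_inv[of "e/2" "1/2"] e by auto
        then show ?thesis by (intro exI[of _ j]) simp
      qed
      have "MCauchy y"
        unfolding MCauchy_def
      proof (intro conjI allI impI)
        show "range y \<subseteq> M" using yM by blast
        fix e :: real assume "e > 0"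
        then obtain j where "2 * (1/2)^j < e" using small by blast
        then show "\<exists>N. \<forall>n n'. N \<le> n \<longrightarrow> N \<le> n' \<longrightarrow> d (y n) (y n') < e"
          using close[OF y y] by (intro exI[of _ "Suc j"]) (metis Suc_le_lessD order.strict_trans1)
      qed
      then obtain l where l: "limitin mtopology y l sequentially"
        using comp unfolding mcomplete_def by blast
      have lM: "l \<in> M" using l limitin_mspace by blast
      \<comment> \<open>Otherwise \<open>g l\<close> and \<open>x\<close> have disjoint
        neighbourhoods. A piece close to \<open>l\<close> is mapped into the first one, although its
        image accumulates at \<open>x\<close>.\<close>
      have "g l = x"
      proof (rule ccontr)
        assume "g l \<noteq> x"
        moreover have "g l \<in> topspace Z" using lM g unfolding continuous_map_def tsY by auto
        moreover have "x \<in> topspace Z" using x(1) unfolding D_def nonmeager_points_def by blast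
        ultimately obtain V U where VU: "openin Z V" "openin Z U" "g l \<in> V" "x \<in> U" "disjnt V U"
          using Polish_space_Hausdorff[OF Z] unfolding Hausdorff_space_def by metis
        have "openin mtopology {y \<in> M. g y \<in> V}"
          using openin_continuous_map_preimage[OF g VU(1)] by (simp add: tsY Yeq)
        then obtain r where r: "r > 0" "mball l r \<subseteq> {y \<in> M. g y \<in> V}"
          using VU(3) lM unfolding openin_mtopology by blast
        obtain j where j: "2 * (1/2)^j < r/2" using small[of "r/2"] r(1) by auto
        obtain N where N: "\<And>n. N \<le> n \<Longrightarrow> d (y n) l < r/2"
          using l r(1) unfolding limit_metric_sequentially by (metis half_gt_zero)
        have "Ys (f (Suc j)) \<subseteq> mball l r"
        proof
          fix z assume z: "z \<in> Ys (f (Suc j))"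
          let ?m = "max N (Suc j)"
          have zM: "z \<in> M" using z YsM by blast
          have "d z (y ?m) < r/2"
            using close[OF z y, of j ?m] j by (simp add: less_max_iff_disj)
          moreover have "d (y ?m) l < r/2" using N by simp
          ultimately have "d l z < r"
            using triangle[OF zM yM[of ?m] lM] commute[of z l] by simp
          then show "z \<in> mball l r" using zM lM by simp
        qed
        then have "As (f (Suc j)) \<subseteq> V" unfolding As_def using r(2) by blast
        moreover have "U \<inter> As (f (Suc j)) \<noteq> {}"
          using xcl[of "Suc j"] VU(2,4) unfolding in_closure_of by blast
        ultimately show False using VU(5) unfolding disjnt_def by blast
      qed
      then show ?thesis using lM Ag tsY by blast
    qed
    show ?thesis
    proof (cases "meager_in Z A")
      case False
      have AZ: "A \<subseteq> topspace Z" using AsZ[of "[]"] As_Nil by simp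
      \<comment> \<open>A nonmeager \<open>A\<close> lies in \<open>D []\<close> up to a meager set,
        so the closed set \<open>D []\<close> cannot be nowhere dense; by \<open>DA\<close> only
        points of \<open>Q\<close> are missing from \<open>A\<close> in its interior.\<close>
      let ?U = "Z interior_of D []"
      have "?U \<noteq> {}"
      proof
        assume "?U = {}"
        then have "nowhere_dense_in Z (D [])"
          using closedin_nonmeager_points[of Z "As []"] unfolding nowhere_dense_in_def D_def
          by (simp add: closure_of_closedin closedin_subset)
        then have "meager_in Z (D [])"
          by (rule nowhere_dense_in_imp_meager_in)
        moreover have "meager_in Z (A - D [])"
          using meager_in_Diff_nonmeager_points[OF Z2 AZ] unfolding D_def As_Nil .
        ultimately have "meager_in Z (D [] \<union> (A - D []))"
          by (rule meager_in_Un)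
        then show False using False meager_in_subset by blast
      qed
      moreover have "?U - A \<subseteq> Q"
        using DA interior_of_subset[of Z "D []"] by blast
      ultimately show ?thesis
        unfolding meager_or_comeager_on_open_def using meager_in_subset[OF mQ] openin_interior_of by blast
    qed (simp add: meager_or_comeager_on_open_def)
  qed
qed

section \<open>The space of loops\<close>

declare mspace_cfunspace [simp del]

abbreviation function_space :: "'b::metric_space set \<Rightarrow> 'a::metric_space set \<Rightarrow> ('b \<Rightarrow> 'a) metric" where
  "function_space K X \<equiv> cfunspace (top_of_set K) (submetric euclidean_metric X)"

lemma mspace_function_space:
  assumes "compact K"
  shows "mspace (function_space K X) = {f. continuous_on K f \<and> f ` K \<subseteq> X \<and> f \<in> extensional K}"
proof -
  have "compactin (top_of_set K) (topspace (top_of_set K))"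
    using assms by (simp add: compactin_subtopology)
  then show ?thesis
    by (subst compactin_mspace_cfunspace) (auto simp: mtopology_of_submetric continuous_map_in_subtopology image_subset_iff Pi_iff)
qed

lemma mdist_function_space_le_iff:
  assumes "f \<in> mspace (function_space K X)" "g \<in> mspace (function_space K X)" "K \<noteq> {}"
  shows "mdist (function_space K X) f g \<le> a \<longleftrightarrow> (\<forall>t\<in>K. dist (f t) (g t) \<le> a)"
  using cfunspace_mdist_le[OF assms(1,2)] assms(3) by simp

lemma finite_ball_cover:
  assumes "compact K" "e > 0"
  shows "\<exists>S. finite S \<and> S \<subseteq> K \<and> K \<subseteq> (\<Union>s\<in>S. ball s e)"
  using seq_compact_imp_totally_bounded[of K] assms compact_eq_seq_compact_metric by blast

text \<open>Up to \<open>4 * e n\<close>, a map is determined by finite data: an index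
  \<open>m\<close> with modulus of continuity \<open>e m\<close> for the accuracy
  \<open>e n\<close>, and its values on a finite net of \<open>K\<close>, rounded to a finite net of
  \<open>X\<close>. There are countably many such data; one map is chosen for each.\<close>

lemma separable_function_space:
  fixes K :: "'b::metric_space set" and X :: "'a::metric_space set"
  assumes K: "compact K" "K \<noteq> {}" and X: "compact X"
  shows "separable_space (mtopology_of (function_space K X))"
proof -
  let ?F = "mspace (function_space K X)"
  define e where "e n = inverse (real (Suc n))" for n
  have e0: "e n > 0" for n by (simp add: e_def)
  have small: "\<exists>n. e n < r" if "r > 0" for r
    using reals_Archimedean[OF that] by (simp add: e_def)
  have "\<exists>S. finite S \<and> S \<subseteq> K \<and> K \<subseteq> (\<Union>s\<in>S. ball s (e m))" for m
    using finite_ball_cover[OF K(1) e0] by blast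
  then obtain S where S: "\<And>m. finite (S m)" "\<And>m. S m \<subseteq> K" "\<And>m. K \<subseteq> (\<Union>s\<in>S m. ball s (e m))"
    by metis
  have "\<exists>T. finite T \<and> T \<subseteq> X \<and> X \<subseteq> (\<Union>s\<in>T. ball s (e m))" for m
    using finite_ball_cover[OF X(1) e0] by blast
  then obtain T where T: "\<And>m. finite (T m)" "\<And>m. T m \<subseteq> X" "\<And>m. X \<subseteq> (\<Union>s\<in>T m. ball s (e m))"
    by metis
  define good where "good n m a g \<longleftrightarrow> g \<in> ?F \<and> (\<forall>s\<in>K. \<forall>t\<in>K. dist s t < e m \<longrightarrow> dist (g s) (g t) < e n) \<and>
      (\<forall>s\<in>S m. dist (g s) (a s) < e n)" for n m a g
  define I where "I = (SIGMA n:UNIV. SIGMA m:UNIV. S m \<rightarrow>\<^sub>E T n)"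
  \<comment> \<open>Data that no map realizes give an arbitrary value of \<open>SOME\<close>; the
    intersection discards those outside the space.\<close>
  define D where "D = (\<lambda>(n,m,a). SOME g. good n m a g) ` I \<inter> ?F"
  have "countable I"
    unfolding I_def by (intro countable_SIGMA countableI_type countable_finite finite_PiE S(1) T(1))
  then have "countable D"
    unfolding D_def by (intro countable_Int1 countable_image)
  moreover have "D \<subseteq> ?F" by (auto simp: D_def)
  moreover have "\<exists>g\<in>D. mdist (function_space K X) f g < r" if f: "f \<in> ?F" and r: "r > 0" for f r
  proof -
    obtain n where n: "e n < r / 4" using small[of "r/4"] r by auto
    have fc: "continuous_on K f" "f ` K \<subseteq> X" using f mspace_function_space[OF K(1)] by blast+
    obtain \<delta> where \<delta>: "\<delta> > 0" "\<And>s t. s \<in> K \<Longrightarrow> t \<in> K \<Longrightarrow> dist s t < \<delta> \<Longrightarrow> dist (f s) (f t) < e n"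
      using compact_uniformly_continuous[OF fc(1) K(1)] e0[of n]
      unfolding uniformly_continuous_on_def by (metis dist_commute)
    obtain m where m: "e m < \<delta>" using small \<delta>(1) by blast
    have "\<exists>y\<in>T n. dist (f s) y < e n" if "s \<in> S m" for s
      using that S(2)[of m] T(3)[of n] fc(2) by (fastforce simp: dist_commute)
    then obtain a0 where a0: "\<And>s. s \<in> S m \<Longrightarrow> a0 s \<in> T n \<and> dist (f s) (a0 s) < e n"
      by metis
    define a where "a = restrict a0 (S m)"
    have a: "a \<in> S m \<rightarrow>\<^sub>E T n" "\<And>s. s \<in> S m \<Longrightarrow> dist (f s) (a s) < e n"
      using a0 by (auto simp: a_def)
    have "good n m a f"
      unfolding good_def using f \<delta>(2) m a(2) by auto
    then have g: "good n m a (SOME g. good n m a g)" (is "good n m a ?g")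
      by (rule someI[of "good n m a"])
    have gF: "?g \<in> ?F" using g unfolding good_def by blast
    then have gD: "?g \<in> D"
      unfolding D_def I_def using a(1) by force
    \<comment> \<open>From \<open>f t\<close> via \<open>f s\<close>, \<open>a s\<close> and
      \<open>?g s\<close> to \<open>?g t\<close> for a net point \<open>s\<close> near
      \<open>t\<close>, each step being shorter than \<open>e n\<close>.\<close>
    have "dist (f t) (?g t) \<le> 4 * e n" if t: "t \<in> K" for t
    proof -
      obtain s where s: "s \<in> S m" "dist s t < e m" using S(3)[of m] t by auto
      have sK: "s \<in> K" using s(1) S(2) by blast
      have "dist (f t) (f s) < e n" using \<delta>(2)[OF t sK] s(2) m by (simp add: dist_commute)
      moreover have "dist (f s) (a s) < e n" using a(2) s(1) .
      moreover have "dist (?g s) (a s) < e n" "dist (?g s) (?g t) < e n"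
        using g s sK t unfolding good_def by blast+
      ultimately show ?thesis
        using dist_triangle[of "f t" "?g t" "f s"] dist_triangle[of "f s" "?g t" "a s"]
          dist_triangle[of "a s" "?g t" "?g s"] dist_commute[of "a s" "?g s"] by linarith
    qed
    then have "mdist (function_space K X) f ?g \<le> 4 * e n"
      using mdist_function_space_le_iff[OF f gF K(2)] by blast
    then show ?thesis using gD n by (intro bexI[of _ ?g]) auto
  qed
  ultimately show ?thesis
    unfolding separable_space_def mtopology_of_def Metric_space.metric_closure_of[OF Metric_space_mspace_mdist]
    by (intro exI[of _ D]) (force simp: Metric_space.in_mball[OF Metric_space_mspace_mdist]
        Metric_space.topspace_mtopology[OF Metric_space_mspace_mdist])
qed

lemma Polish_function_space:
  fixes K :: "'b::metric_space set" and X :: "'a::metric_space set"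
  assumes K: "compact K" "K \<noteq> {}" and X: "compact X"
  shows "Polish_space (mtopology_of (function_space K X))"
proof -
  interpret XM: Metric_space X dist
    by unfold_locales (auto simp: dist_commute dist_triangle)
  have self: "XM.Self = submetric euclidean_metric X"
    by (simp add: XM.Self_def submetric_def)
  have "XM.mtopology = top_of_set X"
    using mtopology_of_submetric[of "euclidean_metric" X] by (simp add: self[symmetric] mtopology_of_def)
  then have "compact_space XM.mtopology"
    using X by (simp add: compact_space_subtopology)
  then have "XM.mcomplete"
    by (rule XM.compact_space_imp_mcomplete)
  then have "mcomplete_of (function_space K X)"
    using XM.mcomplete_cfunspace by (simp add: self)
  then have "completely_metrizable_space (mtopology_of (function_space K X))"
    unfolding mcomplete_of_def mtopology_of_def
    by (rule Metric_space.completely_metrizable_space_mtopology[OF Metric_space_mspace_mdist])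
  then show ?thesis
    using separable_function_space[OF assms] by (simp add: Polish_space_def)
qed

lemma closedin_function_space_evaluation:
  assumes K: "compact K" and z: "z \<in> K"
  shows "closedin (mtopology_of (function_space K X)) {f \<in> mspace (function_space K X). f z = w}"
proof -
  interpret F: Metric_space "mspace (function_space K X)" "mdist (function_space K X)"
    by (rule Metric_space_mspace_mdist)
  let ?A = "{f \<in> mspace (function_space K X). f z = w}"
  have "\<exists>r>0. disjnt ?A (F.mball f r)" if f: "f \<in> mspace (function_space K X) - ?A" for f
  proof (intro exI conjI)
    show "0 < dist (f z) w" using f by auto
    have "dist (f z) (g z) < dist (f z) w" if "g \<in> F.mball f (dist (f z) w)" for g
    proof -
      have g: "g \<in> mspace (function_space K X)" "mdist (function_space K X) f g < dist (f z) w"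
        using that F.in_mball by blast+
      have "dist (f z) (g z) \<le> mdist (function_space K X) f g"
        using mdist_function_space_le_iff[of f K X g] f g(1) z by blast
      then show ?thesis using g(2) by simp
    qed
    then show "disjnt ?A (F.mball f (dist (f z) w))"
      unfolding disjnt_def by blast
  qed
  then show ?thesis
    unfolding mtopology_of_def F.closedin_metric by blast
qed

lemma mspace_loop_space:
  "mspace (loop_space X x) = {p. path p \<and> path_image p \<subseteq> X \<and> pathstart p = x \<and> pathfinish p = x
     \<and> p \<in> extensional {0..1}}"
  unfolding loop_space_def
  using mspace_function_space[of "{0..1::real}" X]
  by (auto simp: path_def path_image_def pathstart_def pathfinish_def)

lemma mdist_loop_space_le_iff:
  assumes "p \<in> mspace (loop_space X x)" "q \<in> mspace (loop_space X x)"
  shows "mdist (loop_space X x) p q \<le> a \<longleftrightarrow> (\<forall>t\<in>{0..1}. dist (p t) (q t) \<le> a)"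
proof -
  have "mspace (loop_space X x) \<subseteq> mspace (function_space {0..1} X)"
    unfolding loop_space_def by simp
  then show ?thesis
    using mdist_function_space_le_iff[of p "{0..1::real}" X q a] assms
    unfolding loop_space_def mdist_submetric by auto
qed

lemma Polish_loop_space:
  assumes "compact X"
  shows "Polish_space (mtopology_of (loop_space X x))"
proof -
  let ?T = "mtopology_of (function_space {0..1::real} X)"
  let ?A = "{f \<in> mspace (function_space {0..1::real} X). f 0 = x} \<inter> {f \<in> mspace (function_space {0..1::real} X). f 1 = x}"
  have "closedin ?T ?A"
    by (intro closedin_Int closedin_function_space_evaluation) auto
  moreover have "Polish_space ?T"
    by (rule Polish_function_space) (use assms in auto)
  ultimately have "Polish_space (subtopology ?T ?A)"
    by (rule Polish_space_closed_subtopology[rotated])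
  moreover have "mtopology_of (loop_space X x) = subtopology ?T ?A"
  proof -
    have "subtopology ?T {p. p 0 = x \<and> p 1 = x} = subtopology ?T (topspace ?T \<inter> {p. p 0 = x \<and> p 1 = x})"
      by (metis subtopology_restrict)
    moreover have "topspace ?T \<inter> {p. p 0 = x \<and> p 1 = x} = ?A"
      by auto
    ultimately show ?thesis
      unfolding loop_space_def mtopology_of_submetric by simp
  qed
  ultimately show ?thesis by simp
qed

lemma continuous_map_loop_spaceI:
  assumes "\<And>a. a \<in> topspace T \<Longrightarrow> f a \<in> mspace (loop_space X x)"
    and "\<And>a e. a \<in> topspace T \<Longrightarrow> e > 0 \<Longrightarrow>
       \<exists>U. openin T U \<and> a \<in> U \<and> (\<forall>b\<in>U. \<forall>t\<in>{0..1}. dist (f a t) (f b t) \<le> e)"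
  shows "continuous_map T (mtopology_of (loop_space X x)) f"
proof -
  interpret L: Metric_space "mspace (loop_space X x)" "mdist (loop_space X x)"
    by (rule Metric_space_mspace_mdist)
  show ?thesis
    unfolding mtopology_of_def L.continuous_map_to_metric
  proof (intro ballI allI impI)
    fix a and e :: real assume a: "a \<in> topspace T" and e: "e > 0"
    \<comment> \<open>Pointwise bounds give only a nonstrict bound on the sup distance, hence the
      half.\<close>
    obtain U where U: "openin T U" "a \<in> U" "\<forall>b\<in>U. \<forall>t\<in>{0..1}. dist (f a t) (f b t) \<le> e/2"
      using assms(2)[OF a, of "e/2"] e by auto
    have "f b \<in> L.mball (f a) e" if b: "b \<in> U" for b
    proof -
      have m: "f a \<in> mspace (loop_space X x)" "f b \<in> mspace (loop_space X x)"
        using assms(1) a b openin_subset[OF U(1)] by auto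
      then have "mdist (loop_space X x) (f a) (f b) \<le> e/2"
        using mdist_loop_space_le_iff[OF m] U(3) b by blast
      then show ?thesis using m e by (simp add: L.in_mball)
    qed
    then show "\<exists>U. openin T U \<and> a \<in> U \<and> (\<forall>y\<in>U. f y \<in> L.mball (f a) e)"
      using U by blast
  qed
qed

lemma openin_loop_space_ball:
  assumes p: "p \<in> mspace (loop_space X x)" and e: "e > 0"
  obtains U where "openin (mtopology_of (loop_space X x)) U" "p \<in> U"
    "\<And>q t. q \<in> U \<Longrightarrow> t \<in> {0..1} \<Longrightarrow> dist (p t) (q t) \<le> e"
proof -
  interpret L: Metric_space "mspace (loop_space X x)" "mdist (loop_space X x)"
    by (rule Metric_space_mspace_mdist)
  show ?thesis
  proof
    show "openin (mtopology_of (loop_space X x)) (L.mball p e)"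
      unfolding mtopology_of_def by (rule L.openin_mball)
    show "p \<in> L.mball p e" using p e by simp
    fix q t assume q: "q \<in> L.mball p e" and t: "t \<in> {0..1::real}"
    then have "q \<in> mspace (loop_space X x)" "mdist (loop_space X x) p q \<le> e"
      by (simp_all add: L.in_mball)
    then show "dist (p t) (q t) \<le> e"
      using mdist_loop_space_le_iff[OF p] t by blast
  qed
qed

lemma restrict_in_loop_space:
  assumes "path p" "path_image p \<subseteq> X" "pathstart p = x" "pathfinish p = x"
  shows "restrict p {0..1} \<in> mspace (loop_space X x)"
proof -
  have "path (restrict p {0..1})"
    using assms(1) unfolding path_def by (rule continuous_on_eq) simp
  then show ?thesis
    using assms unfolding mspace_loop_space by (auto simp: path_image_def pathstart_def pathfinish_def)
qed

lemma homotopic_paths_restrict: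
  assumes "path p" "path_image p \<subseteq> X"
  shows "homotopic_paths X p (restrict p {0..1})"
  by (rule homotopic_paths_eq) (use assms in auto)

text \<open>Concatenation and reversal only rearrange parameters, so at each parameter the two
  values differ by no more than the sup distance in \<open>q\<close> or in \<open>h\<close>; the
  middle path \<open>c\<close> is fixed.\<close>

lemma continuous_map_join_conj:
  assumes c: "path c" "path_image c \<subseteq> X" "pathstart c = x" "pathfinish c = x"
  shows "continuous_map (prod_topology (mtopology_of (loop_space X x)) (mtopology_of (loop_space X x)))
     (mtopology_of (loop_space X x))
     (\<lambda>(q,h). restrict (q +++ (h +++ (c +++ reversepath h))) {0..1})"
proof (rule continuous_map_loop_spaceI)
  fix a assume "a \<in> topspace (prod_topology (mtopology_of (loop_space X x)) (mtopology_of (loop_space X x)))"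
  then obtain q h where a: "a = (q,h)" "q \<in> mspace (loop_space X x)" "h \<in> mspace (loop_space X x)"
    by auto
  show "(case a of (q,h) \<Rightarrow> restrict (q +++ (h +++ (c +++ reversepath h))) {0..1}) \<in> mspace (loop_space X x)"
    unfolding a(1) prod.case
    by (rule restrict_in_loop_space) (use a c in \<open>auto simp: mspace_loop_space path_image_join\<close>)
  fix e :: real assume e: "e > 0"
  obtain U where U: "openin (mtopology_of (loop_space X x)) U" "q \<in> U"
    "\<And>p t. p \<in> U \<Longrightarrow> t \<in> {0..1} \<Longrightarrow> dist (q t) (p t) \<le> e"
    using openin_loop_space_ball[OF a(2) e] by blast
  obtain V where V: "openin (mtopology_of (loop_space X x)) V" "h \<in> V"
    "\<And>p t. p \<in> V \<Longrightarrow> t \<in> {0..1} \<Longrightarrow> dist (h t) (p t) \<le> e"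
    using openin_loop_space_ball[OF a(3) e] by blast
  show "\<exists>W. openin (prod_topology (mtopology_of (loop_space X x)) (mtopology_of (loop_space X x))) W \<and> a \<in> W \<and>
      (\<forall>b\<in>W. \<forall>t\<in>{0..1}. dist ((case a of (q,h) \<Rightarrow> restrict (q +++ (h +++ (c +++ reversepath h))) {0..1}) t)
         ((case b of (q,h) \<Rightarrow> restrict (q +++ (h +++ (c +++ reversepath h))) {0..1}) t) \<le> e)"
  proof (intro exI[of _ "U \<times> V"] conjI ballI)
    fix b and t :: real assume "b \<in> U \<times> V" and t: "t \<in> {0..1}"
    then obtain q' h' where b: "b = (q',h')" "q' \<in> U" "h' \<in> V" by blast
    show "dist ((case a of (q,h) \<Rightarrow> restrict (q +++ (h +++ (c +++ reversepath h))) {0..1}) t)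
         ((case b of (q,h) \<Rightarrow> restrict (q +++ (h +++ (c +++ reversepath h))) {0..1}) t) \<le> e"
      using t U(3)[OF b(2)] V(3)[OF b(3)] e
      unfolding a(1) b(1) by (auto simp: joinpaths_def reversepath_def)
  qed (use U V a in \<open>auto simp: openin_prod_Times_iff\<close>)
qed

text \<open>A null homotopy is a map on the square with value \<open>x\<close> on three sides. Such
  maps form a closed subspace \<open>A\<close> of a Polish space, and restriction to the fourth side
  maps it continuously onto the null homotopic loops.\<close>

lemma analytic_in_null_homotopic_loops:
  assumes X: "compact X"
  shows "analytic_in (mtopology_of (loop_space X x))
    {p \<in> mspace (loop_space X x). homotopic_paths X p (\<lambda>t. x)}"
proof -
  let ?I = "{0..1::real}"
  let ?F = "function_space (?I \<times> ?I) X"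
  let ?E = "\<lambda>z. {H \<in> mspace ?F. H z = x}"
  define A where "A = (\<Inter>t\<in>?I. ?E (1,t) \<inter> ?E (t,0) \<inter> ?E (t,1))"
  have cI: "compact (?I \<times> ?I)" by (intro compact_Times compact_Icc)
  note msp = mspace_function_space[OF cI, of X]
  have "closedin (mtopology_of ?F) A"
    unfolding A_def by (rule closedin_Inter) (auto intro!: closedin_Int closedin_function_space_evaluation cI)
  then have P: "Polish_space (subtopology (mtopology_of ?F) A)"
    by (intro Polish_space_closed_subtopology Polish_function_space X cI) auto
  have AF: "H \<in> mspace ?F" if "H \<in> A" for H
    using INT_D[OF that[unfolded A_def], of 0] by simp
  have Ax: "H (1,t) = x \<and> H (t,0) = x \<and> H (t,1) = x" if "H \<in> A" "t \<in> ?I" for H t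
    using INT_D[OF that[unfolded A_def]] by simp
  have AI: "H \<in> A" if "H \<in> mspace ?F" "\<And>t. t \<in> ?I \<Longrightarrow> H (1,t) = x \<and> H (t,0) = x \<and> H (t,1) = x" for H
    using that unfolding A_def by simp
  let ?g = "\<lambda>H. restrict (\<lambda>t. H (0::real, t::real)) ?I"
  have Hpath: "path (\<lambda>t. H (s, t))" if "H \<in> mspace ?F" "s \<in> ?I" for H s
    unfolding path_def
    by (rule continuous_on_compose2[where g = H]) (use that msp in \<open>auto intro!: continuous_intros\<close>)
  have gL: "?g H \<in> mspace (loop_space X x)" if H: "H \<in> A" for H
  proof (rule restrict_in_loop_space)
    have H': "H \<in> mspace ?F" using AF[OF H] .
    show "path (\<lambda>t. H (0,t))" by (rule Hpath[OF H']) simp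
    show "path_image (\<lambda>t. H (0, t)) \<subseteq> X"
      using H' unfolding msp by (force simp: path_image_def)
    show "pathstart (\<lambda>t. H (0, t)) = x" "pathfinish (\<lambda>t. H (0, t)) = x"
      using Ax[OF H, of 0] by (simp_all add: pathstart_def pathfinish_def)
  qed
  have ts: "topspace (subtopology (mtopology_of ?F) A) = A"
    using AF by (simp only: topspace_subtopology topspace_mtopology_of) blast
  have "continuous_map (subtopology (mtopology_of ?F) A) (mtopology_of (loop_space X x)) ?g"
  proof (rule continuous_map_loop_spaceI, unfold ts)
    interpret F: Metric_space "mspace ?F" "mdist ?F" by (rule Metric_space_mspace_mdist)
    fix H and e :: real assume H: "H \<in> A" and e: "e > 0"
    have HF: "H \<in> mspace ?F" using AF[OF H] .
    have "dist (?g H t) (?g H' t) \<le> e" if H': "H' \<in> F.mball H e" and t: "t \<in> ?I" for H' t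
    proof -
      have "H' \<in> mspace ?F" "mdist ?F H H' \<le> e" using H' by (simp_all add: F.in_mball del: mspace_cfunspace)
      then have "dist (H (0,t)) (H' (0,t)) \<le> e"
        using mdist_function_space_le_iff[OF HF, of H' e] t by auto
      then show ?thesis using t by simp
    qed
    moreover have "openin (subtopology (mtopology_of ?F) A) (A \<inter> F.mball H e)"
      by (rule openin_subtopology_Int2) (simp add: mtopology_of_def)
    moreover have "H \<in> A \<inter> F.mball H e"
      using H HF e F.centre_in_mball_iff by blast
    ultimately show "\<exists>U. openin (subtopology (mtopology_of ?F) A) U \<and> H \<in> U \<and>
        (\<forall>b\<in>U. \<forall>t\<in>{0..1}. dist (?g H t) (?g b t) \<le> e)"
      by (intro exI[of _ "A \<inter> F.mball H e"] conjI) (assumption | blast)+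
  qed (rule gL)
  from analytic_inI[OF P this] have an: "analytic_in (mtopology_of (loop_space X x)) (?g ` A)"
    unfolding ts .
  have "?g ` A = {p \<in> mspace (loop_space X x). homotopic_paths X p (\<lambda>t. x)}"
  proof (rule subset_antisym; rule subsetI)
    fix p assume "p \<in> ?g ` A"
    then obtain H where H: "H \<in> A" "p = ?g H" by blast
    have HF: "continuous_on (?I \<times> ?I) H" "H ` (?I \<times> ?I) \<subseteq> X" using AF[OF H(1)] msp by auto
    have "homotopic_paths X p (\<lambda>t. x)"
      unfolding homotopic_paths
      using HF Ax[OF H(1)] H(2) by (intro exI[of _ H]) (auto simp: pathstart_def pathfinish_def)
    then show "p \<in> {p \<in> mspace (loop_space X x). homotopic_paths X p (\<lambda>t. x)}"
      using gL[OF H(1)] H(2) by blast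
  next
    fix p assume "p \<in> {p \<in> mspace (loop_space X x). homotopic_paths X p (\<lambda>t. x)}"
    then have p: "p \<in> mspace (loop_space X x)" "homotopic_paths X p (\<lambda>t. x)" by auto
    then obtain h where h: "continuous_on (?I \<times> ?I) h" "h \<in> ?I \<times> ?I \<rightarrow> X"
      "\<And>t. t \<in> ?I \<Longrightarrow> h (0,t) = p t" "\<And>t. t \<in> ?I \<Longrightarrow> h (1,t) = x"
      "\<And>t. t \<in> ?I \<Longrightarrow> h (t,0) = p 0 \<and> h (t,1) = p 1"
      unfolding homotopic_paths pathstart_def pathfinish_def by auto
    define H where "H = restrict h (?I \<times> ?I)"
    have "continuous_on (?I \<times> ?I) H"
      unfolding H_def using h(1) by (rule continuous_on_eq) simp
    then have HF: "H \<in> mspace ?F"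
      unfolding msp H_def using h(2) by auto
    have p01: "p 0 = x" "p 1 = x" and ext: "p \<in> extensional ?I"
      using p(1) by (auto simp: mspace_loop_space pathstart_def pathfinish_def)
    have "H (1,t) = x \<and> H (t,0) = x \<and> H (t,1) = x" if "t \<in> ?I" for t
      using that h(4)[OF that] h(5)[OF that] p01 by (simp add: H_def)
    then have "H \<in> A"
      by (rule AI[OF HF])
    moreover have "p t = ?g H t" for t
      using h(3)[of t] extensional_arb[OF ext, of t] by (cases "t \<in> ?I") (simp_all add: H_def)
    then have "p = ?g H" by blast
    ultimately show "p \<in> ?g ` A" by blast
  qed
  then show ?thesis using an by simp
qed

section \<open>Normal subgroups spanned by conjugates\<close>

text \<open>The sets \<open>N[w]\<close> of the overview. The conjugators are chosen independently
  for each letter, and the head of the word is the rightmost factor, so that a letter is removed by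
  one multiplication on the right.\<close>

primrec conj_products :: "('a, 'b) monoid_scheme \<Rightarrow> 'a set \<Rightarrow> 'a list \<Rightarrow> 'a set" where
  "conj_products G N [] = N"
| "conj_products G N (c # w) =
     {k \<otimes>\<^bsub>G\<^esub> (h \<otimes>\<^bsub>G\<^esub> (c \<otimes>\<^bsub>G\<^esub> inv\<^bsub>G\<^esub> h)) |k h. k \<in> conj_products G N w \<and> h \<in> carrier G}"

text \<open>For normal \<open>N\<close> and \<open>F\<close> inside the group this is the normal
  subgroup generated by both. It is presented by words in order to be a countable union when
  \<open>F\<close> is countable.\<close>

definition normal_span :: "('a, 'b) monoid_scheme \<Rightarrow> 'a set \<Rightarrow> 'a set \<Rightarrow> 'a set" where
  "normal_span G N F = (\<Union>w\<in>lists (F \<union> (\<lambda>a. inv\<^bsub>G\<^esub> a) ` F). conj_products G N w)"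

context normal
begin

lemma conj_products_carrier:
  "w \<in> lists (carrier G) \<Longrightarrow> conj_products G H w \<subseteq> carrier G"
  by (induction w rule: list.induct) auto

text \<open>Conjugation acts on every factor separately: it preserves the normal subgroup and turns
  a conjugator \<open>h\<close> into \<open>g \<otimes> h\<close>, without changing the
  word.\<close>

lemma conj_products_conj:
  assumes "w \<in> lists (carrier G)" "a \<in> conj_products G H w" "g \<in> carrier G"
  shows "g \<otimes> a \<otimes> inv g \<in> conj_products G H w"
  using assms
proof (induction w arbitrary: a rule: list.induct)
  case Nil
  then show ?case by (simp add: inv_op_closed2)
next
  case (Cons c w)
  from Cons.prems obtain k h where a: "a = k \<otimes> (h \<otimes> (c \<otimes> inv h))" "k \<in> conj_products G H w" "h \<in> carrier G"
    by auto
  have w: "w \<in> lists (carrier G)" and c: "c \<in> carrier G" using Cons.prems(1) by simp_all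
  have k: "k \<in> carrier G" using a(2) conj_products_carrier[OF w] by blast
  have "g \<otimes> a \<otimes> inv g = (g \<otimes> k \<otimes> inv g) \<otimes> ((g \<otimes> h) \<otimes> (c \<otimes> inv (g \<otimes> h)))"
    using a(1,3) k c Cons.prems(3) by (simp add: m_assoc inv_mult_group inv_solve_left)
  moreover have "g \<otimes> k \<otimes> inv g \<in> conj_products G H w"
    by (rule Cons.IH[OF w a(2) Cons.prems(3)])
  ultimately show ?case
    using a(3) Cons.prems(3) by auto
qed

text \<open>An element \<open>b\<close> of the normal subgroup moves to the left past a factor
  \<open>t\<close> as \<open>t \<otimes> b \<otimes> inv t\<close>, until it is absorbed at the left
  end.\<close>

lemma conj_products_mult_left:
  assumes "w \<in> lists (carrier G)" "a \<in> conj_products G H w" "b \<in> H"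
  shows "a \<otimes> b \<in> conj_products G H w"
  using assms
proof (induction w arbitrary: a b rule: list.induct)
  case (Cons c w)
  from Cons.prems obtain k h where a: "a = k \<otimes> (h \<otimes> (c \<otimes> inv h))" "k \<in> conj_products G H w" "h \<in> carrier G"
    by auto
  have w: "w \<in> lists (carrier G)" and c: "c \<in> carrier G" using Cons.prems(1) by simp_all
  have k: "k \<in> carrier G" using a(2) conj_products_carrier[OF w] by blast
  define t where "t = h \<otimes> (c \<otimes> inv h)"
  have t: "t \<in> carrier G" using a(3) c by (simp add: t_def)
  have b: "b \<in> carrier G" using Cons.prems(3) by (rule mem_carrier)
  have "a \<otimes> b = (k \<otimes> (t \<otimes> b \<otimes> inv t)) \<otimes> t"
    unfolding a(1) t_def[symmetric] using t k b by (simp add: m_assoc)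
  moreover have "k \<otimes> (t \<otimes> b \<otimes> inv t) \<in> conj_products G H w"
    by (rule Cons.IH[OF w a(2)]) (rule inv_op_closed2[OF t Cons.prems(3)])
  ultimately show ?case
    using a(3) unfolding t_def by auto
qed simp

text \<open>The words appear in reverse order because the head of a word is its rightmost
  factor.\<close>

lemma conj_products_append:
  assumes "v \<in> lists (carrier G)" "w \<in> lists (carrier G)"
    "a \<in> conj_products G H v" "b \<in> conj_products G H w"
  shows "a \<otimes> b \<in> conj_products G H (w @ v)"
  using assms
proof (induction w arbitrary: b rule: list.induct)
  case Nil
  then show ?case by (simp add: conj_products_mult_left)
next
  case (Cons c w)
  from Cons.prems obtain k h where b: "b = k \<otimes> (h \<otimes> (c \<otimes> inv h))" "k \<in> conj_products G H w" "h \<in> carrier G"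
    by auto
  have w: "w \<in> lists (carrier G)" and c: "c \<in> carrier G" using Cons.prems(2) by simp_all
  have k: "k \<in> carrier G" and a: "a \<in> carrier G"
    using b(2) Cons.prems(1,3) conj_products_carrier w by blast+
  have "a \<otimes> b = (a \<otimes> k) \<otimes> (h \<otimes> (c \<otimes> inv h))"
    using b(1,3) k a c by (simp add: m_assoc)
  moreover have "a \<otimes> k \<in> conj_products G H (w @ v)"
    by (rule Cons.IH[OF Cons.prems(1) w Cons.prems(3) b(2)])
  ultimately show ?case using b(3) by auto
qed

lemma conj_products_single:
  assumes "c \<in> carrier G" "h \<in> carrier G"
  shows "h \<otimes> (c \<otimes> inv h) \<in> conj_products G H [c]"
  unfolding conj_products.simps
  by (rule CollectI, rule exI[of _ \<one>], rule exI[of _ h]) (use assms in simp)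

lemma conj_products_inv:
  assumes "w \<in> lists (carrier G)" "a \<in> conj_products G H w"
  shows "inv a \<in> conj_products G H (rev (map (\<lambda>c. inv c) w))"
  using assms
proof (induction w arbitrary: a rule: list.induct)
  case (Cons c w)
  from Cons.prems obtain k h where a: "a = k \<otimes> (h \<otimes> (c \<otimes> inv h))" "k \<in> conj_products G H w" "h \<in> carrier G"
    by auto
  have w: "w \<in> lists (carrier G)" and c: "c \<in> carrier G" using Cons.prems(1) by simp_all
  have k: "k \<in> carrier G" using a(2) conj_products_carrier[OF w] by blast
  have "inv a = (h \<otimes> (inv c \<otimes> inv h)) \<otimes> inv k"
    using a(1,3) k c by (simp add: inv_mult_group m_assoc)
  moreover have "(h \<otimes> (inv c \<otimes> inv h)) \<otimes> inv k
      \<in> conj_products G H (rev (map (\<lambda>c. inv c) w) @ [inv c])"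
    by (rule conj_products_append[OF _ _ conj_products_single Cons.IH[OF w a(2)]])
      (use w c a(3) in auto)
  ultimately show ?case by simp
qed simp

lemma lists_generators_carrier:
  "F \<subseteq> carrier G \<Longrightarrow> w \<in> lists (F \<union> (\<lambda>a. inv a) ` F) \<Longrightarrow> w \<in> lists (carrier G)"
  by (erule subsetD[OF lists_mono, rotated]) auto

lemma normal_span_normal:
  assumes F: "F \<subseteq> carrier G"
  shows "normal_span G H F \<lhd> G"
proof (rule normal_invI)
  let ?L = "lists (F \<union> (\<lambda>a. inv a) ` F)"
  note Lc = lists_generators_carrier[OF F]
  show "subgroup (normal_span G H F) G"
  proof
    show "normal_span G H F \<subseteq> carrier G"
      unfolding normal_span_def using Lc conj_products_carrier by blast
    show "\<one> \<in> normal_span G H F"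
      unfolding normal_span_def by (intro UN_I[of "[]"]) auto
    fix a b assume "a \<in> normal_span G H F" "b \<in> normal_span G H F"
    then obtain v w where "v \<in> ?L" "w \<in> ?L" "a \<in> conj_products G H v" "b \<in> conj_products G H w"
      unfolding normal_span_def by blast
    then show "a \<otimes> b \<in> normal_span G H F"
      unfolding normal_span_def using conj_products_append[of v w a b] Lc by (intro UN_I[of "w @ v"]) auto
  next
    fix a assume "a \<in> normal_span G H F"
    then obtain w where w: "w \<in> ?L" "a \<in> conj_products G H w"
      unfolding normal_span_def by blast
    have "(\<lambda>a. inv a) ` (F \<union> (\<lambda>a. inv a) ` F) \<subseteq> F \<union> (\<lambda>a. inv a) ` F"
      using F by auto
    moreover have "set w \<subseteq> F \<union> (\<lambda>a. inv a) ` F"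
      using w(1) by (simp only: in_lists_conv_set) blast
    ultimately have "set (rev (map (\<lambda>c. inv c) w)) \<subseteq> F \<union> (\<lambda>a. inv a) ` F"
      by (simp only: set_rev set_map) blast
    then have "rev (map (\<lambda>c. inv c) w) \<in> ?L"
      by (simp only: in_lists_conv_set) blast
    then show "inv a \<in> normal_span G H F"
      unfolding normal_span_def using conj_products_inv[OF Lc[OF w(1)] w(2)] by blast
  qed
  fix g a assume g: "g \<in> carrier G" and "a \<in> normal_span G H F"
  then show "g \<otimes> a \<otimes> inv g \<in> normal_span G H F"
    unfolding normal_span_def using conj_products_conj Lc by blast
qed

lemma subset_normal_span: "H \<subseteq> normal_span G H F"
  unfolding normal_span_def using UN_upper[of "[]" _ "conj_products G H"] by simp

lemma generators_subset_normal_span: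
  assumes "F \<subseteq> carrier G"
  shows "F \<subseteq> normal_span G H F"
proof
  fix c assume c: "c \<in> F"
  then have "\<one> \<otimes> (c \<otimes> inv \<one>) \<in> conj_products G H [c]"
    using assms by (intro conj_products_single) auto
  moreover have "\<one> \<otimes> (c \<otimes> inv \<one>) = c" "[c] \<in> lists (F \<union> (\<lambda>a. inv a) ` F)"
    using c assms by auto
  ultimately show "c \<in> normal_span G H F"
    unfolding normal_span_def by (metis UN_I)
qed

lemma normal_span_mono: "F \<subseteq> F' \<Longrightarrow> normal_span G H F \<subseteq> normal_span G H F'"
  unfolding normal_span_def by (intro UN_mono lists_mono) auto

lemma normal_span_least:
  assumes K: "K \<lhd> G" and "H \<subseteq> K" "F \<subseteq> K"
  shows "normal_span G H F \<subseteq> K"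
proof -
  interpret K: normal K G by (rule K)
  have "conj_products G H w \<subseteq> K" if "w \<in> lists K" for w
    using that
  proof (induction w rule: list.induct)
    case (Cons c w)
    then have "c \<in> K" "conj_products G H w \<subseteq> K" by auto
    then show ?case
      using K.inv_op_closed2[of _ c] K.mem_carrier by (auto simp: m_assoc[symmetric] subset_iff)
  qed (use assms in auto)
  moreover have "F \<union> (\<lambda>a. inv a) ` F \<subseteq> K"
    using assms(3) by auto
  ultimately show ?thesis
    unfolding normal_span_def using lists_mono by blast
qed

end

section \<open>Normal closures in a group and in its quotients\<close>

lemma normal_closure_eq_carrier_iff:
  assumes "group G" "S \<subseteq> carrier G"
  shows "normal_closure G S = carrier G \<longleftrightarrow> (\<forall>K. K \<lhd> G \<longrightarrow> S \<subseteq> K \<longrightarrow> K = carrier G)"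
proof -
  interpret group G by fact
  have "carrier G \<lhd> G"
    by (rule normal_invI) (auto intro: subgroup_self)
  \<comment> \<open>The carrier belongs to the family that \<open>hull\<close> intersects, so the
    intersection is the carrier exactly when every member is. Normality of the hull itself does not
    enter.\<close>
  then have "carrier G \<in> {K. K \<lhd> G \<and> S \<subseteq> K}"
    using assms(2) by blast
  moreover have "K \<subseteq> carrier G" if "K \<lhd> G" for K
    using that normal_imp_subgroup subgroup.subset by blast
  ultimately show ?thesis
    unfolding normal_closure_def hull_def by blast
qed

lemma card_comonster_aleph_1_iff:
  "card_comonster aleph_1 G \<longleftrightarrow>
     (\<forall>S. S \<subseteq> carrier G \<and> countable S \<longrightarrow> normal_closure G S \<noteq> carrier G)"
proof -
  have "|S| <o aleph_1 \<longleftrightarrow> countable S" for S :: "'a set"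
    using cardSuc_ordLeq_ordLess[OF natLeq_Card_order card_of_Card_order] countable_card_le_natLeq by blast
  then show ?thesis
    unfolding card_comonster_def by simp
qed

context normal
begin

text \<open>Lift \<open>S\<close> to representatives. Their span with \<open>H\<close> has a normal
  image containing \<open>S\<close>, which is the whole quotient, and since the span contains
  \<open>H\<close> it is all of \<open>G\<close>. The finite subset supplied by
  \<open>finite_span\<close> then descends to a finite subset of \<open>S\<close> that normally
  generates the quotient.\<close>

lemma card_comonster_FactGroupI:
  assumes finite_span: "\<And>S. countable S \<Longrightarrow> S \<subseteq> carrier G \<Longrightarrow> normal_span G H S = carrier G \<Longrightarrow>
      \<exists>F\<subseteq>S. finite F \<and> normal_span G H F = carrier G"
    and "comonster (G Mod H)"
  shows "card_comonster aleph_1 (G Mod H)"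
  unfolding card_comonster_aleph_1_iff
proof (intro allI impI notI, elim conjE)
  fix S assume S: "S \<subseteq> carrier (G Mod H)" "countable S" "normal_closure (G Mod H) S = carrier (G Mod H)"
  let ?q = "\<lambda>a. H #> a"
  have qhom: "?q \<in> hom G (G Mod H)" by (rule r_coset_hom_Mod)
  have gQ: "group (G Mod H)" by (rule factorgroup_is_group)
  interpret q: group_hom G "G Mod H" ?q
    by (rule group_hom.intro[OF is_group gQ]) (simp add: group_hom_axioms_def qhom)
  have surj: "?q ` carrier G = carrier (G Mod H)" by (simp add: carrier_FactGroup)
  have "\<forall>A\<in>S. \<exists>a\<in>carrier G. A = ?q a" using S(1) surj by blast
  then obtain r where r: "\<And>A. A \<in> S \<Longrightarrow> r A \<in> carrier G \<and> A = ?q (r A)" by metis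
  have rS: "r ` S \<subseteq> carrier G" using r by blast
  let ?K = "normal_span G H (r ` S)"
  have K: "?K \<lhd> G" by (rule normal_span_normal[OF rS])
  interpret K: normal ?K G by (rule K)
  have "?q ` ?K \<lhd> G Mod H"
    by (rule normal.surj_hom_normal_subgroup[OF K q.group_hom_axioms surj])
  moreover have "S \<subseteq> ?q ` ?K"
    using r generators_subset_normal_span[OF rS] by blast
  ultimately have qK: "?q ` ?K = carrier (G Mod H)"
    using S(3) normal_closure_eq_carrier_iff[OF gQ S(1)] by blast
  have "a \<in> ?K" if a: "a \<in> carrier G" for a
  proof -
    obtain k where k: "k \<in> ?K" "?q a = ?q k" using qK surj a by (metis imageE imageI)
    have "a \<in> ?q a" using a rcos_self subgroup_axioms by blast
    then have "a \<in> H #> k" using k(2) by simp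
    then obtain n where "n \<in> H" "a = n \<otimes> k" unfolding r_coset_def by auto
    then show ?thesis using k(1) subset_normal_span[of "r ` S"] K.m_closed by blast
  qed
  then have "?K = carrier G" using K.subset by blast
  then obtain F where F: "F \<subseteq> r ` S" "finite F" "normal_span G H F = carrier G"
    using finite_span[OF countable_image[OF S(2)] rS] by blast
  then obtain F0 where F0: "F0 \<subseteq> S" "finite F0" "F = r ` F0"
    by (metis finite_subset_image)
  have F0c: "F0 \<subseteq> carrier (G Mod H)" using F0(1) S(1) by blast
  have "M = carrier (G Mod H)" if M: "M \<lhd> G Mod H" "F0 \<subseteq> M" for M
  proof -
    interpret M: normal M "G Mod H" by (rule M)
    \<comment> \<open>The full preimage of \<open>M\<close> is normal and contains \<open>H\<close>
      and \<open>F\<close>, so it contains the span of both, which is \<open>G\<close>.\<close>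
    let ?P = "{a \<in> carrier G. ?q a \<in> M}"
    have "?P \<lhd> G"
    proof (rule normal_invI)
      show "subgroup ?P G"
      proof
        show "\<one> \<in> ?P" using M.one_closed q.hom_one by (metis (mono_tags, lifting) mem_Collect_eq one_closed)
        fix a b assume "a \<in> ?P" "b \<in> ?P"
        then show "a \<otimes> b \<in> ?P" using M.m_closed[of "?q a" "?q b"] q.hom_mult[of a b] by simp
      next
        fix a assume "a \<in> ?P"
        then show "inv a \<in> ?P" using M.m_inv_closed[of "?q a"] q.hom_inv[of a] by simp
      qed auto
      fix g a assume ga: "g \<in> carrier G" "a \<in> ?P"
      have "?q g \<in> carrier (G Mod H)" using ga(1) surj by blast
      then have "?q g \<otimes>\<^bsub>G Mod H\<^esub> ?q a \<otimes>\<^bsub>G Mod H\<^esub> inv\<^bsub>G Mod H\<^esub> ?q g \<in> M"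
        using M.inv_op_closed2 ga(2) by blast
      moreover have "?q (g \<otimes> a \<otimes> inv g) = ?q g \<otimes>\<^bsub>G Mod H\<^esub> ?q a \<otimes>\<^bsub>G Mod H\<^esub> inv\<^bsub>G Mod H\<^esub> ?q g"
        using ga q.hom_mult q.hom_inv by (metis (no_types, lifting) inv_closed m_closed mem_Collect_eq)
      ultimately show "g \<otimes> a \<otimes> inv g \<in> ?P" using ga by simp
    qed
    moreover have "H \<subseteq> ?P"
    proof
      fix n assume n: "n \<in> H"
      then have "?q n = \<one>\<^bsub>G Mod H\<^esub>"
        by (simp add: rcos_const)
      then show "n \<in> ?P" using n mem_carrier M.one_closed by auto
    qed
    moreover have "F \<subseteq> ?P"
      using F0 M(2) r by (auto simp: subset_iff)
    ultimately have "carrier G \<subseteq> ?P"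
      using normal_span_least F(3) by metis
    then have "?q ` carrier G \<subseteq> M"
      by (simp only: image_subset_iff) blast
    then show ?thesis
      using M.subset unfolding surj by (rule subset_antisym[rotated])
  qed
  then have "normal_closure (G Mod H) F0 = carrier (G Mod H)"
    using normal_closure_eq_carrier_iff[OF gQ F0c] by blast
  then show False
    using assms(2) F0(2) F0c unfolding comonster_def by blast
qed

end

text \<open>The version for the group itself, with the trivial subgroup in place of
  \<open>H\<close>; it avoids the passage through the isomorphic quotient by that subgroup.\<close>

lemma (in group) card_comonsterI:
  assumes finite_span: "\<And>S. countable S \<Longrightarrow> S \<subseteq> carrier G \<Longrightarrow> normal_span G {\<one>} S = carrier G \<Longrightarrow>
      \<exists>F\<subseteq>S. finite F \<and> normal_span G {\<one>} F = carrier G"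
    and "comonster G"
  shows "card_comonster aleph_1 G"
proof -
  interpret T: normal "{\<one>}" G
    by (rule normal_invI) (auto intro: triv_subgroup)
  have iff: "normal_closure G S = carrier G \<longleftrightarrow> normal_span G {\<one>} S = carrier G" if S: "S \<subseteq> carrier G" for S
  proof -
    have "{\<one>} \<subseteq> K \<and> K \<subseteq> carrier G" if "K \<lhd> G" for K
      using normal_imp_subgroup[OF that] subgroup.one_closed subgroup.subset by blast
    then show ?thesis
      unfolding normal_closure_eq_carrier_iff[OF is_group S]
      using T.normal_span_normal[OF S] T.generators_subset_normal_span[OF S] T.normal_span_least
      by (metis subset_antisym)
  qed
  show ?thesis
    unfolding card_comonster_aleph_1_iff
  proof (intro allI impI notI, elim conjE)
    fix S assume S: "S \<subseteq> carrier G" "countable S" "normal_closure G S = carrier G"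
    then obtain F where F: "F \<subseteq> S" "finite F" "normal_span G {\<one>} F = carrier G"
      using finite_span[OF S(2,1)] iff[OF S(1)] by auto
    then have "F \<subseteq> carrier G" "normal_closure G F = carrier G"
      using S(1) iff[of F] by auto
    then show False
      using assms(2) F(2) unfolding comonster_def by simp
  qed
qed

section \<open>The fundamental group and its path groupoid\<close>

lemma path_const: "path (\<lambda>t. a)"
  by (simp add: path_def)

lemma path_image_const: "path_image (\<lambda>t. a) = {a}"
  by (auto simp: path_image_def)

text \<open>The points lie in a metric space without linear structure, so the constant path is
  written as a function and not as \<open>linepath a a\<close>. The concatenation is
  \<open>p\<close> reparametrized by \<open>min 1 (2 * t)\<close>.\<close>

lemma homotopic_paths_rid_const:
  assumes "path p" "path_image p \<subseteq> S" "pathfinish p = a"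
  shows "homotopic_paths S (p +++ (\<lambda>t. a)) p"
proof (rule homotopic_paths_sym, rule homotopic_paths_reparametrize[OF assms(1,2)])
  show "continuous_on {0..1} (\<lambda>t::real. min 1 (2 * t))"
    by (intro continuous_intros)
qed (use assms(3) in \<open>auto simp: joinpaths_def pathfinish_def min_def intro: arg_cong[of _ _ p]\<close>)

lemma homotopic_paths_lid_const:
  assumes "path p" "path_image p \<subseteq> S" "pathstart p = a"
  shows "homotopic_paths S ((\<lambda>t. a) +++ p) p"
proof (rule homotopic_paths_sym, rule homotopic_paths_reparametrize[OF assms(1,2)])
  show "continuous_on {0..1} (\<lambda>t::real. max 0 (2 * t - 1))"
    by (intro continuous_intros)
qed (use assms(3) in \<open>auto simp: joinpaths_def pathstart_def max_def intro: arg_cong[of _ _ p]\<close>)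

text \<open>The cancellation takes place in the parameter interval, where line paths exist, for the
  identity path; \<open>p\<close> then carries it to \<open>S\<close>.\<close>

lemma homotopic_paths_rinv_const:
  assumes "path p" "path_image p \<subseteq> S" "pathstart p = a"
  shows "homotopic_paths S (p +++ reversepath p) (\<lambda>t. a)"
proof -
  let ?i = "\<lambda>t::real. t"
  have "homotopic_paths {0..1} (?i +++ reversepath ?i) (linepath (pathstart ?i) (pathstart ?i))"
    by (rule homotopic_paths_rinv) (auto simp: path_def path_image_def)
  moreover have "continuous_on {0..1} p" "p \<in> {0..1} \<rightarrow> S"
    using assms(1,2) by (auto simp: path_def path_image_def)
  ultimately have "homotopic_paths S (p \<circ> (?i +++ reversepath ?i)) (p \<circ> linepath (pathstart ?i) (pathstart ?i))"
    by (rule homotopic_paths_continuous_image)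
  moreover have "p \<circ> (?i +++ reversepath ?i) = p +++ reversepath p"
    by (auto simp: joinpaths_def reversepath_def fun_eq_iff)
  moreover have "p \<circ> linepath (pathstart ?i) (pathstart ?i) = (\<lambda>t. a)"
    using assms(3) by (auto simp: pathstart_def linepath_def fun_eq_iff)
  ultimately show ?thesis by simp
qed

lemma homotopic_paths_linv_const:
  assumes "path p" "path_image p \<subseteq> S" "pathfinish p = a"
  shows "homotopic_paths S (reversepath p +++ p) (\<lambda>t. a)"
  using homotopic_paths_rinv_const[of "reversepath p" S a] assms by simp

lemma homotopic_paths_cancel_left:
  assumes "path p" "path_image p \<subseteq> S" "path q" "path_image q \<subseteq> S" "pathfinish p = pathstart q"
  shows "homotopic_paths S (reversepath p +++ (p +++ q)) q"
proof -
  have "homotopic_paths S (reversepath p +++ (p +++ q)) ((reversepath p +++ p) +++ q)"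
    by (rule homotopic_paths_assoc) (use assms in auto)
  also have "homotopic_paths S \<dots> ((\<lambda>t. pathfinish p) +++ q)"
    by (rule homotopic_paths_join[OF homotopic_paths_linv_const]) (use assms in auto)
  also have "homotopic_paths S \<dots> q"
    by (rule homotopic_paths_lid_const) (use assms in auto)
  finally show ?thesis .
qed

text \<open>Loops with arbitrary values outside the unit interval, in contrast to the points of
  \<open>loop_space\<close>, so that concatenation and reversal stay within this notion.\<close>

definition loop_at :: "'a::metric_space set \<Rightarrow> 'a \<Rightarrow> (real \<Rightarrow> 'a) \<Rightarrow> bool" where
  "loop_at X x p \<longleftrightarrow> path p \<and> path_image p \<subseteq> X \<and> pathstart p = x \<and> pathfinish p = x"

lemma loop_atD:
  assumes "loop_at X x p"
  shows "path p" "path_image p \<subseteq> X" "pathstart p = x" "pathfinish p = x"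
  using assms by (auto simp: loop_at_def)

lemma loop_at_mspace: "p \<in> mspace (loop_space X x) \<Longrightarrow> loop_at X x p"
  by (simp add: mspace_loop_space loop_at_def)

lemma loop_at_join: "loop_at X x p \<Longrightarrow> loop_at X x q \<Longrightarrow> loop_at X x (p +++ q)"
  by (simp add: loop_at_def path_image_join)

lemma loop_at_reversepath: "loop_at X x p \<Longrightarrow> loop_at X x (reversepath p)"
  by (simp add: loop_at_def)

lemma loop_at_const: "x \<in> X \<Longrightarrow> loop_at X x (\<lambda>t. x)"
  by (simp add: loop_at_def path_const path_image_const pathstart_def pathfinish_def)

lemma loop_at_restrict: "loop_at X x p \<Longrightarrow> restrict p {0..1} \<in> mspace (loop_space X x)"
  unfolding loop_at_def by (elim conjE) (rule restrict_in_loop_space)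

lemma loop_class_eqI: "homotopic_paths X p q \<Longrightarrow> loop_class X x p = loop_class X x q"
  unfolding loop_class_def using homotopic_paths_trans homotopic_paths_sym by blast

lemma loop_class_restrict_mem:
  "loop_at X x p \<Longrightarrow> restrict p {0..1} \<in> loop_class X x p"
  by (simp add: loop_class_def loop_at_restrict homotopic_paths_restrict loop_atD)

lemma loop_class_self: "p \<in> mspace (loop_space X x) \<Longrightarrow> p \<in> loop_class X x p"
  unfolding loop_class_def using loop_at_mspace by (auto simp: loop_at_def)

lemma carrier_fundamental_group:
  "carrier (fundamental_group X x) = {loop_class X x p |p. loop_at X x p}"
proof -
  have "\<exists>q\<in>mspace (loop_space X x). loop_class X x p = loop_class X x q" if "loop_at X x p" for p
    using loop_at_restrict[OF that] loop_class_eqI[OF homotopic_paths_restrict[OF loop_atD(1,2)[OF that]]] by blast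
  then show ?thesis
    unfolding fundamental_group_def partial_object.simps image_def using loop_at_mspace by blast
qed

lemma loop_class_in_carrier: "loop_at X x p \<Longrightarrow> loop_class X x p \<in> carrier (fundamental_group X x)"
  unfolding carrier_fundamental_group by blast

lemma fundamental_group_carrierE:
  assumes "a \<in> carrier (fundamental_group X x)"
  obtains p where "p \<in> mspace (loop_space X x)" "a = loop_class X x p"
  using assms unfolding fundamental_group_def by auto

lemma one_fundamental_group: "\<one>\<^bsub>fundamental_group X x\<^esub> = loop_class X x (\<lambda>t. x)"
  by (simp add: fundamental_group_def)

lemma mult_fundamental_group:
  assumes p: "loop_at X x p" and q: "loop_at X x q"
  shows "loop_class X x p \<otimes>\<^bsub>fundamental_group X x\<^esub> loop_class X x q = loop_class X x (p +++ q)"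
proof -
  have "loop_class X x (p' +++ q') = loop_class X x (p +++ q)"
    if "p' \<in> loop_class X x p" "q' \<in> loop_class X x q" for p' q'
  proof (rule loop_class_eqI, rule homotopic_paths_join)
    show h: "homotopic_paths X p' p" "homotopic_paths X q' q"
      using that homotopic_paths_sym unfolding loop_class_def by blast+
    show "pathfinish p' = pathstart q'"
      using homotopic_paths_imp_pathfinish[OF h(1)] homotopic_paths_imp_pathstart[OF h(2)]
      by (simp add: loop_atD[OF p] loop_atD[OF q])
  qed
  then show ?thesis
    using loop_class_restrict_mem[OF p] loop_class_restrict_mem[OF q]
    unfolding fundamental_group_def by (simp add: UN_constant_eq) blast
qed

lemma group_fundamental_group:
  assumes "x \<in> X"
  shows "group (fundamental_group X x)"
proof (rule groupI)
  let ?G = "fundamental_group X x"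
  show "\<one>\<^bsub>?G\<^esub> \<in> carrier ?G"
    unfolding one_fundamental_group by (rule loop_class_in_carrier[OF loop_at_const[OF assms]])
  fix a assume "a \<in> carrier ?G"
  then obtain p where p: "loop_at X x p" "a = loop_class X x p"
    unfolding carrier_fundamental_group by blast
  show "\<one>\<^bsub>?G\<^esub> \<otimes>\<^bsub>?G\<^esub> a = a"
    unfolding p(2) one_fundamental_group mult_fundamental_group[OF loop_at_const[OF assms] p(1)]
    by (rule loop_class_eqI, rule homotopic_paths_lid_const) (use loop_atD[OF p(1)] in auto)
  have "loop_class X x (reversepath p) \<otimes>\<^bsub>?G\<^esub> a = \<one>\<^bsub>?G\<^esub>"
    unfolding p(2) one_fundamental_group mult_fundamental_group[OF loop_at_reversepath[OF p(1)] p(1)]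
    by (rule loop_class_eqI, rule homotopic_paths_linv_const) (use loop_atD[OF p(1)] in auto)
  then show "\<exists>b\<in>carrier ?G. b \<otimes>\<^bsub>?G\<^esub> a = \<one>\<^bsub>?G\<^esub>"
    using loop_class_in_carrier[OF loop_at_reversepath[OF p(1)]] by blast
  fix b assume "b \<in> carrier ?G"
  then obtain q where q: "loop_at X x q" "b = loop_class X x q"
    unfolding carrier_fundamental_group by blast
  show "a \<otimes>\<^bsub>?G\<^esub> b \<in> carrier ?G"
    unfolding p(2) q(2) mult_fundamental_group[OF p(1) q(1)]
    by (rule loop_class_in_carrier[OF loop_at_join[OF p(1) q(1)]])
  fix c assume "c \<in> carrier ?G"
  then obtain r where r: "loop_at X x r" "c = loop_class X x r"
    unfolding carrier_fundamental_group by blast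
  show "a \<otimes>\<^bsub>?G\<^esub> b \<otimes>\<^bsub>?G\<^esub> c = a \<otimes>\<^bsub>?G\<^esub> (b \<otimes>\<^bsub>?G\<^esub> c)"
    unfolding p(2) q(2) r(2) mult_fundamental_group[OF p(1) q(1)] mult_fundamental_group[OF q(1) r(1)]
      mult_fundamental_group[OF p(1) loop_at_join[OF q(1) r(1)]] mult_fundamental_group[OF loop_at_join[OF p(1) q(1)] r(1)]
    by (rule loop_class_eqI, rule homotopic_paths_sym, rule homotopic_paths_assoc)
      (use loop_atD[OF p(1)] loop_atD[OF q(1)] loop_atD[OF r(1)] in auto)
qed

lemma inv_fundamental_group:
  assumes "x \<in> X" "loop_at X x p"
  shows "inv\<^bsub>fundamental_group X x\<^esub> (loop_class X x p) = loop_class X x (reversepath p)"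
proof (rule group.inv_equality[OF group_fundamental_group[OF assms(1)]])
  show "loop_class X x (reversepath p) \<otimes>\<^bsub>fundamental_group X x\<^esub> loop_class X x p = \<one>\<^bsub>fundamental_group X x\<^esub>"
    unfolding one_fundamental_group mult_fundamental_group[OF loop_at_reversepath[OF assms(2)] assms(2)]
    by (rule loop_class_eqI, rule homotopic_paths_linv_const) (use loop_atD[OF assms(2)] in auto)
qed (use assms in \<open>auto intro: loop_class_in_carrier loop_at_reversepath\<close>)

lemma mem_Union_iff_loop_class:
  assumes "K \<subseteq> carrier (fundamental_group X x)" "p \<in> mspace (loop_space X x)"
  shows "p \<in> \<Union>K \<longleftrightarrow> loop_class X x p \<in> K"
proof
  assume "p \<in> \<Union>K"
  then obtain a where a: "a \<in> K" "p \<in> a" by blast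
  then obtain q where "a = loop_class X x q"
    using assms(1) unfolding carrier_fundamental_group by blast
  then have "a = loop_class X x p"
    using a(2) loop_class_eqI unfolding loop_class_def by blast
  then show "loop_class X x p \<in> K" using a(1) by simp
qed (use loop_class_self[OF assms(2)] in blast)

lemma Union_subset_mspace:
  "K \<subseteq> carrier (fundamental_group X x) \<Longrightarrow> \<Union>K \<subseteq> mspace (loop_space X x)"
  unfolding carrier_fundamental_group loop_class_def by blast

text \<open>Solving q = k h c\<inverse> h\<inverse> for \<open>k\<close> gives k = q h c
  h\<inverse>. This turns a set of products into a projection, along \<open>h\<close>, of a preimage
  under the continuous map of \<open>continuous_map_join_conj\<close>. The added letter is the
  inverse of \<open>c\<close> so that \<open>c\<close> itself stands in that map.\<close>

lemma Union_conj_products_Cons: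
  assumes xX: "x \<in> X" and N: "N \<lhd> fundamental_group X x"
    and w: "w \<in> lists (carrier (fundamental_group X x))"
    and c: "loop_at X x c"
  shows "\<Union>(conj_products (fundamental_group X x) N (loop_class X x (reversepath c) # w)) =
    {q \<in> mspace (loop_space X x). \<exists>h\<in>mspace (loop_space X x).
        restrict (q +++ (h +++ (c +++ reversepath h))) {0..1} \<in> \<Union>(conj_products (fundamental_group X x) N w)}"
proof -
  let ?G = "fundamental_group X x" and ?cl = "loop_class X x"
  interpret N: normal N ?G by (rule N)
  let ?c' = "?cl (reversepath c)"
  have c'c: "?c' \<in> carrier ?G" "?cl c \<in> carrier ?G" "?c' = inv\<^bsub>?G\<^esub> (?cl c)"
    using c loop_at_reversepath[OF c] loop_class_in_carrier inv_fundamental_group[OF xX c] by auto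
  have K: "conj_products ?G N w \<subseteq> carrier ?G" "conj_products ?G N (?c' # w) \<subseteq> carrier ?G"
    using N.conj_products_carrier w c'c(1) by (blast, meson Cons_in_lists_iff N.conj_products_carrier)
  have rc: "?cl (restrict (q +++ (h +++ (c +++ reversepath h))) {0..1})
      = ?cl q \<otimes>\<^bsub>?G\<^esub> (?cl h \<otimes>\<^bsub>?G\<^esub> (?cl c \<otimes>\<^bsub>?G\<^esub> inv\<^bsub>?G\<^esub> (?cl h)))"
    and rL: "restrict (q +++ (h +++ (c +++ reversepath h))) {0..1} \<in> mspace (loop_space X x)"
    if "q \<in> mspace (loop_space X x)" "h \<in> mspace (loop_space X x)" for q h
  proof -
    note l = loop_at_mspace[OF that(1)] loop_at_mspace[OF that(2)]
    have "?cl q \<otimes>\<^bsub>?G\<^esub> (?cl h \<otimes>\<^bsub>?G\<^esub> (?cl c \<otimes>\<^bsub>?G\<^esub> inv\<^bsub>?G\<^esub> (?cl h))) = ?cl (q +++ (h +++ (c +++ reversepath h)))"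
      by (simp add: inv_fundamental_group[OF xX] mult_fundamental_group l c loop_at_join loop_at_reversepath)
    moreover have lq: "loop_at X x (q +++ (h +++ (c +++ reversepath h)))"
      by (intro loop_at_join loop_at_reversepath l c)
    ultimately show "?cl (restrict (q +++ (h +++ (c +++ reversepath h))) {0..1})
      = ?cl q \<otimes>\<^bsub>?G\<^esub> (?cl h \<otimes>\<^bsub>?G\<^esub> (?cl c \<otimes>\<^bsub>?G\<^esub> inv\<^bsub>?G\<^esub> (?cl h)))"
      using loop_class_eqI[OF homotopic_paths_restrict[OF loop_atD(1,2)[OF lq]]] by simp
    show "restrict (q +++ (h +++ (c +++ reversepath h))) {0..1} \<in> mspace (loop_space X x)"
      by (rule loop_at_restrict[OF lq])
  qed
  have key: "q \<in> \<Union>(conj_products ?G N (?c' # w)) \<longleftrightarrow> (\<exists>h\<in>mspace (loop_space X x).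
        restrict (q +++ (h +++ (c +++ reversepath h))) {0..1} \<in> \<Union>(conj_products ?G N w))"
    if q: "q \<in> mspace (loop_space X x)" for q
  proof -
    have qc: "?cl q \<in> carrier ?G" using loop_class_in_carrier loop_at_mspace[OF q] by blast
    have move: "?cl q = k \<otimes>\<^bsub>?G\<^esub> (h \<otimes>\<^bsub>?G\<^esub> (?c' \<otimes>\<^bsub>?G\<^esub> inv\<^bsub>?G\<^esub> h)) \<longleftrightarrow>
        ?cl q \<otimes>\<^bsub>?G\<^esub> (h \<otimes>\<^bsub>?G\<^esub> (?cl c \<otimes>\<^bsub>?G\<^esub> inv\<^bsub>?G\<^esub> h)) = k"
      if "k \<in> carrier ?G" "h \<in> carrier ?G" for k h
    proof -
      let ?t = "h \<otimes>\<^bsub>?G\<^esub> (?cl c \<otimes>\<^bsub>?G\<^esub> inv\<^bsub>?G\<^esub> h)"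
      have "h \<otimes>\<^bsub>?G\<^esub> (?c' \<otimes>\<^bsub>?G\<^esub> inv\<^bsub>?G\<^esub> h) = inv\<^bsub>?G\<^esub> ?t"
        using that c'c by (simp add: N.inv_mult_group N.m_assoc)
      moreover have "?t \<in> carrier ?G" using that c'c by simp
      ultimately show ?thesis
        using N.inv_solve_right[OF qc that(1), of ?t] by metis
    qed
    have "q \<in> \<Union>(conj_products ?G N (?c' # w)) \<longleftrightarrow> ?cl q \<in> conj_products ?G N (?c' # w)"
      by (rule mem_Union_iff_loop_class[OF K(2) q])
    also have "\<dots> \<longleftrightarrow> (\<exists>k h. ?cl q = k \<otimes>\<^bsub>?G\<^esub> (h \<otimes>\<^bsub>?G\<^esub> (?c' \<otimes>\<^bsub>?G\<^esub> inv\<^bsub>?G\<^esub> h)) \<and>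
        k \<in> conj_products ?G N w \<and> h \<in> carrier ?G)"
      by simp
    also have "\<dots> \<longleftrightarrow> (\<exists>h\<in>carrier ?G. ?cl q \<otimes>\<^bsub>?G\<^esub> (h \<otimes>\<^bsub>?G\<^esub> (?cl c \<otimes>\<^bsub>?G\<^esub> inv\<^bsub>?G\<^esub> h)) \<in> conj_products ?G N w)"
      (is "?L \<longleftrightarrow> ?R")
    proof
      assume ?L
      then obtain k h where "?cl q = k \<otimes>\<^bsub>?G\<^esub> (h \<otimes>\<^bsub>?G\<^esub> (?c' \<otimes>\<^bsub>?G\<^esub> inv\<^bsub>?G\<^esub> h))"
        "k \<in> conj_products ?G N w" "h \<in> carrier ?G" by blast
      then show ?R using move[OF subsetD[OF K(1)], of k h] by (intro bexI[of _ h]) simp_all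
    next
      assume ?R
      then obtain h where "h \<in> carrier ?G"
        "?cl q \<otimes>\<^bsub>?G\<^esub> (h \<otimes>\<^bsub>?G\<^esub> (?cl c \<otimes>\<^bsub>?G\<^esub> inv\<^bsub>?G\<^esub> h)) \<in> conj_products ?G N w" by blast
      then show ?L using move[OF subsetD[OF K(1)], of _ h] by blast
    qed
    also have "\<dots> \<longleftrightarrow> (\<exists>h\<in>mspace (loop_space X x). ?cl q \<otimes>\<^bsub>?G\<^esub> (?cl h \<otimes>\<^bsub>?G\<^esub> (?cl c \<otimes>\<^bsub>?G\<^esub> inv\<^bsub>?G\<^esub> (?cl h))) \<in> conj_products ?G N w)"
      (is "?L \<longleftrightarrow> ?R")
    proof
      assume ?L
      then obtain h where "h \<in> carrier ?G"
        "?cl q \<otimes>\<^bsub>?G\<^esub> (h \<otimes>\<^bsub>?G\<^esub> (?cl c \<otimes>\<^bsub>?G\<^esub> inv\<^bsub>?G\<^esub> h)) \<in> conj_products ?G N w" by blast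
      then show ?R by (elim fundamental_group_carrierE) auto
    next
      assume ?R
      then show ?L using loop_class_in_carrier[OF loop_at_mspace] by blast
    qed
    also have "\<dots> \<longleftrightarrow> (\<exists>h\<in>mspace (loop_space X x).
        restrict (q +++ (h +++ (c +++ reversepath h))) {0..1} \<in> \<Union>(conj_products ?G N w))"
      using rc[OF q] mem_Union_iff_loop_class[OF K(1) rL[OF q]] by simp
    finally show ?thesis .
  qed
  show ?thesis
  proof (rule subset_antisym; rule subsetI)
    fix q assume q: "q \<in> \<Union>(conj_products ?G N (?c' # w))"
    then have m: "q \<in> mspace (loop_space X x)"
      by (rule subsetD[OF Union_subset_mspace[OF K(2)]])
    show "q \<in> {q \<in> mspace (loop_space X x). \<exists>h\<in>mspace (loop_space X x).
        restrict (q +++ (h +++ (c +++ reversepath h))) {0..1} \<in> \<Union>(conj_products ?G N w)}"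
      by (rule CollectI, rule conjI[OF m], rule iffD1[OF key[OF m] q])
  next
    fix q assume "q \<in> {q \<in> mspace (loop_space X x). \<exists>h\<in>mspace (loop_space X x).
        restrict (q +++ (h +++ (c +++ reversepath h))) {0..1} \<in> \<Union>(conj_products ?G N w)}"
    then have m: "q \<in> mspace (loop_space X x)" and "\<exists>h\<in>mspace (loop_space X x).
        restrict (q +++ (h +++ (c +++ reversepath h))) {0..1} \<in> \<Union>(conj_products ?G N w)"
      by (simp_all only: mem_Collect_eq)
    then show "q \<in> \<Union>(conj_products ?G N (?c' # w))"
      by (rule iffD2[OF key])
  qed
qed

text \<open>An arbitrary choice of paths from \<open>x\<close> to all points, with no continuity in
  the end point. \<open>base_const\<close> ensures that loops at \<open>x\<close> are assigned their
  own classes.\<close>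

locale base_paths =
  fixes X :: "'a::metric_space set" and x :: 'a and \<gamma> :: "'a \<Rightarrow> real \<Rightarrow> 'a"
  assumes x: "x \<in> X" and base_const: "\<gamma> x = (\<lambda>t. x)"
    and base: "y \<in> X \<Longrightarrow> path (\<gamma> y) \<and> path_image (\<gamma> y) \<subseteq> X \<and> pathstart (\<gamma> y) = x \<and> pathfinish (\<gamma> y) = y"
begin

abbreviation "G \<equiv> fundamental_group X x"

definition inner_path :: "(real \<Rightarrow> 'a) \<Rightarrow> bool" where
  "inner_path u \<longleftrightarrow> path u \<and> path_image u \<subseteq> X"

definition closing :: "(real \<Rightarrow> 'a) \<Rightarrow> (real \<Rightarrow> 'a)" where
  "closing u = \<gamma> (pathstart u) +++ (u +++ reversepath (\<gamma> (pathfinish u)))"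

text \<open>A homomorphism from the path groupoid of \<open>X\<close> to the fundamental group. It
  allows loops to be cut at any parameter and loops at different points to be compared in one
  group.\<close>

definition path_elt :: "(real \<Rightarrow> 'a) \<Rightarrow> (real \<Rightarrow> 'a) set" where
  "path_elt u = loop_class X x (closing u)"

lemma group_G: "group G"
  by (rule group_fundamental_group[OF x])

lemma inner_pathD:
  assumes "inner_path u"
  shows "path u" "path_image u \<subseteq> X" "pathstart u \<in> X" "pathfinish u \<in> X"
  using assms pathstart_in_path_image pathfinish_in_path_image unfolding inner_path_def by blast+

lemma inner_path_join: "inner_path u \<Longrightarrow> inner_path v \<Longrightarrow> pathfinish u = pathstart v \<Longrightarrow> inner_path (u +++ v)"
  by (simp add: inner_path_def path_image_join)

lemma inner_path_reversepath: "inner_path u \<Longrightarrow> inner_path (reversepath u)"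
  by (simp add: inner_path_def)

lemma inner_path_base: "y \<in> X \<Longrightarrow> inner_path (\<gamma> y)"
  using base by (simp add: inner_path_def)

lemma base_ends [simp]: "y \<in> X \<Longrightarrow> pathstart (\<gamma> y) = x" "y \<in> X \<Longrightarrow> pathfinish (\<gamma> y) = y"
  using base by auto

lemma loop_at_iff_inner_path: "loop_at X y p \<longleftrightarrow> inner_path p \<and> pathstart p = y \<and> pathfinish p = y"
  by (auto simp: loop_at_def inner_path_def)

lemma loop_at_closing:
  assumes "inner_path u"
  shows "loop_at X x (closing u)"
  using assms inner_pathD[OF assms]
  by (auto simp: loop_at_iff_inner_path closing_def intro!: inner_path_join inner_path_base inner_path_reversepath)

lemma path_elt_carrier: "inner_path u \<Longrightarrow> path_elt u \<in> carrier G"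
  unfolding path_elt_def by (rule loop_class_in_carrier[OF loop_at_closing])

lemma path_elt_homotopic:
  assumes "homotopic_paths X u v"
  shows "path_elt u = path_elt v"
proof -
  have "inner_path u" "inner_path v"
    using homotopic_paths_imp_path[OF assms] homotopic_paths_imp_subset[OF assms] by (auto simp: inner_path_def)
  moreover have e: "pathstart u = pathstart v" "pathfinish u = pathfinish v"
    using homotopic_paths_imp_pathstart[OF assms] homotopic_paths_imp_pathfinish[OF assms] .
  ultimately have "homotopic_paths X (closing u) (closing v)"
    unfolding closing_def e
    by (intro homotopic_paths_join assms) (use inner_pathD in \<open>auto simp: e base\<close>)
  then show ?thesis
    unfolding path_elt_def by (rule loop_class_eqI)
qed

text \<open>The two closed-up paths meet in a trip to \<open>x\<close> and back along the base path
  of the common end point, and this detour cancels.\<close>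

lemma path_elt_join:
  assumes u: "inner_path u" and v: "inner_path v" and uv: "pathfinish u = pathstart v"
  shows "path_elt (u +++ v) = path_elt u \<otimes>\<^bsub>G\<^esub> path_elt v"
proof -
  let ?a = "\<gamma> (pathstart u)" and ?b = "\<gamma> (pathstart v)" and ?c = "reversepath (\<gamma> (pathfinish v))"
  note p = inner_pathD[OF u] inner_pathD[OF v]
  have pin: "inner_path ?a" "inner_path ?b" "inner_path ?c" "inner_path (reversepath ?b)"
    using p by (auto intro!: inner_path_base inner_path_reversepath)
  note q = inner_pathD(1,2)[OF pin(1)] inner_pathD(1,2)[OF pin(2)] inner_pathD(1,2)[OF pin(3)] inner_pathD(1,2)[OF pin(4)]
  have "homotopic_paths X (closing u +++ closing v) (?a +++ ((u +++ reversepath ?b) +++ (?b +++ (v +++ ?c))))"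
    unfolding closing_def uv
    by (rule homotopic_paths_sym, rule homotopic_paths_assoc) (use p q uv in \<open>auto simp: path_image_join\<close>)
  also have "homotopic_paths X \<dots> (?a +++ (u +++ (reversepath ?b +++ (?b +++ (v +++ ?c)))))"
    by (intro homotopic_paths_join homotopic_paths_sym[OF homotopic_paths_assoc])
      (use p q uv in \<open>auto simp: path_image_join\<close>)
  also have "homotopic_paths X \<dots> (?a +++ (u +++ (v +++ ?c)))"
    by (intro homotopic_paths_join homotopic_paths_cancel_left)
      (use p q uv in \<open>auto simp: path_image_join\<close>)
  also have "homotopic_paths X \<dots> (?a +++ ((u +++ v) +++ ?c))"
    by (intro homotopic_paths_join homotopic_paths_assoc)
      (use p q uv in \<open>auto simp: path_image_join\<close>)
  also have "?a +++ ((u +++ v) +++ ?c) = closing (u +++ v)"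
    by (simp add: closing_def)
  finally show ?thesis
    unfolding path_elt_def mult_fundamental_group[OF loop_at_closing[OF u] loop_at_closing[OF v]]
    by (rule loop_class_eqI[symmetric])
qed

lemma path_elt_loop:
  assumes "loop_at X x p"
  shows "path_elt p = loop_class X x p"
proof -
  have r: "reversepath (\<lambda>t. x) = (\<lambda>t. x)" by (simp add: reversepath_def)
  note l = loop_atD[OF assms]
  have cx: "pathstart (\<lambda>t. x) = x" "pathfinish (\<lambda>t. x) = x"
    by (simp_all add: pathstart_def pathfinish_def)
  have "homotopic_paths X ((\<lambda>t. x) +++ (p +++ (\<lambda>t. x))) (p +++ (\<lambda>t. x))"
    by (rule homotopic_paths_lid_const) (use l x in \<open>auto simp: path_image_join path_const path_image_const cx\<close>)
  also have "homotopic_paths X \<dots> p"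
    by (rule homotopic_paths_rid_const) (use l in auto)
  finally show ?thesis
    unfolding path_elt_def closing_def l(3,4) base_const r by (rule loop_class_eqI)
qed

text \<open>A constant path is homotopic to its own square, so its element is an idempotent of a
  group.\<close>

lemma path_elt_const:
  assumes "y \<in> X"
  shows "path_elt (\<lambda>t. y) = \<one>\<^bsub>G\<^esub>"
proof -
  interpret group G by (rule group_G)
  have pin: "inner_path (\<lambda>t. y)" using assms by (simp add: inner_path_def path_const path_image_const)
  have "homotopic_paths X ((\<lambda>t. y) +++ (\<lambda>t. y)) (\<lambda>t. y)"
    by (rule homotopic_paths_lid_const) (simp_all add: path_const path_image_const assms pathstart_def)
  then have "path_elt (\<lambda>t. y) \<otimes>\<^bsub>G\<^esub> path_elt (\<lambda>t. y) = path_elt (\<lambda>t. y)"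
    using path_elt_join[OF pin pin] path_elt_homotopic by (simp add: pathstart_def pathfinish_def)
  then show ?thesis
    using path_elt_carrier[OF pin] by simp
qed

lemma path_elt_reversepath:
  assumes "inner_path u"
  shows "path_elt (reversepath u) = inv\<^bsub>G\<^esub> (path_elt u)"
proof -
  interpret group G by (rule group_G)
  have "path_elt (reversepath u) \<otimes>\<^bsub>G\<^esub> path_elt u = path_elt (reversepath u +++ u)"
    using path_elt_join[OF inner_path_reversepath[OF assms] assms] by simp
  also have "\<dots> = path_elt (\<lambda>t. pathfinish u)"
    by (rule path_elt_homotopic, rule homotopic_paths_linv_const) (use inner_pathD[OF assms] in auto)
  also have "\<dots> = \<one>\<^bsub>G\<^esub>"
    by (rule path_elt_const) (rule inner_pathD(4)[OF assms])
  finally show ?thesis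
    using path_elt_carrier[OF assms] path_elt_carrier[OF inner_path_reversepath[OF assms]] by (metis inv_equality)
qed

lemma inner_path_piece:
  assumes "inner_path u" "a \<in> {0..1}" "b \<in> {0..1}"
  shows "inner_path (u \<circ> linepath a b)"
proof -
  have sub: "path_image (linepath a b) \<subseteq> {0..1}"
    using assms(2,3) by (simp add: closed_segment_subset)
  have "path (u \<circ> linepath a b)"
    using inner_pathD(1)[OF assms(1)] continuous_on_subset[OF _ sub, of u]
    by (intro path_continuous_image) (auto simp: path_def)
  moreover have "path_image (u \<circ> linepath a b) \<subseteq> X"
    using inner_pathD(2)[OF assms(1)] sub unfolding path_image_compose by (auto simp: path_image_def)
  ultimately show ?thesis by (simp add: inner_path_def)
qed

lemma pathstart_piece: "pathstart (u \<circ> linepath a b) = u a"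
  and pathfinish_piece: "pathfinish (u \<circ> linepath a b) = u b"
  by (simp_all add: pathstart_compose pathfinish_compose)

text \<open>The homotopy lives in the parameter interval and is carried over by \<open>u\<close>;
  the three parameters may come in any order.\<close>

lemma path_elt_piece_join:
  assumes u: "inner_path u" and abc: "a \<in> {0..1}" "b \<in> {0..1}" "c \<in> {0..1}"
  shows "path_elt (u \<circ> linepath a c) = path_elt (u \<circ> linepath a b) \<otimes>\<^bsub>G\<^esub> path_elt (u \<circ> linepath b c)"
proof -
  let ?i = "\<lambda>t::real. t"
  have l: "subpath r s ?i = linepath r s" for r s :: real
    by (auto simp: subpath_def linepath_def fun_eq_iff algebra_simps)
  have "homotopic_paths {0..1} (subpath a b ?i +++ subpath b c ?i) (subpath a c ?i)"
    by (rule homotopic_join_subpaths) (use abc in \<open>auto simp: path_def path_image_def\<close>)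
  moreover have "continuous_on {0..1} u" "u \<in> {0..1} \<rightarrow> X"
    using inner_pathD(1,2)[OF u] by (auto simp: path_def path_image_def)
  ultimately have "homotopic_paths X (u \<circ> (linepath a b +++ linepath b c)) (u \<circ> linepath a c)"
    unfolding l by (rule homotopic_paths_continuous_image)
  then have "homotopic_paths X ((u \<circ> linepath a b) +++ (u \<circ> linepath b c)) (u \<circ> linepath a c)"
    by (simp add: path_compose_join)
  then show ?thesis
    using path_elt_homotopic path_elt_join[OF inner_path_piece[OF u abc(1,2)] inner_path_piece[OF u abc(2,3)]]
    by (simp add: pathstart_piece pathfinish_piece)
qed

lemma path_elt_cong:
  assumes "inner_path u" "\<And>t. t \<in> {0..1} \<Longrightarrow> u t = v t"
  shows "path_elt u = path_elt v"
  by (rule path_elt_homotopic, rule homotopic_paths_eq) (use assms inner_pathD in auto)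

end

section \<open>A Cantor set of loops\<close>

definition cantor_space :: "(nat \<Rightarrow> bool) topology" where
  "cantor_space = product_topology (\<lambda>_. discrete_topology UNIV) UNIV"

lemma topspace_cantor_space [simp]: "topspace cantor_space = UNIV"
  by (simp add: cantor_space_def)

lemma openin_cantor_space_cylinder: "openin cantor_space {\<tau>. \<forall>i<n. \<tau> i = \<sigma> i}"
proof -
  have "{\<tau>. \<forall>i<n. \<tau> i = \<sigma> i} = PiE UNIV (\<lambda>i. if i < n then {\<sigma> i} else UNIV)"
    by (auto simp: PiE_def Pi_def split: if_splits)
  moreover have "openin cantor_space (PiE UNIV (\<lambda>i. if i < n then {\<sigma> i} else UNIV))"
    unfolding cantor_space_def
    by (rule product_topology_basis) (auto intro: finite_subset[of _ "{..<n}"])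
  ultimately show ?thesis by simp
qed

lemma openin_cantor_space_imp_cylinder:
  assumes "openin cantor_space U" "\<sigma> \<in> U"
  shows "\<exists>n. {\<tau>. \<forall>i<n. \<tau> i = \<sigma> i} \<subseteq> U"
proof -
  obtain V where V: "finite {i. V i \<noteq> (UNIV :: bool set)}" "\<sigma> \<in> PiE UNIV V" "PiE UNIV V \<subseteq> U"
    using assms unfolding cantor_space_def openin_product_topology_alt by fastforce
  obtain n where n: "\<And>i. V i \<noteq> UNIV \<Longrightarrow> i < n"
    using V(1) by (auto simp: finite_nat_set_iff_bounded)
  have "\<tau> \<in> PiE UNIV V" if "\<forall>i<n. \<tau> i = \<sigma> i" for \<tau>
  proof -
    have "\<tau> i \<in> V i" for i
      using that n[of i] V(2) by (cases "V i = UNIV") (auto simp: PiE_def Pi_def)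
    then show ?thesis by auto
  qed
  then have "{\<tau>. \<forall>i<n. \<tau> i = \<sigma> i} \<subseteq> U"
    using V(3) by (simp only: subset_iff mem_Collect_eq) blast
  then show ?thesis ..
qed

lemma Polish_cantor_space: "Polish_space cantor_space"
proof -
  let ?B = "(\<lambda>s. {\<tau>. \<forall>i<length s. \<tau> i = s ! i}) ` (UNIV :: bool list set)"
  have "openin cantor_space V" if "V \<in> ?B" for V
    using that openin_cantor_space_cylinder by fastforce
  moreover have "\<exists>V\<in>?B. \<sigma> \<in> V \<and> V \<subseteq> U" if U: "openin cantor_space U" "\<sigma> \<in> U" for U \<sigma>
  proof -
    obtain n where n: "{\<tau>. \<forall>i<n. \<tau> i = \<sigma> i} \<subseteq> U"
      using openin_cantor_space_imp_cylinder[OF U] by blast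
    have "{\<tau>. \<forall>i<n. \<tau> i = \<sigma> i} = {\<tau>. \<forall>i<length (map \<sigma> [0..<n]). \<tau> i = map \<sigma> [0..<n] ! i}"
      by auto
    then have "{\<tau>. \<forall>i<n. \<tau> i = \<sigma> i} \<in> ?B" by blast
    then show ?thesis using n by (intro bexI[of _ "{\<tau>. \<forall>i<n. \<tau> i = \<sigma> i}"]) auto
  qed
  moreover have "countable ?B" by simp
  ultimately have "second_countable cantor_space"
    unfolding second_countable_def by blast
  moreover have "completely_metrizable_space cantor_space"
    unfolding cantor_space_def completely_metrizable_space_product_topology
    by (auto simp: completely_metrizable_space_discrete_topology)
  ultimately show ?thesis
    using Polish_space_iff_second_countable by blast
qed

lemma homeomorphic_map_flip:
  "homeomorphic_map cantor_space cantor_space (\<lambda>\<sigma>. \<sigma>(k := \<not> \<sigma> k))"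
proof -
  have "continuous_map cantor_space cantor_space (\<lambda>\<sigma>. \<sigma>(k := \<not> \<sigma> k))"
    unfolding continuous_map_def
  proof (intro conjI allI impI)
    fix U assume U: "openin cantor_space U"
    show "openin cantor_space {\<sigma> \<in> topspace cantor_space. \<sigma>(k := \<not> \<sigma> k) \<in> U}"
    proof (subst openin_subopen, intro ballI)
      fix \<sigma> assume "\<sigma> \<in> {\<sigma> \<in> topspace cantor_space. \<sigma>(k := \<not> \<sigma> k) \<in> U}"
      then obtain n where n: "{\<tau>. \<forall>i<n. \<tau> i = (\<sigma>(k := \<not> \<sigma> k)) i} \<subseteq> U"
        using openin_cantor_space_imp_cylinder[OF U] by blast
      let ?V = "{\<tau>. \<forall>i<max n (Suc k). \<tau> i = \<sigma> i}"
      have "?V \<subseteq> {\<sigma> \<in> topspace cantor_space. \<sigma>(k := \<not> \<sigma> k) \<in> U}"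
      proof
        fix \<tau> assume \<tau>: "\<tau> \<in> ?V"
        then have "\<tau> i = \<sigma> i" if "i < n \<or> i = k" for i
          using that by (simp add: less_max_iff_disj) auto
        then have "\<tau>(k := \<not> \<tau> k) \<in> {\<tau>. \<forall>i<n. \<tau> i = (\<sigma>(k := \<not> \<sigma> k)) i}"
          by simp
        then show "\<tau> \<in> {\<sigma> \<in> topspace cantor_space. \<sigma>(k := \<not> \<sigma> k) \<in> U}"
          using n by (simp only: mem_Collect_eq topspace_cantor_space) blast
      qed
      moreover have "\<sigma> \<in> ?V" by simp
      ultimately show "\<exists>T. openin cantor_space T \<and> \<sigma> \<in> T \<and> T \<subseteq> {\<sigma> \<in> topspace cantor_space. \<sigma>(k := \<not> \<sigma> k) \<in> U}"
        using openin_cantor_space_cylinder[of "max n (Suc k)" \<sigma>] by (intro exI[of _ ?V] conjI)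
    qed
  qed simp
  then have "homeomorphic_maps cantor_space cantor_space (\<lambda>\<sigma>. \<sigma>(k := \<not> \<sigma> k)) (\<lambda>\<sigma>. \<sigma>(k := \<not> \<sigma> k))"
    unfolding homeomorphic_maps_def by simp
  then show ?thesis using homeomorphic_maps_map by blast
qed

text \<open>\<open>A\<close> is comeager in a cylinder that fixes the first \<open>m\<close>
  coordinates. Flipping a coordinate \<open>k \<ge> m\<close> maps the cylinder to itself and
  preserves meagerness. Without the desired pair, the cylinder would be covered by the part outside
  \<open>A\<close> and the flip of that part, against the Baire category theorem.\<close>

lemma nonmeager_imp_flip_pair:
  assumes "meager_or_comeager_on_open cantor_space A" "\<not> meager_in cantor_space A"
  shows "\<exists>m. \<forall>k\<ge>m. \<exists>\<sigma>. \<sigma> \<in> A \<and> \<sigma>(k := \<not> \<sigma> k) \<in> A"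
proof -
  obtain U \<rho> where U: "openin cantor_space U" "\<rho> \<in> U" "meager_in cantor_space (U - A)"
    using assms unfolding meager_or_comeager_on_open_def by blast
  obtain m where m: "{\<tau>. \<forall>i<m. \<tau> i = \<rho> i} \<subseteq> U"
    using openin_cantor_space_imp_cylinder[OF U(1,2)] by blast
  let ?V = "{\<tau>. \<forall>i<m. \<tau> i = \<rho> i}"
  have "\<exists>\<sigma>. \<sigma> \<in> A \<and> \<sigma>(k := \<not> \<sigma> k) \<in> A" if k: "k \<ge> m" for k
  proof (rule ccontr)
    assume no: "\<nexists>\<sigma>. \<sigma> \<in> A \<and> \<sigma>(k := \<not> \<sigma> k) \<in> A"
    let ?f = "\<lambda>\<sigma>::nat \<Rightarrow> bool. \<sigma>(k := \<not> \<sigma> k)"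
    have mM: "meager_in cantor_space (?V - A)"
      by (rule meager_in_subset[OF U(3)]) (use m in blast)
    have "?V \<subseteq> (?V - A) \<union> ?f ` (?V - A)"
    proof
      fix \<sigma> assume \<sigma>: "\<sigma> \<in> ?V"
      then have "?f \<sigma> \<in> ?V" using k by auto
      moreover have "\<sigma> = ?f (?f \<sigma>)" by simp
      ultimately show "\<sigma> \<in> (?V - A) \<union> ?f ` (?V - A)"
        using \<sigma> no by (metis (no_types, lifting) DiffI UnCI imageI)
    qed
    then have "meager_in cantor_space ?V"
      by (rule meager_in_subset[OF meager_in_Un[OF mM meager_in_homeomorphic_image[OF homeomorphic_map_flip[of k] mM]]])
    then have "?V = {}"
      by (rule openin_meager_imp_empty[rotated])
        (use Polish_cantor_space in \<open>simp_all add: Polish_space_def openin_cantor_space_cylinder\<close>)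
    then show False by auto
  qed
  then show ?thesis by blast
qed

lemma countable_cover_flip_pair:
  assumes "countable W" "(\<Union>w\<in>W. B w) = UNIV"
    "\<And>w. w \<in> W \<Longrightarrow> meager_or_comeager_on_open cantor_space (B w)"
  shows "\<exists>w\<in>W. \<exists>m. \<forall>k\<ge>m. \<exists>\<sigma>. \<sigma> \<in> B w \<and> \<sigma>(k := \<not> \<sigma> k) \<in> B w"
proof (rule ccontr)
  assume "\<not> ?thesis"
  then have "meager_in cantor_space (B w)" if "w \<in> W" for w
    using nonmeager_imp_flip_pair[OF assms(3)[OF that]] that by blast
  then have "meager_in cantor_space UNIV"
    using meager_in_UN[OF assms(1), of cantor_space B] assms(2) by simp
  moreover have "openin cantor_space UNIV"
    using openin_topspace[of cantor_space] by simp
  ultimately show False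
    using openin_meager_imp_empty[of cantor_space UNIV] Polish_cantor_space unfolding Polish_space_def by simp
qed

text \<open>
  The loop \<open>loop_seq \<alpha> y \<sigma>\<close> runs through the loops \<open>\<alpha> k\<close> with \<open>\<sigma> k\<close> on the disjoint intervals
  \<open>[slot_start k, slot_end k]\<close>, which shrink towards \<open>0\<close>, and rests at \<open>y\<close> otherwise.
\<close>

definition slot_start :: "nat \<Rightarrow> real" where "slot_start k = 1 / (2 * real k + 2)"
definition slot_end :: "nat \<Rightarrow> real" where "slot_end k = 1 / (2 * real k + 1)"

definition loop_seq :: "(nat \<Rightarrow> real \<Rightarrow> 'a) \<Rightarrow> 'a \<Rightarrow> (nat \<Rightarrow> bool) \<Rightarrow> real \<Rightarrow> 'a" where
  "loop_seq \<alpha> y \<sigma> t =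
    (if \<exists>k. \<sigma> k \<and> t \<in> {slot_start k..slot_end k}
     then let k = (THE k. t \<in> {slot_start k..slot_end k})
       in \<alpha> k ((t - slot_start k) / (slot_end k - slot_start k))
     else y)"

lemma slot_order: "0 < slot_start k" "slot_start k < slot_end k" "slot_end k \<le> 1"
  by (simp_all add: slot_start_def slot_end_def divide_simps)

text \<open>The denominators are distinct integers, so even the closed slots are disjoint. This
  makes the choice by \<open>THE\<close> in \<open>loop_seq\<close> unambiguous at end points
  too.\<close>

lemma slot_disjoint:
  assumes "t \<in> {slot_start k..slot_end k}" "t \<in> {slot_start j..slot_end j}"
  shows "j = k"
proof -
  have "slot_end j < slot_start k" if "k < j" for j k
  proof -
    have "2 * real k + 2 < 2 * real j + 1" using that by linarith
    then show ?thesis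
      unfolding slot_end_def slot_start_def by (simp add: divide_strict_left_mono)
  qed
  then show ?thesis
    using assms by (metis atLeastAtMost_iff linorder_less_linear not_le order_trans)
qed

lemma loop_seq_on_slot:
  assumes "t \<in> {slot_start k..slot_end k}"
  shows "loop_seq \<alpha> y \<sigma> t = (if \<sigma> k then \<alpha> k ((t - slot_start k) / (slot_end k - slot_start k)) else y)"
proof -
  have "(THE k. t \<in> {slot_start k..slot_end k}) = k"
    using assms slot_disjoint by (intro the_equality) auto
  moreover have "(\<exists>j. \<sigma> j \<and> t \<in> {slot_start j..slot_end j}) \<longleftrightarrow> \<sigma> k"
    using assms slot_disjoint by blast
  ultimately show ?thesis
    unfolding loop_seq_def by (simp add: Let_def)
qed

lemma loop_seq_off_slots:
  assumes "\<And>k. \<sigma> k \<Longrightarrow> t \<notin> {slot_start k..slot_end k}"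
  shows "loop_seq \<alpha> y \<sigma> t = y"
  using assms unfolding loop_seq_def by auto

lemma loop_seq_cong:
  assumes "\<And>k. t \<in> {slot_start k..slot_end k} \<Longrightarrow> \<sigma> k = \<tau> k"
  shows "loop_seq \<alpha> y \<sigma> t = loop_seq \<alpha> y \<tau> t"
proof (cases "\<exists>k. t \<in> {slot_start k..slot_end k}")
  case True
  then obtain k where k: "t \<in> {slot_start k..slot_end k}" by blast
  show ?thesis unfolding loop_seq_on_slot[OF k] using assms[OF k] by simp
next
  case False
  then show ?thesis using loop_seq_off_slots[of \<sigma> t] loop_seq_off_slots[of \<tau> t] by metis
qed

text \<open>The geometric rate lets agreement of the first \<open>n\<close> coordinates bound the
  uniform distance by \<open>(1/2)^n\<close>.\<close>

locale null_sequence_of_loops =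
  fixes X :: "'a::metric_space set" and y :: 'a and \<alpha> :: "nat \<Rightarrow> real \<Rightarrow> 'a"
  assumes loop: "\<And>k. loop_at X y (\<alpha> k)" and small: "\<And>k. path_image (\<alpha> k) \<subseteq> cball y ((1/2)^k)"
begin

lemma rescale_slot:
  assumes "t \<in> {slot_start k..slot_end k}"
  shows "(t - slot_start k) / (slot_end k - slot_start k) \<in> {0..1}"
  using assms slot_order[of k] by (auto simp: divide_simps)

lemma loop_seq_ends:
  "loop_seq \<alpha> y \<sigma> (slot_start k) = y" "loop_seq \<alpha> y \<sigma> (slot_end k) = y"
  using slot_order[of k] loop_atD(3,4)[OF loop[of k]]
  by (simp_all add: loop_seq_on_slot[of _ k] pathstart_def pathfinish_def)

lemma base_point_in: "y \<in> X"
  using loop_atD[OF loop[of 0]] by (metis pathstart_in_path_image subsetD)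

lemma loop_seq_in: "loop_seq \<alpha> y \<sigma> t \<in> X"
proof (cases "\<exists>k. t \<in> {slot_start k..slot_end k}")
  case True
  then obtain k where k: "t \<in> {slot_start k..slot_end k}" by blast
  have "\<alpha> k ((t - slot_start k) / (slot_end k - slot_start k)) \<in> path_image (\<alpha> k)"
    using rescale_slot[OF k] unfolding path_image_def by blast
  then show ?thesis unfolding loop_seq_on_slot[OF k] using loop_atD(2)[OF loop[of k]] base_point_in by auto
next
  case False
  then show ?thesis using loop_seq_off_slots[of \<sigma> t \<alpha> y] base_point_in by auto
qed

text \<open>At each time at most one slot is active, so the deviations do not add up. If the bits of
  slot \<open>k\<close> differ, then \<open>k \<ge> n\<close>, one value is \<open>y\<close> and the
  other lies on a loop in the ball of radius \<open>(1/2)^k\<close>.\<close>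

lemma dist_loop_seq:
  assumes "\<forall>i<n. \<sigma> i = \<tau> i"
  shows "dist (loop_seq \<alpha> y \<sigma> t) (loop_seq \<alpha> y \<tau> t) \<le> (1/2)^n"
proof (cases "\<exists>k. t \<in> {slot_start k..slot_end k} \<and> \<sigma> k \<noteq> \<tau> k")
  case True
  then obtain k where k: "t \<in> {slot_start k..slot_end k}" "\<sigma> k \<noteq> \<tau> k" by blast
  have "\<alpha> k ((t - slot_start k) / (slot_end k - slot_start k)) \<in> path_image (\<alpha> k)"
    using rescale_slot[OF k(1)] unfolding path_image_def by blast
  then have d: "dist y (\<alpha> k ((t - slot_start k) / (slot_end k - slot_start k))) \<le> (1/2)^k"
    using small[of k] by auto
  have "n \<le> k" using k(2) assms by (meson not_le)
  then have "(1/2::real)^k \<le> (1/2)^n" by (intro power_decreasing) auto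
  from order_trans[OF d this] show ?thesis
    using k(2) unfolding loop_seq_on_slot[OF k(1)] by (auto simp: dist_commute)
next
  case False
  then have "loop_seq \<alpha> y \<sigma> t = loop_seq \<alpha> y \<tau> t" by (intro loop_seq_cong) auto
  then show ?thesis by simp
qed

text \<open>Admitting slot \<open>n\<close> changes the function only in the interior of that slot,
  so continuity is pasted together from the closed slot and the closed complement of its
  interior.\<close>

lemma continuous_on_loop_seq_finite: "continuous_on {0..1} (loop_seq \<alpha> y (\<lambda>k. \<sigma> k \<and> k < n))"
proof (induction n)
  case 0
  have "loop_seq \<alpha> y (\<lambda>k. \<sigma> k \<and> k < 0) = (\<lambda>t. y)"
    by (intro ext loop_seq_off_slots) simp
  then show ?case by simp
next
  case (Suc n)
  let ?f = "loop_seq \<alpha> y (\<lambda>k. \<sigma> k \<and> k < Suc n)" and ?g = "loop_seq \<alpha> y (\<lambda>k. \<sigma> k \<and> k < n)"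
  let ?a = "slot_start n" and ?b = "slot_end n"
  have fg: "?f t = ?g t" if "t \<notin> {?a<..<?b}" for t
  proof (cases "t \<in> {?a..?b}")
    case True
    then have "t = ?a \<or> t = ?b" using that by auto
    then show ?thesis using loop_seq_ends by metis
  next
    case False
    show ?thesis
      by (rule loop_seq_cong) (use False less_Suc_eq in auto)
  qed
  have "continuous_on ({0..?a} \<union> {?b..1}) ?f"
    by (rule continuous_on_eq[OF continuous_on_subset[OF Suc.IH]])
      (use fg slot_order[of n] in auto)
  moreover have "continuous_on {?a..?b} ?f"
  proof (cases "\<sigma> n")
    case True
    have "continuous_on {?a..?b} (\<lambda>t. \<alpha> n ((t - ?a) / (?b - ?a)))"
      by (rule continuous_on_compose2[OF loop_atD(1)[OF loop, unfolded path_def]])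
        (use rescale_slot slot_order[of n] in \<open>auto intro!: continuous_intros\<close>)
    then show ?thesis
      by (rule continuous_on_eq) (use True in \<open>simp add: loop_seq_on_slot[of _ n]\<close>)
  next
    case False
    show ?thesis
      by (rule continuous_on_eq[OF continuous_on_const[of _ y]]) (use False in \<open>simp add: loop_seq_on_slot[of _ n]\<close>)
  qed
  ultimately have "continuous_on (({0..?a} \<union> {?b..1}) \<union> {?a..?b}) ?f"
    by (rule continuous_on_closed_Un[OF closed_Un[OF closed_atLeastAtMost closed_atLeastAtMost] closed_atLeastAtMost])
  moreover have "({0..?a} \<union> {?b..1}) \<union> {?a..?b} = {0..1}"
    using slot_order[of n] by auto
  ultimately show ?case by simp
qed

text \<open>The truncations to finitely many slots converge uniformly, by
  \<open>dist_loop_seq\<close>.\<close>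

lemma continuous_on_loop_seq: "continuous_on {0..1} (loop_seq \<alpha> y \<sigma>)"
proof (rule uniform_limit_theorem)
  show "uniform_limit {0..1} (\<lambda>n. loop_seq \<alpha> y (\<lambda>k. \<sigma> k \<and> k < n)) (loop_seq \<alpha> y \<sigma>) sequentially"
    unfolding uniform_limit_sequentially_iff
  proof (intro allI impI)
    fix e :: real assume "e > 0"
    then obtain N where N: "(1/2)^N < e"
      using real_arch_pow_inv[of e "1/2"] by auto
    have "dist (loop_seq \<alpha> y (\<lambda>k. \<sigma> k \<and> k < n) t) (loop_seq \<alpha> y \<sigma> t) < e" if "n \<ge> N" for n t
    proof -
      have "dist (loop_seq \<alpha> y (\<lambda>k. \<sigma> k \<and> k < n) t) (loop_seq \<alpha> y \<sigma> t) \<le> (1/2)^n"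
        by (rule dist_loop_seq) simp
      also have "\<dots> \<le> (1/2)^N" using that by (intro power_decreasing) auto
      finally show ?thesis using N by simp
    qed
    then show "\<exists>N. \<forall>n\<ge>N. \<forall>t\<in>{0..1}. dist (loop_seq \<alpha> y (\<lambda>k. \<sigma> k \<and> k < n) t) (loop_seq \<alpha> y \<sigma> t) < e"
      by blast
  qed
qed (simp_all add: continuous_on_loop_seq_finite)

lemma loop_at_loop_seq: "loop_at X y (loop_seq \<alpha> y \<sigma>)"
proof -
  have "loop_seq \<alpha> y \<sigma> 0 = y"
  proof (rule loop_seq_off_slots)
    show "0 \<notin> {slot_start k..slot_end k}" for k using slot_order(1)[of k] by auto
  qed
  moreover have "slot_end 0 = 1" by (simp add: slot_end_def)
  ultimately show ?thesis
    using loop_seq_ends(2)[of \<sigma> 0] continuous_on_loop_seq loop_seq_in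
    unfolding loop_at_def path_def by (auto simp: pathstart_def pathfinish_def path_image_def)
qed

end

context base_paths
begin

text \<open>All these loops are based at \<open>y\<close>, so they are closed up by the same two
  paths, which do not affect distances.\<close>

lemma continuous_map_closing_loop_seq:
  assumes "null_sequence_of_loops X y \<alpha>"
  shows "continuous_map cantor_space (mtopology_of (loop_space X x))
    (\<lambda>\<sigma>. restrict (closing (loop_seq \<alpha> y \<sigma>)) {0..1})"
proof (rule continuous_map_loop_spaceI)
  interpret A: null_sequence_of_loops X y \<alpha> by fact
  have pin: "inner_path (loop_seq \<alpha> y \<sigma>)" and ends: "pathstart (loop_seq \<alpha> y \<sigma>) = y" "pathfinish (loop_seq \<alpha> y \<sigma>) = y" for \<sigma>
    using A.loop_at_loop_seq[of \<sigma>] by (auto simp: loop_at_iff_inner_path)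
  show "restrict (closing (loop_seq \<alpha> y \<sigma>)) {0..1} \<in> mspace (loop_space X x)" for \<sigma>
    by (rule loop_at_restrict[OF loop_at_closing[OF pin]])
  fix \<sigma> :: "nat \<Rightarrow> bool" and e :: real assume e: "e > 0"
  then obtain n where n: "(1/2)^n < e"
    using real_arch_pow_inv[of e "1/2"] by auto
  have "dist (restrict (closing (loop_seq \<alpha> y \<sigma>)) {0..1} t) (restrict (closing (loop_seq \<alpha> y \<tau>)) {0..1} t) \<le> e"
    if "\<forall>i<n. \<tau> i = \<sigma> i" "t \<in> {0..1}" for \<tau> t
  proof -
    have "dist (loop_seq \<alpha> y \<sigma> s) (loop_seq \<alpha> y \<tau> s) \<le> e" for s
      using A.dist_loop_seq[of n \<sigma> \<tau> s] that(1) n by auto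
    then show ?thesis
      using that(2) e unfolding closing_def ends by (auto simp: joinpaths_def)
  qed
  then show "\<exists>U. openin cantor_space U \<and> \<sigma> \<in> U \<and> (\<forall>\<tau>\<in>U. \<forall>t\<in>{0..1}.
      dist (restrict (closing (loop_seq \<alpha> y \<sigma>)) {0..1} t) (restrict (closing (loop_seq \<alpha> y \<tau>)) {0..1} t) \<le> e)"
    using openin_cantor_space_cylinder[of n \<sigma>] by (intro exI[of _ "{\<tau>. \<forall>i<n. \<tau> i = \<sigma> i}"]) auto
qed

text \<open>Cutting at both ends of slot \<open>k\<close> gives the elements e1 a e2 and e1 e2,
  where a is the element of \<open>\<alpha> k\<close>. Their quotient is the conjugate of a by e1,
  and normality removes the conjugator.\<close>

lemma path_elt_loop_seq_flip:
  assumes "null_sequence_of_loops X y \<alpha>" and K: "K \<lhd> G"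
    and \<sigma>: "path_elt (loop_seq \<alpha> y \<sigma>) \<in> K" "path_elt (loop_seq \<alpha> y (\<sigma>(k := \<not> \<sigma> k))) \<in> K"
  shows "path_elt (\<alpha> k) \<in> K"
proof -
  interpret A: null_sequence_of_loops X y \<alpha> by fact
  interpret K: normal K G by fact
  let ?a = "slot_start k" and ?b = "slot_end k"
  have ab: "?a \<in> {0..1}" "?b \<in> {0..1}" using slot_order[of k] by auto
  have pin: "inner_path (loop_seq \<alpha> y \<tau>)" for \<tau>
    using A.loop_at_loop_seq[of \<tau>] by (auto simp: loop_at_iff_inner_path)
  have pk: "inner_path (\<alpha> k)" using A.loop[of k] by (auto simp: loop_at_iff_inner_path)
  define e1 where "e1 = path_elt (loop_seq \<alpha> y \<sigma> \<circ> linepath 0 ?a)"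
  define e2 where "e2 = path_elt (loop_seq \<alpha> y \<sigma> \<circ> linepath ?b 1)"
  have e: "e1 \<in> carrier G" "e2 \<in> carrier G" "path_elt (\<alpha> k) \<in> carrier G"
    unfolding e1_def e2_def using inner_path_piece[OF pin] ab pk by (auto intro!: path_elt_carrier)
  have decomp: "path_elt (loop_seq \<alpha> y \<tau>) = e1 \<otimes>\<^bsub>G\<^esub> ((if \<tau> k then path_elt (\<alpha> k) else \<one>\<^bsub>G\<^esub>) \<otimes>\<^bsub>G\<^esub> e2)"
    if \<tau>: "\<And>j. j \<noteq> k \<Longrightarrow> \<tau> j = \<sigma> j" for \<tau>
  proof -
    have "loop_seq \<alpha> y \<tau> t = loop_seq \<alpha> y \<sigma> t" if t: "t \<notin> {?a<..<?b}" for t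
    proof (cases "t \<in> {?a..?b}")
      case True
      then have "t = ?a \<or> t = ?b" using t by auto
      then show ?thesis using A.loop_seq_ends by metis
    next
      case False
      show ?thesis by (rule loop_seq_cong) (use False \<tau> in metis)
    qed
    moreover have "linepath 0 ?a t \<notin> {?a<..<?b}" "linepath ?b 1 t \<notin> {?a<..<?b}" if "t \<in> {0..1}" for t
    proof -
      have "linepath 0 ?a t \<in> closed_segment 0 ?a" "linepath ?b 1 t \<in> closed_segment ?b 1"
        by (rule linepath_in_path, rule that)+
      then show "linepath 0 ?a t \<notin> {?a<..<?b}" "linepath ?b 1 t \<notin> {?a<..<?b}"
        using slot_order[of k] by (auto simp: closed_segment_eq_real_ivl)
    qed
    ultimately have "path_elt (loop_seq \<alpha> y \<tau> \<circ> linepath 0 ?a) = e1" "path_elt (loop_seq \<alpha> y \<tau> \<circ> linepath ?b 1) = e2"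
      unfolding e1_def e2_def using inner_path_piece[OF pin] ab by (auto intro!: path_elt_cong)
    moreover have "path_elt (loop_seq \<alpha> y \<tau> \<circ> linepath ?a ?b) = (if \<tau> k then path_elt (\<alpha> k) else \<one>\<^bsub>G\<^esub>)"
    proof -
      have "(loop_seq \<alpha> y \<tau> \<circ> linepath ?a ?b) t = (if \<tau> k then \<alpha> k t else y)" if t: "t \<in> {0..1}" for t
      proof -
        have "linepath ?a ?b t \<in> closed_segment ?a ?b" using t by (rule linepath_in_path)
        then have "linepath ?a ?b t \<in> {?a..?b}" using slot_order[of k] by (auto simp: closed_segment_eq_real_ivl)
        moreover have "(linepath ?a ?b t - ?a) / (?b - ?a) = t"
          using slot_order[of k] by (simp add: linepath_def field_simps)
        ultimately show ?thesis by (simp add: loop_seq_on_slot)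
      qed
      then have "path_elt (loop_seq \<alpha> y \<tau> \<circ> linepath ?a ?b) = path_elt (\<lambda>t. if \<tau> k then \<alpha> k t else y)"
        using inner_path_piece[OF pin ab] by (intro path_elt_cong) auto
      then show ?thesis using path_elt_const[OF A.base_point_in] by simp
    qed
    moreover have "path_elt (loop_seq \<alpha> y \<tau>) = path_elt (loop_seq \<alpha> y \<tau> \<circ> linepath 0 1)"
      by (rule path_elt_cong[OF pin]) (simp add: linepath_def)
    ultimately show ?thesis
      using path_elt_piece_join[OF pin, of 0 ?a 1] path_elt_piece_join[OF pin, of ?a ?b 1] ab by simp
  qed
  have "e1 \<otimes>\<^bsub>G\<^esub> (path_elt (\<alpha> k) \<otimes>\<^bsub>G\<^esub> e2) \<in> K \<and> e1 \<otimes>\<^bsub>G\<^esub> e2 \<in> K"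
    using \<sigma> decomp[of \<sigma>] decomp[of "\<sigma>(k := \<not> \<sigma> k)"] e by (cases "\<sigma> k") auto
  then have "e1 \<otimes>\<^bsub>G\<^esub> (path_elt (\<alpha> k) \<otimes>\<^bsub>G\<^esub> e2) \<otimes>\<^bsub>G\<^esub> inv\<^bsub>G\<^esub> (e1 \<otimes>\<^bsub>G\<^esub> e2) \<in> K"
    by blast
  then have "e1 \<otimes>\<^bsub>G\<^esub> (path_elt (\<alpha> k) \<otimes>\<^bsub>G\<^esub> inv\<^bsub>G\<^esub> e1) \<in> K"
    using e by (simp add: K.m_assoc K.inv_mult_group)
      (simp add: K.m_assoc[symmetric] K.r_inv)
  then have "inv\<^bsub>G\<^esub> e1 \<otimes>\<^bsub>G\<^esub> (e1 \<otimes>\<^bsub>G\<^esub> (path_elt (\<alpha> k) \<otimes>\<^bsub>G\<^esub> inv\<^bsub>G\<^esub> e1)) \<otimes>\<^bsub>G\<^esub> e1 \<in> K"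
    using e(1) by (rule K.inv_op_closed1[rotated])
  then have "inv\<^bsub>G\<^esub> e1 \<otimes>\<^bsub>G\<^esub> (e1 \<otimes>\<^bsub>G\<^esub> path_elt (\<alpha> k)) \<in> K"
    using e by (simp add: K.m_assoc)
  moreover have "inv\<^bsub>G\<^esub> e1 \<otimes>\<^bsub>G\<^esub> (e1 \<otimes>\<^bsub>G\<^esub> path_elt (\<alpha> k)) = path_elt (\<alpha> k)"
    using e by (simp add: K.m_assoc[symmetric])
  ultimately show ?thesis by simp
qed

end

section \<open>Small loops\<close>

text \<open>\<open>d\<close> is a Lebesgue number of a cover by open sets whose traces on
  \<open>X\<close> lie in path connected subsets of small balls. These have radius
  \<open>e/2\<close> about other centres, hence lie in the ball of radius \<open>e\<close> about
  \<open>p\<close>.\<close>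

lemma uniformly_locally_path_connected:
  fixes X :: "'a::metric_space set"
  assumes "compact X" "locally path_connected X" "e > 0"
  shows "\<exists>d>0. \<forall>p\<in>X. \<forall>q\<in>X. dist p q < d \<longrightarrow>
    (\<exists>c. path c \<and> path_image c \<subseteq> X \<and> path_image c \<subseteq> ball p e \<and> pathstart c = p \<and> pathfinish c = q)"
proof -
  have "\<exists>T V. open T \<and> y \<in> T \<and> X \<inter> T \<subseteq> V \<and> path_connected V \<and> V \<subseteq> X \<inter> ball y (e/2)" if y: "y \<in> X" for y
  proof -
    have "openin (top_of_set X) (X \<inter> ball y (e/2))" "y \<in> X \<inter> ball y (e/2)"
      using y assms(3) by (auto simp: openin_open_Int)
    then obtain U V where UV: "openin (top_of_set X) U" "path_connected V" "y \<in> U" "U \<subseteq> V" "V \<subseteq> X \<inter> ball y (e/2)"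
      using assms(2) unfolding locally_def by metis
    then obtain T where "open T" "U = X \<inter> T"
      unfolding openin_open by blast
    then show ?thesis using UV by blast
  qed
  then obtain T V where TV: "\<And>y. y \<in> X \<Longrightarrow> open (T y) \<and> y \<in> T y \<and> X \<inter> T y \<subseteq> V y \<and> path_connected (V y) \<and> V y \<subseteq> X \<inter> ball y (e/2)"
    by metis
  obtain d where d: "d > 0" "\<And>p. p \<in> X \<Longrightarrow> \<exists>S\<in>T ` X. ball p d \<subseteq> S"
    using Heine_Borel_lemma[OF assms(1), of "T ` X"] TV by blast
  have "\<exists>c. path c \<and> path_image c \<subseteq> X \<and> path_image c \<subseteq> ball p e \<and> pathstart c = p \<and> pathfinish c = q"
    if pq: "p \<in> X" "q \<in> X" "dist p q < d" for p q
  proof -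
    obtain y where y: "y \<in> X" "ball p d \<subseteq> T y" using d(2)[OF pq(1)] by blast
    have "p \<in> T y" "q \<in> T y" using y(2) pq(3) d(1) by auto
    then have "p \<in> V y" "q \<in> V y" using TV[OF y(1)] pq(1,2) by blast+
    then obtain c where c: "path c" "path_image c \<subseteq> V y" "pathstart c = p" "pathfinish c = q"
      using TV[OF y(1)] unfolding path_connected_def by blast
    have Vy: "V y \<subseteq> X \<inter> ball y (e/2)" using TV[OF y(1)] by blast
    have "ball y (e/2) \<subseteq> ball p e"
    proof
      fix z assume "z \<in> ball y (e/2)"
      moreover have "dist y p < e/2" using \<open>p \<in> V y\<close> Vy by auto
      ultimately show "z \<in> ball p e"
        using dist_triangle3[of p z y] by (simp add: dist_commute)
    qed
    then show ?thesis using c Vy by blast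
  qed
  then show ?thesis using d(1) by (intro exI[of _ d]) simp
qed

context base_paths
begin

text \<open>By compactness the base points of ever smaller bad loops accumulate at some
  \<open>y\<close>. Short paths from \<open>y\<close> move them to \<open>y\<close>; this conjugates
  their elements and so does not bring them into a normal subgroup.\<close>

lemma null_sequence_outside:
  assumes X: "compact X" "locally path_connected X"
    and K: "\<And>n. K n \<lhd> G" and mono: "\<And>m n. m \<le> n \<Longrightarrow> K m \<subseteq> K n"
    and outside: "\<And>n d. d > 0 \<Longrightarrow> \<exists>p. inner_path p \<and> pathfinish p = pathstart p \<and>
        path_image p \<subseteq> ball (pathstart p) d \<and> path_elt p \<notin> K n"
  shows "\<exists>y \<alpha>. null_sequence_of_loops X y \<alpha> \<and> (\<forall>k. path_elt (\<alpha> k) \<notin> K k)"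
proof -
  have "\<exists>p. inner_path p \<and> pathfinish p = pathstart p \<and>
        path_image p \<subseteq> ball (pathstart p) (inverse (real (Suc n))) \<and> path_elt p \<notin> K n" for n
    by (rule outside) simp
  then obtain p where p: "\<And>n. inner_path (p n)" "\<And>n. pathfinish (p n) = pathstart (p n)"
    "\<And>n. path_image (p n) \<subseteq> ball (pathstart (p n)) (inverse (real (Suc n)))" "\<And>n. path_elt (p n) \<notin> K n"
    by metis
  have "\<forall>n. pathstart (p n) \<in> X" using inner_pathD(3)[OF p(1)] by blast
  then obtain y r where y: "y \<in> X" "strict_mono r" "((\<lambda>n. pathstart (p n)) \<circ> r) \<longlonglongrightarrow> y"
    using X(1) unfolding compact_def by metis
  have "\<exists>q. loop_at X y q \<and> path_image q \<subseteq> cball y ((1/2)^k) \<and> path_elt q \<notin> K k" for k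
  proof -
    \<comment> \<open>Half the target radius: the loop \<open>p n\<close> deviates by less than
      \<open>e\<close> from its base point, which is itself closer than \<open>e\<close> to
      \<open>y\<close>.\<close>
    define e where "e = (1/2::real)^k / 2"
    have e: "e > 0" by (simp add: e_def)
    obtain d where d: "d > 0" "\<forall>p\<in>X. \<forall>q\<in>X. dist p q < d \<longrightarrow>
      (\<exists>c. path c \<and> path_image c \<subseteq> X \<and> path_image c \<subseteq> ball p e \<and> pathstart c = p \<and> pathfinish c = q)"
      using uniformly_locally_path_connected[OF X e] by (elim exE conjE)
    obtain J1 where J1: "\<And>j. j \<ge> J1 \<Longrightarrow> dist (pathstart (p (r j))) y < min d e"
      using y(3) d(1) e unfolding lim_sequentially o_def by (metis min_less_iff_conj)
    obtain J2 where J2: "inverse (real (Suc J2)) < e"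
      using reals_Archimedean[OF e] by blast
    \<comment> \<open>Far enough for the base point to be near \<open>y\<close> and the loop to be
      short, and at least \<open>k\<close>, so that avoiding \<open>K n\<close> implies avoiding
      \<open>K k\<close>.\<close>
    define n where "n = r (max J1 (max J2 k))"
    have n: "n \<ge> k" "n \<ge> J2" "dist y (pathstart (p n)) < d" "dist y (pathstart (p n)) < e"
      using seq_suble[OF y(2), of "max J1 (max J2 k)"] J1[of "max J1 (max J2 k)"]
      by (auto simp: n_def dist_commute)
    have "inverse (real (Suc n)) \<le> inverse (real (Suc J2))"
      using n(2) by (intro le_imp_inverse_le) auto
    then have ne: "inverse (real (Suc n)) < e" using J2 by (rule le_less_trans)
    obtain c where c: "path c" "path_image c \<subseteq> X" "path_image c \<subseteq> ball y e" "pathstart c = y" "pathfinish c = pathstart (p n)"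
      using d(2)[rule_format, OF y(1) inner_pathD(3)[OF p(1)] n(3)] by blast
    have cin: "inner_path c" using c by (simp add: inner_path_def)
    let ?q = "c +++ (p n +++ reversepath c)"
    have pr: "inner_path (p n +++ reversepath c)"
      by (intro inner_path_join p(1) inner_path_reversepath cin) (simp add: c p(2))
    have q: "loop_at X y ?q"
      unfolding loop_at_iff_inner_path using c pr by (auto intro!: inner_path_join cin)
    have "path_image (p n) \<subseteq> cball y ((1/2)^k)"
    proof
      fix z assume "z \<in> path_image (p n)"
      then have "dist (pathstart (p n)) z < e" using p(3)[of n] ne by auto
      then show "z \<in> cball y ((1/2)^k)"
        using dist_triangle[of y z "pathstart (p n)"] n(4) by (auto simp: e_def)
    qed
    moreover have "e \<le> (1/2)^k" by (simp add: e_def)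
    then have "path_image c \<subseteq> cball y ((1/2)^k)"
      using c(3) ball_subset_cball[of y e] subset_cball[of e "(1/2)^k" y] by blast
    ultimately have "path_image ?q \<subseteq> cball y ((1/2)^k)"
      using c p(2)[of n] by (auto simp: path_image_join)
    moreover have "path_elt ?q \<notin> K k"
    proof
      interpret K: normal "K n" G by (rule K)
      assume "path_elt ?q \<in> K k"
      then have "path_elt ?q \<in> K n" using mono[OF n(1)] by blast
      moreover have ec: "path_elt c \<in> carrier G" "path_elt (p n) \<in> carrier G"
        using path_elt_carrier cin p(1) by blast+
      moreover have "path_elt ?q = path_elt c \<otimes>\<^bsub>G\<^esub> (path_elt (p n) \<otimes>\<^bsub>G\<^esub> inv\<^bsub>G\<^esub> path_elt c)"
        using path_elt_join[OF cin pr] path_elt_join[OF p(1) inner_path_reversepath[OF cin]] path_elt_reversepath[OF cin]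
        by (simp add: c p(2))
      ultimately have "inv\<^bsub>G\<^esub> path_elt c \<otimes>\<^bsub>G\<^esub> (path_elt c \<otimes>\<^bsub>G\<^esub> (path_elt (p n) \<otimes>\<^bsub>G\<^esub> inv\<^bsub>G\<^esub> path_elt c)) \<otimes>\<^bsub>G\<^esub> path_elt c \<in> K n"
        using K.inv_op_closed1 by simp
      moreover have "inv\<^bsub>G\<^esub> path_elt c \<otimes>\<^bsub>G\<^esub> (path_elt c \<otimes>\<^bsub>G\<^esub> (path_elt (p n) \<otimes>\<^bsub>G\<^esub> inv\<^bsub>G\<^esub> path_elt c)) \<otimes>\<^bsub>G\<^esub> path_elt c
          = (inv\<^bsub>G\<^esub> path_elt c \<otimes>\<^bsub>G\<^esub> path_elt c) \<otimes>\<^bsub>G\<^esub> path_elt (p n) \<otimes>\<^bsub>G\<^esub> (inv\<^bsub>G\<^esub> path_elt c \<otimes>\<^bsub>G\<^esub> path_elt c)"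
        using ec by (simp only: K.m_assoc K.m_closed K.inv_closed)
      ultimately show False using p(4)[of n] ec by simp
    qed
    ultimately show ?thesis using q by blast
  qed
  then obtain \<alpha> where "\<And>k. loop_at X y (\<alpha> k) \<and> path_image (\<alpha> k) \<subseteq> cball y ((1/2)^k) \<and> path_elt (\<alpha> k) \<notin> K k"
    by metis
  then show ?thesis
    by (intro exI[of _ y] exI[of _ \<alpha>]) (simp add: null_sequence_of_loops_def)
qed

text \<open>
  Modulo small loops the group is generated by the loops along a net of base points. For \<open>y\<close> in \<open>X\<close>
  let \<open>c y\<close> be a short path to a net point. Then \<open>path_elt u\<close> lies in the coset
  \<open>path_elt (c y) M (path_elt (c z))\<inverse>\<close> for short paths \<open>u\<close> from \<open>y\<close> to \<open>z\<close>, and this property is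
  stable under concatenation.
\<close>

lemma finitely_generated_modulo_small_loops:
  assumes X: "compact X" "locally path_connected X" and d: "d > 0"
    and small: "\<And>p. inner_path p \<Longrightarrow> pathfinish p = pathstart p \<Longrightarrow> path_image p \<subseteq> ball (pathstart p) d \<Longrightarrow> path_elt p \<in> K"
  shows "\<exists>E. finite E \<and> E \<subseteq> carrier G \<and> (\<forall>M. M \<lhd> G \<longrightarrow> K \<subseteq> M \<longrightarrow> E \<subseteq> M \<longrightarrow> M = carrier G)"
proof -
  have d8: "d / 8 > 0" using d by simp
  obtain e0 where e0: "e0 > 0" "\<forall>p\<in>X. \<forall>q\<in>X. dist p q < e0 \<longrightarrow>
      (\<exists>c. path c \<and> path_image c \<subseteq> X \<and> path_image c \<subseteq> ball p (d/8) \<and> pathstart c = p \<and> pathfinish c = q)"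
    using uniformly_locally_path_connected[OF X d8] by (elim exE conjE)
  then obtain link where link: "\<And>p q. p \<in> X \<Longrightarrow> q \<in> X \<Longrightarrow> dist p q < e0 \<Longrightarrow>
      inner_path (link p q) \<and> path_image (link p q) \<subseteq> ball p (d/8) \<and> pathstart (link p q) = p \<and> pathfinish (link p q) = q"
    unfolding inner_path_def by metis
  \<comment> \<open>The bound \<open>e0\<close> provides links between net points closer than
    \<open>e\<close>; this distance arises from three steps of \<open>e/3\<close>, to the path
    \<open>u\<close>, along it, and to the net again. The bound \<open>d/8\<close> keeps the loop
    closed by such a link in a ball of radius \<open>d\<close>.\<close>
  define e where "e = min e0 (d/8)"
  have e: "e > 0" "e \<le> e0" "e \<le> d/8" using e0(1) d by (auto simp: e_def)
  obtain T where T: "finite T" "T \<subseteq> X" "X \<subseteq> (\<Union>s\<in>T. ball s (e/3))"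
    using finite_ball_cover[OF X(1), of "e/3"] e(1) by auto
  have "\<forall>y\<in>X. \<exists>s\<in>T. dist y s < e/3" using T(3) by (fastforce simp: dist_commute)
  then obtain i where i: "\<And>y. y \<in> X \<Longrightarrow> i y \<in> T \<and> dist y (i y) < e/3" by metis
  have iX: "i y \<in> X" if "y \<in> X" for y using i[OF that] T(2) by blast
  define c where "c y = link y (i y)" for y
  have c: "inner_path (c y)" "path_image (c y) \<subseteq> ball y (d/8)" "pathstart (c y) = y" "pathfinish (c y) = i y"
    if "y \<in> X" for y
    using link[OF that iX[OF that]] i[OF that] e unfolding c_def by auto
  define E where "E = (\<lambda>(s,t). path_elt (link s t)) ` {(s,t) \<in> T \<times> T. dist s t < e}"
  have linkT: "inner_path (link s t) \<and> path_image (link s t) \<subseteq> ball s (d/8) \<and> pathstart (link s t) = s \<and> pathfinish (link s t) = t"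
    if "s \<in> T" "t \<in> T" "dist s t < e" for s t
    using link[of s t] that T(2) e(2) by auto
  show ?thesis
  proof (intro exI conjI allI impI)
    have "finite {(s,t) \<in> T \<times> T. dist s t < e}"
      by (rule finite_subset[of _ "T \<times> T"]) (use T(1) in auto)
    then show "finite E" unfolding E_def by (rule finite_imageI)
    have "path_elt (link s t) \<in> carrier G" if "s \<in> T" "t \<in> T" "dist s t < e" for s t
      using linkT[OF that] path_elt_carrier by blast
    then show "E \<subseteq> carrier G" unfolding E_def by (simp add: image_subset_iff split_beta)
    fix M assume M: "M \<lhd> G" "K \<subseteq> M" "E \<subseteq> M"
    interpret M: normal M G by (rule M(1))
    note M_mult = subgroup.m_closed[OF M.subgroup_axioms]
    define \<psi> where "\<psi> y = path_elt (c y)" for y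
    have \<psi>: "\<psi> y \<in> carrier G" if "y \<in> X" for y
      unfolding \<psi>_def by (rule path_elt_carrier[OF c(1)[OF that]])
    have short: "inv\<^bsub>G\<^esub> \<psi> (pathstart u) \<otimes>\<^bsub>G\<^esub> (path_elt u \<otimes>\<^bsub>G\<^esub> \<psi> (pathfinish u)) \<in> M"
      if u: "inner_path u" "path_image u \<subseteq> ball (pathstart u) (e/3)" for u
    proof -
      let ?y = "pathstart u" and ?z = "pathfinish u"
      have yz: "?y \<in> X" "?z \<in> X" using inner_pathD[OF u(1)] by auto
      have dyz: "dist ?y ?z < e/3" using u(2) pathfinish_in_path_image[of u] by auto
      have dy: "dist (i ?y) ?y < e/3" and dz: "dist ?z (i ?z) < e/3"
        using i[OF yz(1)] i[OF yz(2)] by (auto simp: dist_commute)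
      have "dist (i ?y) (i ?z) \<le> dist (i ?y) ?y + dist ?y ?z + dist ?z (i ?z)"
        using dist_triangle[of "i ?y" "i ?z" ?y] dist_triangle[of ?y "i ?z" ?z] by linarith
      then have dij: "dist (i ?y) (i ?z) < e" using dy dz dyz by linarith
      let ?l = "link (i ?y) (i ?z)"
      have l: "inner_path ?l" "path_image ?l \<subseteq> ball (i ?y) (d/8)" "pathstart ?l = i ?y" "pathfinish ?l = i ?z"
        using linkT[OF _ _ dij] i[OF yz(1)] i[OF yz(2)] by auto
      have lE: "path_elt ?l \<in> M"
        using M(3) dij i[OF yz(1)] i[OF yz(2)] unfolding E_def by force
      let ?w1 = "c ?z +++ reversepath ?l"
      let ?w2 = "u +++ ?w1"
      \<comment> \<open>Back along \<open>c ?y\<close>, along \<open>u\<close>, along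
        \<open>c ?z\<close> and back along the link: a small loop at the net point
        \<open>i ?y\<close>. It measures the difference between \<open>u\<close> and an element of
        \<open>E\<close>.\<close>
      let ?w = "reversepath (c ?y) +++ ?w2"
      have w1: "inner_path ?w1"
        by (intro inner_path_join inner_path_reversepath c(1) yz l) (simp add: c yz l)
      have w2: "inner_path ?w2"
        by (intro inner_path_join w1 u(1)) (simp add: c yz)
      have w: "inner_path ?w"
        by (intro inner_path_join w2 inner_path_reversepath c(1) yz) (simp add: c yz)
      have ends: "pathstart ?w = i ?y" "pathfinish ?w = i ?y" by (simp_all add: c yz l)
      have "path_image ?w \<subseteq> path_image (c ?y) \<union> path_image u \<union> path_image (c ?z) \<union> path_image ?l"
        using path_image_join_subset[of "reversepath (c ?y)" ?w2] path_image_join_subset[of u ?w1]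
          path_image_join_subset[of "c ?z" "reversepath ?l"] by auto
      moreover have "path_image (c ?y) \<subseteq> ball (i ?y) d"
      proof
        fix s assume "s \<in> path_image (c ?y)"
        then have "dist ?y s < d/8" using c(2)[OF yz(1)] by auto
        then show "s \<in> ball (i ?y) d" using dist_triangle[of "i ?y" s ?y] dy e d by auto
      qed
      moreover have "path_image u \<subseteq> ball (i ?y) d"
      proof
        fix s assume "s \<in> path_image u"
        then have "dist ?y s < e/3" using u(2) by auto
        then show "s \<in> ball (i ?y) d" using dist_triangle[of "i ?y" s ?y] dy e d by auto
      qed
      moreover have "path_image (c ?z) \<subseteq> ball (i ?y) d"
      proof
        fix s assume "s \<in> path_image (c ?z)"
        then have "dist ?z s < d/8" using c(2)[OF yz(2)] by auto
        then show "s \<in> ball (i ?y) d"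
          using dist_triangle[of "i ?y" s ?y] dist_triangle[of ?y s ?z] dyz dy e d by auto
      qed
      moreover have "path_image ?l \<subseteq> ball (i ?y) d"
        using l(2) d by (auto simp: subset_iff)
      ultimately have "path_image ?w \<subseteq> ball (pathstart ?w) d"
        unfolding ends by blast
      then have wM: "path_elt ?w \<in> M"
        using small[OF w] M(2) ends by auto
      have ce: "\<psi> ?y \<in> carrier G" "\<psi> ?z \<in> carrier G" "path_elt u \<in> carrier G" "path_elt ?l \<in> carrier G"
        using \<psi> yz path_elt_carrier u(1) l(1) by auto
      have "path_elt ?w = inv\<^bsub>G\<^esub> \<psi> ?y \<otimes>\<^bsub>G\<^esub> (path_elt u \<otimes>\<^bsub>G\<^esub> (\<psi> ?z \<otimes>\<^bsub>G\<^esub> inv\<^bsub>G\<^esub> path_elt ?l))"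
        using path_elt_join[OF inner_path_reversepath[OF c(1)[OF yz(1)]] w2] path_elt_join[OF u(1) w1]
          path_elt_join[OF c(1)[OF yz(2)] inner_path_reversepath[OF l(1)]]
          path_elt_reversepath[OF c(1)[OF yz(1)]] path_elt_reversepath[OF l(1)]
        by (simp add: c yz l \<psi>_def)
      then have "inv\<^bsub>G\<^esub> \<psi> ?y \<otimes>\<^bsub>G\<^esub> (path_elt u \<otimes>\<^bsub>G\<^esub> \<psi> ?z) = path_elt ?w \<otimes>\<^bsub>G\<^esub> path_elt ?l"
        using ce by (simp add: M.m_assoc)
      then show ?thesis using M_mult[OF wM lE] by simp
    qed
    have "a \<in> M" if a: "a \<in> carrier G" for a
    proof -
      obtain u where u: "u \<in> mspace (loop_space X x)" "a = loop_class X x u"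
        using a fundamental_group_carrierE by blast
      have uin: "inner_path u" and u01: "pathstart u = x" "pathfinish u = x" and au: "a = path_elt u"
        using loop_at_mspace[OF u(1)] path_elt_loop[OF loop_at_mspace[OF u(1)]] u(2)
        by (auto simp: loop_at_iff_inner_path)
      have uX: "u t \<in> X" if "t \<in> {0..1}" for t
        using inner_pathD(2)[OF uin] that by (auto simp: path_image_def)
      \<comment> \<open>\<open>Bolzano\<close> subdivides the interval: \<open>P\<close> holds for
        short pieces by \<open>short\<close> and is stable under concatenation. The premise makes
        \<open>P\<close> vacuous for pieces that leave the unit interval.\<close>
      define P where "P r s \<longleftrightarrow> (0 \<le> r \<and> r \<le> s \<and> s \<le> 1 \<longrightarrow>
          inv\<^bsub>G\<^esub> \<psi> (u r) \<otimes>\<^bsub>G\<^esub> (path_elt (u \<circ> linepath r s) \<otimes>\<^bsub>G\<^esub> \<psi> (u s)) \<in> M)" for r s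
      have "uniformly_continuous_on {0..1} u"
        using inner_pathD(1)[OF uin] unfolding path_def by (rule compact_uniformly_continuous) simp
      then obtain \<delta> where \<delta>: "\<delta> > 0" "\<And>s t. s \<in> {0..1} \<Longrightarrow> t \<in> {0..1} \<Longrightarrow> dist t s < \<delta> \<Longrightarrow> dist (u t) (u s) < e/3"
        unfolding uniformly_continuous_on_def using e(1) by (metis divide_pos_pos zero_less_numeral)
      have "P 0 1"
      proof (rule Bolzano)
        fix r s t :: real assume rst: "P r s" "P s t" "r \<le> s" "s \<le> t"
        show "P r t"
          unfolding P_def
        proof (intro impI, elim conjE)
          assume r: "0 \<le> r" "t \<le> 1"
          have I: "r \<in> {0..1}" "s \<in> {0..1}" "t \<in> {0..1}" using r rst(3,4) by auto
          have ce: "\<psi> (u r) \<in> carrier G" "\<psi> (u s) \<in> carrier G" "\<psi> (u t) \<in> carrier G"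
            "path_elt (u \<circ> linepath r s) \<in> carrier G" "path_elt (u \<circ> linepath s t) \<in> carrier G"
            using I \<psi>[OF uX] path_elt_carrier[OF inner_path_piece[OF uin]] by auto
          have "inv\<^bsub>G\<^esub> \<psi> (u r) \<otimes>\<^bsub>G\<^esub> (path_elt (u \<circ> linepath r s) \<otimes>\<^bsub>G\<^esub> \<psi> (u s)) \<otimes>\<^bsub>G\<^esub>
              (inv\<^bsub>G\<^esub> \<psi> (u s) \<otimes>\<^bsub>G\<^esub> (path_elt (u \<circ> linepath s t) \<otimes>\<^bsub>G\<^esub> \<psi> (u t))) \<in> M"
            by (rule M_mult) (use rst r in \<open>auto simp: P_def\<close>)
          also have "inv\<^bsub>G\<^esub> \<psi> (u r) \<otimes>\<^bsub>G\<^esub> (path_elt (u \<circ> linepath r s) \<otimes>\<^bsub>G\<^esub> \<psi> (u s)) \<otimes>\<^bsub>G\<^esub>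
              (inv\<^bsub>G\<^esub> \<psi> (u s) \<otimes>\<^bsub>G\<^esub> (path_elt (u \<circ> linepath s t) \<otimes>\<^bsub>G\<^esub> \<psi> (u t)))
            = inv\<^bsub>G\<^esub> \<psi> (u r) \<otimes>\<^bsub>G\<^esub> (path_elt (u \<circ> linepath r s) \<otimes>\<^bsub>G\<^esub> (\<psi> (u s) \<otimes>\<^bsub>G\<^esub>
              inv\<^bsub>G\<^esub> \<psi> (u s) \<otimes>\<^bsub>G\<^esub> (path_elt (u \<circ> linepath s t) \<otimes>\<^bsub>G\<^esub> \<psi> (u t))))"
            using ce by (simp only: M.m_assoc M.m_closed M.inv_closed)
          also have "\<psi> (u s) \<otimes>\<^bsub>G\<^esub> inv\<^bsub>G\<^esub> \<psi> (u s) \<otimes>\<^bsub>G\<^esub> (path_elt (u \<circ> linepath s t) \<otimes>\<^bsub>G\<^esub> \<psi> (u t))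
              = path_elt (u \<circ> linepath s t) \<otimes>\<^bsub>G\<^esub> \<psi> (u t)"
            using ce by simp
          finally show "inv\<^bsub>G\<^esub> \<psi> (u r) \<otimes>\<^bsub>G\<^esub> (path_elt (u \<circ> linepath r t) \<otimes>\<^bsub>G\<^esub> \<psi> (u t)) \<in> M"
            using ce path_elt_piece_join[OF uin I] by (simp add: M.m_assoc o_def)
        qed
      next
        fix t :: real assume "0 \<le> t" "t \<le> 1"
        show "\<exists>\<delta>>0. \<forall>r s. r \<le> t \<and> t \<le> s \<and> s - r < \<delta> \<longrightarrow> P r s"
        proof (intro exI[of _ \<delta>] conjI allI impI \<delta>(1))
          fix r s assume rs: "r \<le> t \<and> t \<le> s \<and> s - r < \<delta>"
          show "P r s"
            unfolding P_def
          proof (intro impI, elim conjE)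
            assume r: "0 \<le> r" "s \<le> 1"
            have I: "r \<in> {0..1}" "s \<in> {0..1}" using r rs by auto
            have "path_image (u \<circ> linepath r s) \<subseteq> ball (u r) (e/3)"
            proof
              fix z assume "z \<in> path_image (u \<circ> linepath r s)"
              then obtain v where v: "v \<in> {r..s}" "z = u v"
                using rs unfolding path_image_compose by (auto simp: closed_segment_eq_real_ivl)
              then show "z \<in> ball (u r) (e/3)"
                using \<delta>(2)[of v r] r rs by (auto simp: dist_real_def)
            qed
            then show "inv\<^bsub>G\<^esub> \<psi> (u r) \<otimes>\<^bsub>G\<^esub> (path_elt (u \<circ> linepath r s) \<otimes>\<^bsub>G\<^esub> \<psi> (u s)) \<in> M"
              using short[OF inner_path_piece[OF uin I]] by (simp add: pathstart_piece pathfinish_piece)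
          qed
        qed
      qed simp
      moreover have "path_elt (u \<circ> linepath 0 1) = a"
        unfolding au by (rule path_elt_cong[OF uin, symmetric]) (simp add: linepath_def)
      moreover have "u 0 = x" "u 1 = x" using u01 by (auto simp: pathstart_def pathfinish_def)
      ultimately have "inv\<^bsub>G\<^esub> \<psi> x \<otimes>\<^bsub>G\<^esub> (a \<otimes>\<^bsub>G\<^esub> \<psi> x) \<in> M" by (simp add: P_def)
      \<comment> \<open>For a loop at \<open>x\<close> the coset condition says that a conjugate of
        \<open>a\<close> lies in \<open>M\<close>, which is normal.\<close>
      then have "\<psi> x \<otimes>\<^bsub>G\<^esub> (inv\<^bsub>G\<^esub> \<psi> x \<otimes>\<^bsub>G\<^esub> (a \<otimes>\<^bsub>G\<^esub> \<psi> x)) \<otimes>\<^bsub>G\<^esub> inv\<^bsub>G\<^esub> \<psi> x \<in> M"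
        using M.inv_op_closed2 \<psi>[OF x] by blast
      moreover have "\<psi> x \<otimes>\<^bsub>G\<^esub> (inv\<^bsub>G\<^esub> \<psi> x \<otimes>\<^bsub>G\<^esub> (a \<otimes>\<^bsub>G\<^esub> \<psi> x)) \<otimes>\<^bsub>G\<^esub> inv\<^bsub>G\<^esub> \<psi> x
          = (\<psi> x \<otimes>\<^bsub>G\<^esub> inv\<^bsub>G\<^esub> \<psi> x) \<otimes>\<^bsub>G\<^esub> a \<otimes>\<^bsub>G\<^esub> (\<psi> x \<otimes>\<^bsub>G\<^esub> inv\<^bsub>G\<^esub> \<psi> x)"
        using a \<psi>[OF x] by (simp only: M.m_assoc M.m_closed M.inv_closed)
      ultimately show ?thesis using a \<psi>[OF x] by simp
    qed
    then show "M = carrier G" using M.subset by blast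
  qed
qed

end

section \<open>Reduction of a countable set of generators to a finite one\<close>

lemma base_paths_exists:
  assumes "path_connected X" "x \<in> X"
  obtains \<gamma> where "base_paths X x \<gamma>"
proof -
  have "\<exists>g. path g \<and> path_image g \<subseteq> X \<and> pathstart g = x \<and> pathfinish g = y" if "y \<in> X" for y
    using assms that unfolding path_connected_def by blast
  then obtain \<gamma> where \<gamma>: "\<And>y. y \<in> X \<Longrightarrow> path (\<gamma> y) \<and> path_image (\<gamma> y) \<subseteq> X \<and> pathstart (\<gamma> y) = x \<and> pathfinish (\<gamma> y) = y"
    by metis
  have "base_paths X x (\<gamma>(x := (\<lambda>t. x)))"
    by unfold_locales
      (use \<gamma> assms(2) in \<open>auto simp: path_const path_image_const pathstart_def pathfinish_def\<close>)
  then show ?thesis using that by blast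
qed

lemma conj_products_subset_finite_span:
  assumes w: "w \<in> lists (range g \<union> (\<lambda>a. inv\<^bsub>G\<^esub> a) ` range g)"
  shows "\<exists>n::nat. conj_products G N w \<subseteq> normal_span G N (g ` {..<n})"
proof -
  let ?B = "\<lambda>F. F \<union> (\<lambda>a. inv\<^bsub>G\<^esub> a) ` F"
  have "\<exists>n. w \<in> lists (?B (g ` {..<n}))"
    using w
  proof (induction w rule: list.induct)
    case (Cons b w)
    then obtain n where n: "w \<in> lists (?B (g ` {..<n}))" by auto
    obtain j where j: "b = g j \<or> b = inv\<^bsub>G\<^esub> g j" using Cons.prems by auto
    let ?m = "max n (Suc j)"
    have "?B (g ` {..<n}) \<subseteq> ?B (g ` {..<?m})" by auto
    then have "w \<in> lists (?B (g ` {..<?m}))" using n lists_mono by blast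
    moreover have "b \<in> ?B (g ` {..<?m})" using j by auto
    ultimately show ?case by (metis Cons_in_lists_iff)
  qed auto
  then show ?thesis unfolding normal_span_def by blast
qed

text \<open>\<open>Q\<close> stands for membership in a pointclass or for analyticity.
  \<open>Qstep\<close> is the passage to one more letter as in
  \<open>Union_conj_products_Cons\<close>, and \<open>Qcantor\<close> feeds the category
  argument.\<close>

lemma finite_normal_span_fundamental_group:
  fixes X :: "'a::metric_space set"
  assumes X: "Peano_continuum X" and xX: "x \<in> X"
    and N: "N \<lhd> fundamental_group X x"
    and QN: "Q (\<Union>N)"
    and Qstep: "\<And>A c. Q A \<Longrightarrow> loop_at X x c \<Longrightarrow>
      Q {q \<in> mspace (loop_space X x). \<exists>h\<in>mspace (loop_space X x).
        restrict (q +++ (h +++ (c +++ reversepath h))) {0..1} \<in> A}"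
    and Qcantor: "\<And>A f. Q A \<Longrightarrow> continuous_map cantor_space (mtopology_of (loop_space X x)) f \<Longrightarrow>
      meager_or_comeager_on_open cantor_space {\<sigma>. f \<sigma> \<in> A}"
    and S: "countable S" "S \<subseteq> carrier (fundamental_group X x)"
    and span: "normal_span (fundamental_group X x) N S = carrier (fundamental_group X x)"
  shows "\<exists>F\<subseteq>S. finite F \<and> normal_span (fundamental_group X x) N F = carrier (fundamental_group X x)"
proof (cases "S = {}")
  case True
  then show ?thesis using span by blast
next
  case False
  have Xc: "compact X" "locally path_connected X" "path_connected X"
    using X by (auto simp: Peano_continuum_def)
  obtain \<gamma> where "base_paths X x \<gamma>" using base_paths_exists[OF Xc(3) xX] by blast
  then interpret base_paths X x \<gamma> .
  interpret N: normal N G by (rule N)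
  define g where "g = from_nat_into S"
  have g: "range g = S" unfolding g_def by (rule range_from_nat_into) (use False S in auto)
  define K where "K n = normal_span G N (g ` {..<n})" for n
  have gc: "g ` {..<n} \<subseteq> carrier G" for n using g S(2) by blast
  have K: "K n \<lhd> G" for n unfolding K_def by (rule N.normal_span_normal[OF gc])
  have Kmono: "K m \<subseteq> K n" if "m \<le> n" for m n
    unfolding K_def by (rule N.normal_span_mono) (use that in auto)
  have KU: "\<exists>n. a \<in> K n" if "a \<in> carrier G" for a
  proof -
    have "a \<in> normal_span G N S" using that span by simp
    then obtain w where "w \<in> lists (S \<union> (\<lambda>a. inv\<^bsub>G\<^esub> a) ` S)" "a \<in> conj_products G N w"
      unfolding normal_span_def by blast
    then show ?thesis
      using conj_products_subset_finite_span[of w g G N] unfolding g K_def by blast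
  qed
  have Qw: "Q (\<Union>(conj_products G N w))" if "w \<in> lists (carrier G)" for w
    using that
  proof (induction w rule: list.induct)
    case (Cons b w)
    then have w: "w \<in> lists (carrier G)" and b: "b \<in> carrier G" by auto
    obtain p where p: "loop_at X x p" "b = loop_class X x p"
      using b unfolding carrier_fundamental_group by blast
    \<comment> \<open>The recursion handles letters of the form \<open>reversepath c\<close>, so
      take \<open>c\<close> to be the reverse of \<open>p\<close>.\<close>
    have b': "b = loop_class X x (reversepath (reversepath p))" using p(2) by simp
    show ?case
      unfolding b' Union_conj_products_Cons[OF xX N w loop_at_reversepath[OF p(1)]]
      by (rule Qstep[OF Cons.IH[OF w] loop_at_reversepath[OF p(1)]])
  qed (simp add: QN)
  have "\<exists>n d. d > 0 \<and> (\<forall>p. inner_path p \<longrightarrow> pathfinish p = pathstart p \<longrightarrow>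
      path_image p \<subseteq> ball (pathstart p) d \<longrightarrow> path_elt p \<in> K n)"
  proof (rule ccontr)
    assume "\<not> ?thesis"
    then have outside: "\<exists>p. inner_path p \<and> pathfinish p = pathstart p \<and> path_image p \<subseteq> ball (pathstart p) d \<and> path_elt p \<notin> K n"
      if "d > 0" for n d
      using that by metis
    have "\<exists>y \<alpha>. null_sequence_of_loops X y \<alpha> \<and> (\<forall>k. path_elt (\<alpha> k) \<notin> K k)"
      by (rule null_sequence_outside[OF Xc(1,2) K]) (fact Kmono, fact outside)
    then obtain y \<alpha> where A: "null_sequence_of_loops X y \<alpha>" and out: "\<And>k. path_elt (\<alpha> k) \<notin> K k"
      by blast
    interpret A: null_sequence_of_loops X y \<alpha> by (rule A)
    define f where "f \<sigma> = restrict (closing (loop_seq \<alpha> y \<sigma>)) {0..1}" for \<sigma>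
    have f: "continuous_map cantor_space (mtopology_of (loop_space X x)) f"
      unfolding f_def by (rule continuous_map_closing_loop_seq[OF A])
    have pin: "inner_path (loop_seq \<alpha> y \<sigma>)" for \<sigma>
      using A.loop_at_loop_seq by (simp add: loop_at_iff_inner_path)
    have fmem: "f \<sigma> \<in> \<Union>J \<longleftrightarrow> path_elt (loop_seq \<alpha> y \<sigma>) \<in> J" if "J \<subseteq> carrier G" for \<sigma> J
    proof -
      note l = loop_at_closing[OF pin, of \<sigma>]
      have "loop_class X x (f \<sigma>) = path_elt (loop_seq \<alpha> y \<sigma>)"
        unfolding f_def path_elt_def
        by (rule loop_class_eqI[symmetric], rule homotopic_paths_restrict) (use loop_atD[OF l] in auto)
      then show ?thesis
        using mem_Union_iff_loop_class[OF that, of "f \<sigma>"] loop_at_restrict[OF l] unfolding f_def by simp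
    qed
    let ?W = "lists (S \<union> (\<lambda>a. inv\<^bsub>G\<^esub> a) ` S)"
    let ?B = "\<lambda>w. {\<sigma>. f \<sigma> \<in> \<Union>(conj_products G N w)}"
    have Wc: "w \<in> lists (carrier G)" if "w \<in> ?W" for w
      using N.lists_generators_carrier[OF S(2) that] .
    have cov: "(\<Union>w\<in>?W. ?B w) = UNIV"
    proof -
      have "\<exists>w\<in>?W. f \<sigma> \<in> \<Union>(conj_products G N w)" for \<sigma>
      proof -
        have "path_elt (loop_seq \<alpha> y \<sigma>) \<in> normal_span G N S"
          unfolding span by (rule path_elt_carrier[OF pin])
        then obtain w where w: "w \<in> ?W" "path_elt (loop_seq \<alpha> y \<sigma>) \<in> conj_products G N w"
          unfolding normal_span_def by blast
        then show ?thesis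
          by (intro bexI[where x = w] iffD2[OF fmem[OF N.conj_products_carrier[OF Wc[OF w(1)]]]])
      qed
      then have "\<sigma> \<in> (\<Union>w\<in>?W. ?B w)" for \<sigma>
        by (simp only: UN_iff mem_Collect_eq)
      then show ?thesis by (intro subset_antisym subset_UNIV subsetI)
    qed
    have cW: "countable ?W" using S(1) by (intro countable_lists) auto
    have "\<exists>w\<in>?W. \<exists>m. \<forall>k\<ge>m. \<exists>\<sigma>. \<sigma> \<in> ?B w \<and> \<sigma>(k := \<not> \<sigma> k) \<in> ?B w"
      by (rule countable_cover_flip_pair[OF cW cov]) (rule Qcantor[OF Qw[OF Wc] f])
    then obtain w m where w: "w \<in> ?W" and
      m: "\<forall>k\<ge>m. \<exists>\<sigma>. \<sigma> \<in> ?B w \<and> \<sigma>(k := \<not> \<sigma> k) \<in> ?B w"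
      by (elim bexE exE)
    have "\<exists>n. conj_products G N w \<subseteq> K n"
      using conj_products_subset_finite_span[OF w[folded g]] unfolding K_def .
    then obtain n where n: "conj_products G N w \<subseteq> K n" by blast
    \<comment> \<open>From \<open>m\<close> on there are flip pairs, and from \<open>n\<close> on
      the set of the word lies in \<open>K ?k\<close>, the subgroup that \<open>\<alpha> ?k\<close>
      was chosen to avoid.\<close>
    let ?k = "max m n"
    have "\<exists>\<sigma>. \<sigma> \<in> ?B w \<and> \<sigma>(?k := \<not> \<sigma> ?k) \<in> ?B w"
      by (rule m[rule_format]) simp
    then obtain \<sigma> where \<sigma>: "\<sigma> \<in> ?B w" "\<sigma>(?k := \<not> \<sigma> ?k) \<in> ?B w" by (elim exE conjE)
    have "conj_products G N w \<subseteq> K ?k" using n Kmono[of n ?k] by auto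
    then have "path_elt (loop_seq \<alpha> y \<sigma>) \<in> K ?k" "path_elt (loop_seq \<alpha> y (\<sigma>(?k := \<not> \<sigma> ?k))) \<in> K ?k"
      using \<sigma> unfolding mem_Collect_eq fmem[OF N.conj_products_carrier[OF Wc[OF w]]] by (auto dest: subsetD)
    from path_elt_loop_seq_flip[OF A K this] show False using out by blast
  qed
  then obtain n d where nd: "d > 0" "\<And>p. inner_path p \<Longrightarrow> pathfinish p = pathstart p \<Longrightarrow>
      path_image p \<subseteq> ball (pathstart p) d \<Longrightarrow> path_elt p \<in> K n" by blast
  obtain E where E: "finite E" "E \<subseteq> carrier G" "\<And>M. M \<lhd> G \<Longrightarrow> K n \<subseteq> M \<Longrightarrow> E \<subseteq> M \<Longrightarrow> M = carrier G"
    using finitely_generated_modulo_small_loops[OF Xc(1,2) nd] by blast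
  have "\<forall>a\<in>E. \<exists>m. a \<in> K m" using KU E(2) by blast
  then obtain j where j: "\<And>a. a \<in> E \<Longrightarrow> a \<in> K (j a)" by metis
  \<comment> \<open>The elements of \<open>E\<close> have no relation to \<open>S\<close>, but the
    increasing chain exhausts the group and \<open>E\<close> is finite, so one member contains
    \<open>E\<close> and \<open>K n\<close>.\<close>
  define m where "m = Max (insert n (j ` E))"
  have "n \<le> m" "\<And>a. a \<in> E \<Longrightarrow> j a \<le> m" using E(1) by (auto simp: m_def)
  then have "K n \<subseteq> K m" "E \<subseteq> K m" using Kmono j by (auto, blast)
  then have "K m = carrier G" using E(3)[OF K] by blast
  then show ?thesis
    unfolding K_def using g by (intro exI[of _ "g ` {..<m}"]) auto
qed

section \<open>Pointclasses\<close>

lemma nice_pointclass_image: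
  assumes "nice_pointclass P" "Polish_space Y" "Polish_space Z" "continuous_map Y Z f" "A \<in> P Y"
  shows "f ` A \<in> P Z"
  using assms unfolding nice_pointclass_def by blast

lemma nice_pointclass_preimage:
  assumes "nice_pointclass P" "Polish_space Y" "Polish_space Z" "continuous_map Y Z f" "A \<in> P Z"
  shows "{y \<in> topspace Y. f y \<in> A} \<in> P Y"
  using assms unfolding nice_pointclass_def by blast

lemma in_pointclassE:
  assumes "in_pointclass P Z A" "Polish_space Z"
  obtains Y h k where "Polish_space Y" "homeomorphic_maps Z Y h k" "A \<subseteq> topspace Z" "h ` A \<in> P Y"
proof -
  obtain Y h where h: "A \<subseteq> topspace Z" "homeomorphic_map Z Y h" "h ` A \<in> P Y"
    using assms(1) unfolding in_pointclass_def by blast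
  then obtain k where "homeomorphic_maps Z Y h k"
    using homeomorphic_map_maps by blast
  then show ?thesis
    using that[of Y h k] h assms(2) Polish_space_homeomorphic[OF homeomorphic_map_imp_homeomorphic_space[OF h(2)]]
    by blast
qed

text \<open>The witness for \<open>A\<close> fixes a real copy of \<open>Z\<close>, and any real
  copy of \<open>Y\<close> will do; in these copies \<open>f\<close> becomes a map to which closure
  under preimages applies.\<close>

lemma in_pointclass_continuous_preimage:
  assumes P: "nice_pointclass P" and YZ: "Polish_space Y" "Polish_space Z"
    and f: "continuous_map Y Z f" and A: "in_pointclass P Z A"
  shows "in_pointclass P Y {y \<in> topspace Y. f y \<in> A}"
proof -
  obtain Z' h k where Z': "Polish_space Z'" "homeomorphic_maps Z Z' h k" "A \<subseteq> topspace Z" "h ` A \<in> P Z'"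
    using in_pointclassE[OF A YZ(2)] .
  obtain Y' :: "real topology" and h' where Y': "Polish_space Y'" "homeomorphic_map Y Y' h'"
    using Polish_space_real_copy[OF YZ(1)] .
  then obtain k' where k': "homeomorphic_maps Y Y' h' k'"
    using homeomorphic_map_maps by blast
  have cont: "continuous_map Y' Z' (h \<circ> (f \<circ> k'))"
    using k' Z'(2) f unfolding homeomorphic_maps_def by (intro continuous_map_compose) auto
  have "{y \<in> topspace Y'. (h \<circ> (f \<circ> k')) y \<in> h ` A} \<in> P Y'"
    by (rule nice_pointclass_preimage[OF P Y'(1) Z'(1) cont Z'(4)])
  moreover have "{y \<in> topspace Y'. (h \<circ> (f \<circ> k')) y \<in> h ` A} = h' ` {y \<in> topspace Y. f y \<in> A}"
  proof -
    have fin: "f y \<in> topspace Z" if "y \<in> topspace Y" for y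
      using f that unfolding continuous_map_def by auto
    have hA: "h z \<in> h ` A \<longleftrightarrow> z \<in> A" if "z \<in> topspace Z" for z
      using that Z'(2,3) unfolding homeomorphic_maps_def by (metis image_iff subsetD)
    have h'in: "h' y \<in> topspace Y'" "k' (h' y) = y" if "y \<in> topspace Y" for y
      using k' that unfolding homeomorphic_maps_def continuous_map_def by auto
    have k'in: "k' y \<in> topspace Y" "h' (k' y) = y" if "y \<in> topspace Y'" for y
      using k' that unfolding homeomorphic_maps_def continuous_map_def by auto
    show ?thesis
    proof (rule subset_antisym; rule subsetI)
      fix y assume "y \<in> {y \<in> topspace Y'. (h \<circ> (f \<circ> k')) y \<in> h ` A}"
      then have y: "y \<in> topspace Y'" "f (k' y) \<in> A" using hA[OF fin[OF k'in(1)]] by auto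
      then have "h' (k' y) \<in> h' ` {y \<in> topspace Y. f y \<in> A}" using k'in(1) by blast
      then show "y \<in> h' ` {y \<in> topspace Y. f y \<in> A}" using k'in(2)[OF y(1)] by simp
    next
      fix y assume "y \<in> h' ` {y \<in> topspace Y. f y \<in> A}"
      then show "y \<in> {y \<in> topspace Y'. (h \<circ> (f \<circ> k')) y \<in> h ` A}"
        using h'in by auto
    qed
  qed
  ultimately show ?thesis
    unfolding in_pointclass_def using Y'(2) by (metis (no_types, lifting) mem_Collect_eq subsetI)
qed

lemma in_pointclass_continuous_image:
  assumes P: "nice_pointclass P" and YZ: "Polish_space Y" "Polish_space Z"
    and f: "continuous_map Y Z f" and A: "in_pointclass P Y A"
  shows "in_pointclass P Z (f ` A)"
proof -
  obtain Y' h k where Y': "Polish_space Y'" "homeomorphic_maps Y Y' h k" "A \<subseteq> topspace Y" "h ` A \<in> P Y'"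
    using in_pointclassE[OF A YZ(1)] .
  obtain Z' :: "real topology" and h' where Z': "Polish_space Z'" "homeomorphic_map Z Z' h'"
    using Polish_space_real_copy[OF YZ(2)] .
  have cont: "continuous_map Y' Z' (h' \<circ> (f \<circ> k))"
    using Y'(2) homeomorphic_imp_continuous_map[OF Z'(2)] f unfolding homeomorphic_maps_def
    by (intro continuous_map_compose) auto
  have "(h' \<circ> (f \<circ> k)) ` h ` A \<in> P Z'"
    by (rule nice_pointclass_image[OF P Y'(1) Z'(1) cont Y'(4)])
  moreover have "k (h a) = a" if "a \<in> A" for a
    using that Y'(2,3) unfolding homeomorphic_maps_def by auto
  then have "(h' \<circ> (f \<circ> k)) ` h ` A = h' ` f ` A"
    by (force simp: image_iff)
  moreover have "f ` A \<subseteq> topspace Z"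
    using Y'(3) f unfolding continuous_map_def by auto
  ultimately show ?thesis
    unfolding in_pointclass_def using Z'(2) by auto
qed

lemma in_pointclass_imp_meager_or_comeager_on_open:
  assumes "pointclass_has_BP P" "Polish_space Z" "in_pointclass P Z A"
  shows "meager_or_comeager_on_open Z A"
proof -
  obtain Y h k where Y: "Polish_space Y" "homeomorphic_maps Z Y h k" "A \<subseteq> topspace Z" "h ` A \<in> P Y"
    using in_pointclassE[OF assms(3,2)] .
  have "meager_or_comeager_on_open Y (h ` A)"
    using assms(1) Y(1,4) Baire_property_in_imp unfolding pointclass_has_BP_def by blast
  moreover have "homeomorphic_map Y Z k"
    using Y(2) homeomorphic_maps_map homeomorphic_maps_sym by blast
  moreover have "h ` A \<subseteq> topspace Y"
    using Y(2,3) unfolding homeomorphic_maps_def continuous_map_def by auto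
  ultimately have "meager_or_comeager_on_open Z (k ` h ` A)"
    using meager_or_comeager_on_open_homeomorphic by blast
  moreover have "k ` h ` A = A"
    using Y(2,3) unfolding homeomorphic_maps_def by (force simp: image_iff)
  ultimately show ?thesis by simp
qed

text \<open>Quantifying over the conjugator \<open>h\<close> is projection to the first coordinate,
  so closure under preimages and images covers this step.\<close>

lemma conj_step_eq_projection:
  "{q \<in> mspace (loop_space X x). \<exists>h\<in>mspace (loop_space X x).
      restrict (q +++ (h +++ (c +++ reversepath h))) {0..1} \<in> A} =
   fst ` {z \<in> topspace (prod_topology (mtopology_of (loop_space X x)) (mtopology_of (loop_space X x))).
      (case z of (q, h) \<Rightarrow> restrict (q +++ (h +++ (c +++ reversepath h))) {0..1}) \<in> A}"
  by (auto simp: image_iff) blast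

lemma Union_singleton_one_fundamental_group:
  assumes "x \<in> X"
  shows "\<Union>{\<one>\<^bsub>fundamental_group X x\<^esub>} = {p \<in> mspace (loop_space X x). homotopic_paths X p (\<lambda>t. x)}"
  unfolding one_fundamental_group loop_class_def using homotopic_paths_sym_eq[of X "\<lambda>t. x"] by simp

theorem theorem4p2:
  fixes X :: "'a::metric_space set" and x :: 'a
  assumes "Peano_continuum X" and "x \<in> X"
  shows "(\<forall>P N. nice_pointclass P \<longrightarrow> pointclass_has_BP P \<longrightarrow>
             N \<lhd> fundamental_group X x \<longrightarrow> of_pointclass P X x N \<longrightarrow>
             comonster (fundamental_group X x Mod N) \<longrightarrow>
             card_comonster aleph_1 (fundamental_group X x Mod N)) \<and>
         (comonster (fundamental_group X x) \<longrightarrow>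
             card_comonster aleph_1 (fundamental_group X x))"
proof -
  let ?L = "mtopology_of (loop_space X x)"
  have X: "compact X" using assms(1) by (simp add: Peano_continuum_def)
  have L: "Polish_space ?L" by (rule Polish_loop_space[OF X])
  have LL: "Polish_space (prod_topology ?L ?L)" by (rule Polish_space_prod_topology[OF L L])
  interpret G: group "fundamental_group X x" by (rule group_fundamental_group[OF assms(2)])
  note finite_span = finite_normal_span_fundamental_group[OF assms]
  have join: "continuous_map (prod_topology ?L ?L) ?L
      (\<lambda>(q,h). restrict (q +++ (h +++ (c +++ reversepath h))) {0..1})" if "loop_at X x c" for c
    by (rule continuous_map_join_conj) (use loop_atD[OF that] in auto)
  have "card_comonster aleph_1 (fundamental_group X x Mod N)"
    if P: "nice_pointclass P" "pointclass_has_BP P" and N: "N \<lhd> fundamental_group X x"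
      and NP: "of_pointclass P X x N" and "comonster (fundamental_group X x Mod N)" for P N
  proof (rule normal.card_comonster_FactGroupI[OF N _ that(5)])
    fix S assume S: "countable S" "S \<subseteq> carrier (fundamental_group X x)"
      "normal_span (fundamental_group X x) N S = carrier (fundamental_group X x)"
    show "\<exists>F\<subseteq>S. finite F \<and> normal_span (fundamental_group X x) N F = carrier (fundamental_group X x)"
    proof (rule finite_span[of N "in_pointclass P ?L", OF N _ _ _ S])
      show "in_pointclass P ?L (\<Union>N)" using NP by (simp add: of_pointclass_def)
    next
      fix A c assume A: "in_pointclass P ?L A" and c: "loop_at X x c"
      show "in_pointclass P ?L {q \<in> mspace (loop_space X x). \<exists>h\<in>mspace (loop_space X x).
          restrict (q +++ (h +++ (c +++ reversepath h))) {0..1} \<in> A}"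
        unfolding conj_step_eq_projection
        by (intro in_pointclass_continuous_image[OF P(1) LL L continuous_map_fst]
            in_pointclass_continuous_preimage[OF P(1) LL L join[OF c] A])
    next
      fix A and f :: "(nat \<Rightarrow> bool) \<Rightarrow> real \<Rightarrow> 'a"
      assume A: "in_pointclass P ?L A" and f: "continuous_map cantor_space ?L f"
      show "meager_or_comeager_on_open cantor_space {\<sigma>. f \<sigma> \<in> A}"
        using in_pointclass_imp_meager_or_comeager_on_open[OF P(2) Polish_cantor_space
            in_pointclass_continuous_preimage[OF P(1) Polish_cantor_space L f A]] by simp
    qed
  qed
  moreover have "card_comonster aleph_1 (fundamental_group X x)" if "comonster (fundamental_group X x)"
  proof (rule G.card_comonsterI[OF _ that])
    let ?N = "{\<one>\<^bsub>fundamental_group X x\<^esub>}"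
    fix S assume S: "countable S" "S \<subseteq> carrier (fundamental_group X x)"
      "normal_span (fundamental_group X x) ?N S = carrier (fundamental_group X x)"
    have N: "?N \<lhd> fundamental_group X x" by (rule G.one_is_normal)
    show "\<exists>F\<subseteq>S. finite F \<and> normal_span (fundamental_group X x) ?N F = carrier (fundamental_group X x)"
    \<comment> \<open>The analytic sets take the place of a pointclass: closure under continuous
      images and preimages and the category dichotomy are available for them.\<close>
    proof (rule finite_span[of ?N "analytic_in ?L", OF N _ _ _ S])
      show "analytic_in ?L (\<Union>?N)"
        unfolding Union_singleton_one_fundamental_group[OF assms(2)]
        by (rule analytic_in_null_homotopic_loops[OF X])
    next
      fix A c assume A: "analytic_in ?L A" and c: "loop_at X x c"
      show "analytic_in ?L {q \<in> mspace (loop_space X x). \<exists>h\<in>mspace (loop_space X x).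
          restrict (q +++ (h +++ (c +++ reversepath h))) {0..1} \<in> A}"
        unfolding conj_step_eq_projection
        by (rule analytic_in_continuous_image[OF
            analytic_in_continuous_preimage[OF LL Polish_space_Hausdorff[OF L] join[OF c] A] continuous_map_fst])
    next
      fix A and f :: "(nat \<Rightarrow> bool) \<Rightarrow> real \<Rightarrow> 'a"
      assume A: "analytic_in ?L A" and f: "continuous_map cantor_space ?L f"
      show "meager_or_comeager_on_open cantor_space {\<sigma>. f \<sigma> \<in> A}"
        using analytic_in_meager_or_comeager_on_open[OF Polish_cantor_space
            analytic_in_continuous_preimage[OF Polish_cantor_space Polish_space_Hausdorff[OF L] f A]] by simp
    qed
  qed
  ultimately show ?thesis by blast
qed

end
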